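(* Suppose all the assumptions listed in the context hold. Let $N\ge2$ and run Algorithm CC-SCGD with $\lambda_0=0$, $\tau_t=\rho_t=t/2$, $\alpha_t=2\sqrt N$ and $\eta_t=\frac{15C_{g_1}^2C_{g_2}^2\sqrt N}{2}$ for all $0\le t\le N$. Let $\sigma_H>0$ be the constant bounding the conditional variance of $H_t$ (see context), let $$Q=2L_{g_1}\sigma_{g_2}^2\|\lambda^*\|+3C_{g_1}\sigma_{g_2}\|\lambda^*\|+\|\lambda^*\|\sigma_H+2L_{f_1}\sigma_{f_2}^2+3C_{f_1}\sigma_{f_2},$$ $$R=\frac{7C_{f_1}^2C_{f_2}^2}{C_{g_1}^2C_{g_2}^2}+6\|\lambda^*\|^2+\frac{D_X^2C_{g_1}^2C_{g_2}^2+\sigma_H^2}{2}+\frac{15C_{g_1}^2C_{g_2}^2}{4}\|x_0-x^*\|^2+\|\lambda_0-\lambda^*\|^2+Q,$$ let $\bar x_N=\frac1N\sum_{t=1}^Nx_t$, and let $\tilde\lambda=(\|\lambda^*\|+1)\frac{G(\bar x_N)_+}{\|G(\bar x_N)_+\|}$, so that $\|\tilde\lambda\|=\|\lambda^*\|+1$ and $\|\tilde\lambda\|^2=(\|\lambda^*\|+1)^2$ (only these values enter below). Then $$\mathbb E[F(\bar x_N)-F(x^* )]\le\frac1{\sqrt N}\Big(\frac{15C_{g_1}^2C_{g_2}^2}{4}\|x_0-x^*\|^2+\frac{7C_{f_1}^2C_{f_2}^2}{C_{g_1}^2C_{g_2}^2}+\frac{D_X^2C_{g_1}^2C_{g_2}^2+\sigma_H^2}{2}+2L_{f_1}\sigma_{f_2}^2+3C_{f_1}\sigma_{f_2}\Big)+\frac{4}{3\sqrt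 N}\big(\|\lambda^*\|^2+2Re^2\big)$$ and $$\begin{aligned}\mathbb E\big[\|G(\bar x_N)_+\|\big]\le{}&\frac1{\sqrt N}\Big(\frac{16}{3}\|\tilde\lambda\|^2+2L_{g_1}\sigma_{g_2}^2\|\tilde\lambda\|+3C_{g_1}\sigma_{g_2}\|\tilde\lambda\|+\frac{15C_{g_1}^2C_{g_2}^2}{4}\|x_0-x^*\|^2+\frac{7C_{f_1}^2C_{f_2}^2}{C_{g_1}^2C_{g_2}^2}\Big)\\&+\frac1{\sqrt N}\Big(\frac{D_X^2C_{g_1}^2C_{g_2}^2+\sigma_H^2}{2}+\|\tilde\lambda\|^2+\sigma_H\|\tilde\lambda\|+2L_{f_1}\sigma_{f_2}^2+3C_{f_1}\sigma_{f_2}\Big)+\frac1{\sqrt N}\big(\|\tilde\lambda\|+\|\lambda^*\|^2+2Re^2\big),\end{aligned}$$ where $G(x)_+=\max\{G(x),0\}$ componentwise.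
   Context: Problem. $\mathcal X\subset\mathbb R^{d_x}$ is convex and closed; $\xi_1,\xi_2,\zeta_1,\zeta_2$ are random vectors. Minimize $F(x)=f_1(f_2(x))$ over $x\in\mathcal X$ subject to $G(x)=g_1(g_2(x))\le0$ (componentwise, $m$ constraints), where $f_1(y)=\mathbb E[f_1(y,\xi_1)]:\mathbb R^{d_y}\to\mathbb R$ is convex and differentiable, $f_2(x)=\mathbb E[f_2(x,\xi_2)]:\mathbb R^{d_x}\to\mathbb R^{d_y}$, $g_1(z)=\mathbb E[g_1(z,\zeta_1)]:\mathbb R^{d_z}\to\mathbb R^m$ (differentiable), $g_2(x)=\mathbb E[g_2(x,\zeta_2)]:\mathbb R^{d_x}\to\mathbb R^{d_z}$ and $G$ have convex components, and $F$ is convex. For vector-valued functions, $\partial$ and $\nabla$ denote matrices whose $j$-th column is a (sub)gradient of the $j$-th component; $\partial f_2(x,\xi_2)$, $\nabla f_1(y,\xi_1)$, $\partial g_2(x,\zeta_2)\in\mathbb R^{d_x\times d_z}$, $\nabla g_1(z,\zeta_1)\in\mathbb R^{d_z\times m}$ denote stochastic (sub)gradients returned by the sampling oracle. $\|\cdot\|$ is the Euclidean norm. Saddle point. There is $(x^*,\lambda^* )\in\mathcal X\times\mathbb R_+^m$ such that $\mathcal L(x,\lambda)=F(x)+\langle G(x),\lambda\rangle$ satisfies $\mathcal L(x^*,\lambda)\le\mathcal L(x^*,\lambda^* )\le\mathcal L(x,\lambda^* )$ for all $(x,\lambda)\in\mathcal X\times\mathbb R_+^m$. Assumptions, with positive constants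 $C_{f_1},C_{f_2},\sigma_{f_1},\sigma_{f_2},L_{f_1},D_X,C_{g_1},C_{g_2},\sigma_{g_1},\sigma_{g_2},L_{g_1}$. On the objective: (a) $\mathcal X$ is convex and bounded, $\sup_{x\in\mathcal X}\|x-x^*\|\le D_X$. (b) $f_1,f_2$ are convex with $f_1(y)=\max_{\pi_1\in\Pi_1}\langle\pi_1,y\rangle-f_1^*(\pi_1)$ for $y\in\mathbb R^{d_y}$ and $f_2(x)=\max_{\pi_2\in\Pi_2}\pi_2^\top x-f_2^*(\pi_2)$ (componentwise) for $x\in\mathcal X$, where conjugates of vector-valued functions are taken componentwise ($j$-th component $=$ Fenchel conjugate of the $j$-th component function at the $j$-th column of the argument) and $\Pi_1\subset\mathbb R^{d_y}$, $\Pi_2\subset\mathbb R^{d_x\times d_y}$ are the domains of $f_1^*,f_2^*$. (c) $\nabla f_1$ is $L_{f_1}$-Lipschitz. (d) $\mathbb E[f_2(x,\xi_2)]=f_2(x)$, $\mathbb E\|f_2(x,\xi_2)-f_2(x)\|^2=\sigma_{f_2}^2$ for all $x\in\mathcal X$. (e) $\mathbb E[f_1(y,\xi_1)]=f_1(y)$, $\mathbb E(f_1(y,\xi_1)-f_1(y))^2=\sigma_{f_1}^2$ for all $y$. (f) $\mathbb E[\partial f_2(x,\xi_2)]\in\partial f_2(x)$, $\mathbb E\|\partial f_2(x,\xi_2)\|^2\le C_{f_2}^2$ for all $x\in\mathcal X$. (g) $\mathbb E[\nabla f_1(y,\xi_1)]=\nabla f_1(y)$, $\mathbb E\|\nabla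 f_1(y,\xi_1)\|^2\le C_{f_1}^2$ for all $y$. If $f_2$ is not affine then $\nabla f_1(y)\ge0$ componentwise for all $y$. On the constraints: $g_1(z)=\max_{v_1\in\mathcal V_1}v_1^\top z-g_1^*(v_1)$ for $z\in\mathbb R^{d_z}$ and $g_2(x)=\max_{v_2\in\mathcal V_2}v_2^\top x-g_2^*(v_2)$ for $x\in\mathcal X$ (componentwise), $\mathcal V_1\subset\mathbb R^{d_z\times m}$, $\mathcal V_2\subset\mathbb R^{d_x\times d_z}$ the domains of $g_1^*,g_2^*$; for all $z$: $\mathbb E[g_1(z,\zeta_1)]=g_1(z)$, $\mathbb E\|g_1(z,\zeta_1)-g_1(z)\|^2\le\sigma_{g_1}^2$, $\mathbb E[\nabla g_1(z,\zeta_1)]=\nabla g_1(z)$, $\mathbb E\|\nabla g_1(z,\zeta_1)\|^2\le C_{g_1}^2$; for all $x\in\mathcal X$: $\mathbb E[g_2(x,\zeta_2)]=g_2(x)$, $\mathbb E\|g_2(x,\zeta_2)-g_2(x)\|^2\le\sigma_{g_2}^2$, $\mathbb E[\partial g_2(x,\zeta_2)]\in\partial g_2(x)$, $\mathbb E\|\partial g_2(x,\zeta_2)\|^2\le C_{g_2}^2$; $\|\nabla g_1(z_1)-\nabla g_1(z_2)\|\le L_{g_1}\|z_1-z_2\|$ for all $z_1,z_2$; for each constraint $G^{(j)}$, its outer-level function is monotone non-decreasing if its inner-level function is non-affine. Algorithm CC-SCGD. Given step-sizes $\alpha_t,\eta_t,\tau_t,\rho_t$, $x_0\in\mathcal X$,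 $y_0=0$, $z_0=0$, $\lambda_0\in\mathbb R_+^m$, for $t=0,\dots,N-1$: $y_{t+1}=\frac{f_2(x_t,\xi_{2,t}^1)+\tau_ty_t}{1+\tau_t}$, $z_{t+1}=\frac{g_2(x_t,\zeta_{2,t}^1)+\rho_tz_t}{1+\rho_t}$; $x_{t+1}=\mathrm{Proj}_{\mathcal X}\big[x_t-\frac1{\eta_t}\big(\partial f_2(x_t,\xi_{2,t}^0)\nabla f_1(y_{t+1},\xi_{1,t}^0)+\partial g_2(x_t,\zeta_{2,t}^0)\nabla g_1(z_{t+1},\zeta_{1,t}^0)\lambda_t\big)\big]$; $H_{t+1}=g_1(z_{t+1},\zeta_{1,t}^1)-\nabla g_1(z_{t+1},\zeta_{1,t}^1)^\top z_{t+1}+\nabla g_1(z_{t+1},\zeta_{1,t}^1)^\top g_2(x_t,\zeta_{2,t}^2)$; $\lambda_{t+1}=[\lambda_t+H_{t+1}/\alpha_t]_+$. All samples with distinct indices are mutually independent copies of $\xi_1,\xi_2,\zeta_1,\zeta_2$. Constant $\sigma_H$. Let $v_{2,t}\in\operatorname{argmax}_{v_2\in\mathcal V_2}\{v_2^\top x_{t-1}-g_2^*(v_2)\}$ (so $v_{2,t}\in\partial g_2(x_{t-1})$) and $v_{1,t}=\nabla g_1(z_t)$. $\sigma_H>0$ denotes a constant with $\mathrm{Var}(H_t\mid x_{t-1},v_{1,t},v_{2,t})\le\sigma_H^2$ for all $t$ (its existence is a lemma of the paper), where the variance of a random vector is the expected squared Euclidean distance to its (conditional) mean. *)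

theory Defs
  imports "HOL-Probability.Probability"
begin

text \<open>
  A matrix in \<open>R^{d \<times> k}\<close> has type \<open>real^'k^'d\<close>; its \<open>norm\<close> is the Euclidean (Frobenius) norm.
  (Sub)gradients of a function into \<open>real^'k\<close> are such matrices, the \<open>j\<close>-th
  \<open>column\<close> being a (sub)gradient of the \<open>j\<close>-th component.
\<close>

definition affine_map :: "(real^'n \<Rightarrow> real^'k) \<Rightarrow> bool" where
  "affine_map f \<longleftrightarrow> (\<exists>A b. \<forall>x. f x = A *v x + b)"

definition pos_part :: "real^'k \<Rightarrow> real^'k" where
  "pos_part v = (\<chi> j. max (v $ j) 0)"

definition subdiff :: "('a::real_inner \<Rightarrow> real) \<Rightarrow> 'a \<Rightarrow> 'a set" where
  "subdiff f x = {s. \<forall>y. f x + s \<bullet> (y - x) \<le> f y}"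

definition vec_subdiff :: "(real^'n \<Rightarrow> real^'k) \<Rightarrow> real^'n \<Rightarrow> (real^'k^'n) set" where
  "vec_subdiff f x = {S. \<forall>j. column j S \<in> subdiff (\<lambda>u. f u $ j) x}"

definition vec_has_gradient :: "(real^'n \<Rightarrow> real^'k) \<Rightarrow> real^'k^'n \<Rightarrow> real^'n \<Rightarrow> bool" where
  "vec_has_gradient f D x \<longleftrightarrow> (\<forall>j. GDERIV (\<lambda>u. f u $ j) x :> column j D)"

definition fenchel_conj :: "('a::real_inner \<Rightarrow> real) \<Rightarrow> 'a \<Rightarrow> ereal" where
  "fenchel_conj f p = (SUP x. ereal (p \<bullet> x - f x))"

definition conj_dom :: "('a::real_inner \<Rightarrow> real) \<Rightarrow> 'a set" where
  "conj_dom f = {p. fenchel_conj f p < \<infinity>}"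

definition vec_conj_dom :: "(real^'n \<Rightarrow> real^'k) \<Rightarrow> (real^'k^'n) set" where
  "vec_conj_dom f = {P. \<forall>j. column j P \<in> conj_dom (\<lambda>u. f u $ j)}"

text \<open>
  The objective functions \<open>\<langle>p, x\<rangle> - f\<^sup>*(p)\<close> and (componentwise) \<open>P\<^sup>T x - f\<^sup>*(P)\<close> of the dual
  representations. They are only used for \<open>p\<close> in the domain of the conjugate; there the
  conjugate of a real-valued function is finite, so \<open>real_of_ereal\<close> loses nothing.
\<close>

definition dual_obj :: "('a::real_inner \<Rightarrow> real) \<Rightarrow> 'a \<Rightarrow> 'a \<Rightarrow> real" where
  "dual_obj f x p = p \<bullet> x - real_of_ereal (fenchel_conj f p)"

definition vec_dual_obj :: "(real^'n \<Rightarrow> real^'k) \<Rightarrow> real^'n \<Rightarrow> real^'k^'n \<Rightarrow> real^'k" where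
  "vec_dual_obj f x P =
     transpose P *v x - (\<chi> j. real_of_ereal (fenchel_conj (\<lambda>u. f u $ j) (column j P)))"

text \<open>For vector-valued \<open>h\<close> the order below is the componentwise one.\<close>

definition argmax_on :: "'a set \<Rightarrow> ('a \<Rightarrow> 'b::order) \<Rightarrow> 'a set" where
  "argmax_on S h = {p \<in> S. \<forall>q\<in>S. h q \<le> h p}"

definition is_max_on :: "'a set \<Rightarrow> ('a \<Rightarrow> 'b::order) \<Rightarrow> 'b \<Rightarrow> bool" where
  "is_max_on S h c \<longleftrightarrow> (\<exists>p \<in> argmax_on S h. c = h p)"

text \<open>
  Conditional variance of a random vector: the conditional expectation of the squared distance
  to the (componentwise) conditional mean. It takes values in \<open>ennreal\<close>, so that a bound on it
  also expresses its finiteness.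
\<close>

definition cond_mean ::
  "'w measure \<Rightarrow> 'w measure \<Rightarrow> ('w \<Rightarrow> real^'k) \<Rightarrow> 'w \<Rightarrow> real^'k" where
  "cond_mean M A H = (\<lambda>\<omega>. \<chi> j. real_cond_exp M A (\<lambda>\<omega>'. H \<omega>' $ j) \<omega>)"

definition cond_variance ::
  "'w measure \<Rightarrow> 'w measure \<Rightarrow> ('w \<Rightarrow> real^'k) \<Rightarrow> 'w \<Rightarrow> ennreal" where
  "cond_variance M A H =
     nn_cond_exp M A (\<lambda>\<omega>. ennreal ((norm (H \<omega> - cond_mean M A H \<omega>))\<^sup>2))"

abbreviation generated_algebra ::
  "'w measure \<Rightarrow> ('w \<Rightarrow> 'b::topological_space) \<Rightarrow> 'w measure" where
  "generated_algebra M Y \<equiv> vimage_algebra (space M) Y borel"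

text \<open>
  Samples carry a superscript \<open>k\<close> and a time \<open>t\<close>; e.g. \<open>Zeta2 k t\<close> is the index of
  \<open>\<zeta>\<^sub>2\<^sub>,\<^sub>t\<^sup>k\<close>. As the four kinds of samples live in spaces of different dimension, mutual
  independence is stated for the generated sigma-algebras.
\<close>

datatype sample_index = Xi1 nat nat | Xi2 nat nat | Zeta1 nat nat | Zeta2 nat nat

definition sample_indices :: "nat \<Rightarrow> sample_index set" where
  "sample_indices N =
     {Xi1 0 t | t. t < N} \<union> {Xi2 k t | k t. k < 2 \<and> t < N} \<union>
     {Zeta1 k t | k t. k < 2 \<and> t < N} \<union> {Zeta2 k t | k t. k < 3 \<and> t < N}"

definition is_copy_of ::
  "'w measure \<Rightarrow> ('w \<Rightarrow> 'b::topological_space) \<Rightarrow> ('w \<Rightarrow> 'b) \<Rightarrow> bool" where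
  "is_copy_of M Y Y0 \<longleftrightarrow> Y \<in> borel_measurable M \<and> distr M borel Y = distr M borel Y0"

definition independent_copies ::
  "'w measure \<Rightarrow> nat \<Rightarrow>
   ('w \<Rightarrow> real^'p1) \<Rightarrow> ('w \<Rightarrow> real^'p2) \<Rightarrow> ('w \<Rightarrow> real^'q1) \<Rightarrow> ('w \<Rightarrow> real^'q2) \<Rightarrow>
   (nat \<Rightarrow> nat \<Rightarrow> 'w \<Rightarrow> real^'p1) \<Rightarrow> (nat \<Rightarrow> nat \<Rightarrow> 'w \<Rightarrow> real^'p2) \<Rightarrow>
   (nat \<Rightarrow> nat \<Rightarrow> 'w \<Rightarrow> real^'q1) \<Rightarrow> (nat \<Rightarrow> nat \<Rightarrow> 'w \<Rightarrow> real^'q2) \<Rightarrow> bool" where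
  "independent_copies M N X1 X2 Z1 Z2 xi1 xi2 zeta1 zeta2 \<longleftrightarrow>
     (\<forall>i \<in> sample_indices N. case i of
         Xi1 k t \<Rightarrow> is_copy_of M (xi1 k t) X1
       | Xi2 k t \<Rightarrow> is_copy_of M (xi2 k t) X2
       | Zeta1 k t \<Rightarrow> is_copy_of M (zeta1 k t) Z1
       | Zeta2 k t \<Rightarrow> is_copy_of M (zeta2 k t) Z2) \<and>
     prob_space.indep_sets M
       (\<lambda>i. case i of
           Xi1 k t \<Rightarrow> sets (generated_algebra M (xi1 k t))
         | Xi2 k t \<Rightarrow> sets (generated_algebra M (xi2 k t))
         | Zeta1 k t \<Rightarrow> sets (generated_algebra M (zeta1 k t))
         | Zeta2 k t \<Rightarrow> sets (generated_algebra M (zeta2 k t)))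
       (sample_indices N)"

text \<open>
  A sampling oracle \<open>h u s\<close> depends on the query point \<open>u\<close> and the sample \<open>s\<close>. Joint measurability
  makes oracle outputs at random query points, hence all iterates, random variables.
\<close>

definition jointly_measurable ::
  "('u::topological_space \<Rightarrow> 's::topological_space \<Rightarrow> 'v::topological_space) \<Rightarrow> bool" where
  "jointly_measurable h \<longleftrightarrow> (\<lambda>(u, s). h u s) \<in> borel \<Otimes>\<^sub>M borel \<rightarrow>\<^sub>M borel"

definition second_moment_le :: "'w measure \<Rightarrow> ('w \<Rightarrow> 'v::real_normed_vector) \<Rightarrow> real \<Rightarrow> bool" where
  "second_moment_le M Y c \<longleftrightarrow>
     integrable M (\<lambda>\<omega>. (norm (Y \<omega>))\<^sup>2) \<and> (\<integral>\<omega>. (norm (Y \<omega>))\<^sup>2 \<partial>M) \<le> c"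

end

theory Submission
  imports Defs
begin

text \<open>
  Both bounds are instances of one estimate for the gap
  \<open>F(xbar) - F(x*) + \<langle>G(xbar), l\<rangle>\<close> with an arbitrary multiplier \<open>l \<ge> 0\<close>. The choice \<open>l = 0\<close> gives the
  bound on the objective. The choice \<open>l = (\<parallel>\<lambda>*\<parallel> + 1) G(xbar)\<^sub>+ / \<parallel>G(xbar)\<^sub>+\<parallel>\<close> gives the bound on the
  infeasibility, since the saddle point implies
  \<open>F(xbar) - F(x*) \<ge> - \<langle>G(xbar), \<lambda>*\<rangle> \<ge> - \<parallel>\<lambda>*\<parallel> \<parallel>G(xbar)\<^sub>+\<parallel>\<close>. That multiplier depends on the outcome of the
  run. So the estimate is first proved for every single outcome (\<open>pathwise_gap\<close>), with a right-hand
  side that depends on \<open>l\<close> only through its norm, and expectations are taken afterwards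
  (\<open>expected_gap\<close>).

  The difficulty is the composition. The gradient used at time \<open>t\<close> is taken at \<open>y\<^bsub>t+1\<^esub>\<close>, which is not
  close to \<open>f2(x\<^sub>t)\<close>: it is an average of noisy values of \<open>f2\<close> at all previous iterates. What the
  method controls is therefore the linearization of \<open>f1\<close> at \<open>y\<^bsub>t+1\<^esub>\<close>, evaluated at \<open>f2(x\<^sub>t)\<close>. For a
  convex \<open>\<phi>\<close> and a reference point \<open>r\<close> put \<open>B\<^sub>t = \<phi>(y\<^sub>t) - \<phi>(r) - \<langle>\<nabla>\<phi>(r), y\<^sub>t - r\<rangle> \<ge> 0\<close>. If
  \<open>(1 + \<tau>\<^sub>t) y\<^bsub>t+1\<^esub> = u\<^sub>t + \<tau>\<^sub>t y\<^sub>t\<close>, then the linearization of \<open>\<phi>\<close> at \<open>y\<^bsub>t+1\<^esub>\<close>, evaluated at \<open>u\<^sub>t\<close>, equals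
  the one at \<open>r\<close> plus \<open>(1 + \<tau>\<^sub>t) B\<^bsub>t+1\<^esub> - \<tau>\<^sub>t B\<^sub>t\<close> plus a nonnegative term. As \<open>\<tau>\<^bsub>t+1\<^esub> \<le> 1 + \<tau>\<^sub>t\<close> and
  \<open>\<tau>\<^sub>0 = 0\<close>, the sum over \<open>t\<close> of the extra terms is nonnegative (\<open>averaged_tracking\<close>). With
  \<open>r = f2(xbar)\<close> and the monotonicity of the outer function, the sum of the linearizations dominates
  \<open>N F(xbar)\<close> up to noise (\<open>composite_gap\<close>). The same argument applies to \<open>\<langle>l, g1\<rangle>\<close>.

  The noise of a value oracle is uncorrelated with everything that was sampled before, so its sums
  have norm of order \<open>sqrt N\<close>. It also enters \<open>y\<^bsub>t+1\<^esub>\<close> itself; by smoothness this costs at most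
  \<open>L \<parallel>\<epsilon>\<^sub>t\<parallel>^2 / (1 + \<tau>\<^sub>t)\<close>, whose sum is again of order \<open>sqrt N\<close> (\<open>expected_noise\<close>). All statements about
  fresh samples rest on one fact: a fresh sample is independent of the history, so that the joint law
  is a product and expectations may be computed with the query point frozen (\<open>freeze_nn\<close>,
  \<open>freeze_integral\<close>).

  The multipliers enter the primal gradients, hence \<open>E \<parallel>\<lambda>\<^sub>t\<parallel>^2\<close> has to be bounded. For \<open>l = \<lambda>*\<close> the gap is
  nonnegative, and what remains of the estimate bounds \<open>E \<parallel>\<lambda>\<^sub>n - \<lambda>*\<parallel>^2\<close> by \<open>3 R\<close> plus \<open>2/15\<close> times an average
  of the earlier \<open>E \<parallel>\<lambda>\<^sub>t\<parallel>^2\<close>. The factor \<open>2 \<cdot> 2/15\<close> is below one, so the recursion closes and gives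
  \<open>E \<parallel>\<lambda>\<^sub>t\<parallel>^2 \<le> 9 R\<close> (\<open>averaged_recursion_bound\<close>).
\<close>

section \<open>Matrices, gradients and projections\<close>

lemma norm_matrix_vector_le:
  fixes A :: "real^'k^'d"
  shows "norm (A *v v) \<le> norm A * norm v"
proof -
  have "norm (A *v v) \<le> L2_set (\<lambda>i. norm (A $ i) * norm v) UNIV"
    unfolding norm_vec_def[of "A *v v"]
    by (intro L2_set_mono) (auto simp: matrix_vector_mul_component Cauchy_Schwarz_ineq2)
  also have "\<dots> = norm A * norm v"
    by (simp add: L2_set_left_distrib norm_vec_def[of A])
  finally show ?thesis .
qed

lemma norm_transpose:
  fixes A :: "real^'k^'d"
  shows "norm (transpose A) = norm A"
proof -
  have "(norm (transpose A))^2 = (norm A)^2"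
    unfolding dot_square_norm[symmetric] inner_vec_def transpose_def
    by (simp, rule sum.swap)
  thus ?thesis by (simp add: power2_eq_iff_nonneg)
qed

lemma transpose_vector_inner:
  fixes A :: "real^'k^'d"
  shows "(transpose A *v d) \<bullet> l = d \<bullet> (A *v l)"
  by (simp add: dot_lmul_matrix)

lemma matrix_vector_inner_columns:
  fixes A :: "real^'k^'d"
  shows "(A *v p) \<bullet> d = (\<Sum>j\<in>UNIV. p $ j * (column j A \<bullet> d))"
  by (simp add: matrix_mult_sum inner_sum_left scalar_mult_eq_scaleR)

text \<open>Restricting to the line through the two points reduces this to the tangent inequality on the reals.\<close>

lemma convex_tangent_le:
  fixes f :: "'a::real_inner \<Rightarrow> real"
  assumes cvx: "convex_on UNIV f" and grad: "GDERIV f r :> D"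
  shows "f r + D \<bullet> (y - r) \<le> f y"
proof -
  define g where "g s = f (r + s *\<^sub>R (y - r))" for s :: real
  have "convex_on UNIV g"
  proof (rule convex_onI)
    fix t a b :: real assume t: "0 < t" "t < 1"
    have "r + ((1 - t) *\<^sub>R a + t *\<^sub>R b) *\<^sub>R (y - r)
        = (1 - t) *\<^sub>R (r + a *\<^sub>R (y - r)) + t *\<^sub>R (r + b *\<^sub>R (y - r))"
      by (simp add: algebra_simps)
    thus "g ((1 - t) *\<^sub>R a + t *\<^sub>R b) \<le> (1 - t) * g a + t * g b"
      unfolding g_def using convex_onD[OF cvx, of t] t by simp
  qed auto
  moreover have "(g has_real_derivative D \<bullet> (y - r)) (at 0 within UNIV)"
  proof -
    have line: "((\<lambda>s::real. r + s *\<^sub>R (y - r)) has_derivative (\<lambda>s. s *\<^sub>R (y - r))) (at 0)"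
      by (auto intro!: derivative_eq_intros)
    have "(f has_derivative (\<lambda>h. D \<bullet> h)) (at (r + 0 *\<^sub>R (y - r)))"
      using grad by (simp add: gderiv_def inner_commute)
    from has_derivative_compose[OF line this]
    show ?thesis
      unfolding g_def has_field_derivative_def
      by (rule has_derivative_eq_rhs) (simp add: fun_eq_iff mult.commute)
  qed
  ultimately have "g 1 - g 0 \<ge> (D \<bullet> (y - r)) * (1 - 0)"
    by (intro convex_on_imp_above_tangent) auto
  thus ?thesis by (simp add: g_def)
qed

lemma mono_gradient_nonneg:
  fixes f :: "real^'n \<Rightarrow> real"
  assumes mono: "mono f" and grad: "GDERIV f r :> D"
  shows "0 \<le> D"
proof -
  have "0 \<le> D $ i" for i
  proof -
    define g where "g s = f (r + s *\<^sub>R axis i 1)" for s :: real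
    have line: "((\<lambda>s::real. r + s *\<^sub>R axis i 1) has_derivative (\<lambda>s. s *\<^sub>R axis i 1)) (at 0)"
      by (auto intro!: derivative_eq_intros)
    have "(f has_derivative (\<lambda>h. D \<bullet> h)) (at (r + 0 *\<^sub>R axis i 1))"
      using grad by (simp add: gderiv_def inner_commute)
    from has_derivative_compose[OF line this]
    have der: "(g has_real_derivative D $ i) (at 0)"
      unfolding g_def has_field_derivative_def
      by (rule has_derivative_eq_rhs) (simp add: fun_eq_iff inner_axis mult.commute)
    have "mono_on UNIV g"
      unfolding g_def
      by (intro mono_onI monoD[OF mono]) (auto simp: less_eq_vec_def axis_def)
    from mono_on_imp_deriv_nonneg[OF this der] show ?thesis by simp
  qed
  thus ?thesis by (simp add: less_eq_vec_def)
qed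

text \<open>
  The projection does not increase the distance to a point of the set; expanding the squared
  distance of the unprojected step gives the claim.
\<close>

lemma projected_step:
  fixes X :: "(real^'x) set"
  assumes X: "closed X" "convex X" and u: "u \<in> X" and e: "0 < \<eta>"
  shows "w \<bullet> (p - u) \<le> \<eta> / 2 * ((norm (p - u))^2
           - (norm (closest_point X (p - (1 / \<eta>) *\<^sub>R w) - u))^2) + (norm w)^2 / (2 * \<eta>)"
proof -
  let ?v = "p - (1 / \<eta>) *\<^sub>R w"
  have "dist (closest_point X ?v) (closest_point X u) \<le> dist ?v u"
    using X u by (intro closest_point_lipschitz) auto
  hence "norm (closest_point X ?v - u) \<le> norm (?v - u)"
    using closest_point_self[OF u] by (simp add: dist_norm)
  hence "(norm (closest_point X ?v - u))^2 \<le> (norm (?v - u))^2"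
    by (intro power_mono) auto
  also have "?v - u = (p - u) - (1 / \<eta>) *\<^sub>R w" by simp
  also have "(norm ((p - u) - (1 / \<eta>) *\<^sub>R w))^2
      = (norm (p - u))^2 - 2 / \<eta> * (w \<bullet> (p - u)) + (norm w)^2 / \<eta>^2"
    unfolding power2_norm_eq_inner
    by (simp add: inner_diff_left inner_diff_right inner_commute) (use e in \<open>simp add: field_simps power2_eq_square\<close>)
  finally have "\<eta> / 2 * (norm (closest_point X ?v - u))^2
     \<le> \<eta> / 2 * ((norm (p - u))^2 - 2 / \<eta> * (w \<bullet> (p - u)) + (norm w)^2 / \<eta>^2)"
    using e by (intro mult_left_mono) auto
  also have "\<dots> = \<eta> / 2 * (norm (p - u))^2 - w \<bullet> (p - u) + (norm w)^2 / (2 * \<eta>)"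
    using e by (simp add: field_simps power2_eq_square)
  finally show ?thesis by (simp add: algebra_simps)
qed

lemma pos_part_nonneg: "0 \<le> pos_part v"
  by (simp add: pos_part_def less_eq_vec_def)

lemma pos_part_ge: "v \<le> pos_part v"
  by (simp add: pos_part_def less_eq_vec_def)

lemma pos_part_inner_self: "v \<bullet> pos_part v = (norm (pos_part v))^2"
  unfolding power2_norm_eq_inner inner_vec_def pos_part_def
  by (intro sum.cong refl) (auto simp: max_def)

lemma norm_pos_part_le: "norm (pos_part v) \<le> norm v"
  unfolding norm_vec_def pos_part_def by (intro L2_set_mono) auto

lemma continuous_pos_part: "continuous_on S pos_part"
  unfolding pos_part_def[abs_def] by (intro continuous_intros)

lemma inner_nonneg_vec:
  fixes u v :: "real^'m"
  assumes "0 \<le> u" "0 \<le> v"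
  shows "0 \<le> u \<bullet> v"
  using assms by (auto simp: inner_vec_def less_eq_vec_def intro!: sum_nonneg)

text \<open>
  The projected ascent step is a proximal step. Unlike the bound that follows from non-expansiveness
  alone, this form keeps the term \<open>- \<parallel>q - p\<parallel>^2\<close>, which later absorbs the mismatch between the
  old and the new multiplier. A bound on \<open>\<parallel>h\<parallel>\<close> would be useless, since the constraint values can be
  arbitrarily negative.
\<close>

lemma dual_step:
  fixes l p h :: "real^'m"
  assumes a: "0 < \<alpha>" and l: "0 \<le> l"
  defines "q \<equiv> pos_part (p + (1 / \<alpha>) *\<^sub>R h)"
  shows "h \<bullet> (l - q) \<le> \<alpha> / 2 * ((norm (p - l))^2 - (norm (q - l))^2 - (norm (q - p))^2)"
proof -
  have "h \<bullet> (l - q) - \<alpha> * ((q - p) \<bullet> (l - q)) = - \<alpha> * ((q - (p + (1 / \<alpha>) *\<^sub>R h)) \<bullet> (l - q))"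
    using a by (simp add: inner_diff_left inner_add_left algebra_simps)
  also have "\<dots> \<le> 0"
  proof -
    have "0 \<le> (q - (p + (1 / \<alpha>) *\<^sub>R h)) \<bullet> l"
      unfolding q_def using pos_part_ge by (intro inner_nonneg_vec l) auto
    moreover have "(q - (p + (1 / \<alpha>) *\<^sub>R h)) \<bullet> q = 0"
      unfolding q_def inner_diff_left pos_part_inner_self by (simp add: power2_norm_eq_inner)
    ultimately show ?thesis using a by (simp add: inner_diff_right)
  qed
  also have "(q - p) \<bullet> (l - q) = ((norm (p - l))^2 - (norm (q - l))^2 - (norm (q - p))^2) / 2"
    unfolding power2_norm_eq_inner
    by (simp add: inner_diff_left inner_diff_right inner_commute)
  finally show ?thesis by simp
qed

section \<open>One level of the composition\<close>

text \<open>
  The chain rule of the method, as an inequality: for \<open>p \<ge> 0\<close> it sums the subgradient inequalities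
  of the components; for affine \<open>h\<close> these are equalities, as can be seen by reflecting \<open>v\<close> at \<open>u\<close>,
  and may be multiplied by numbers of either sign.
\<close>

lemma subdiff_monotone_composition:
  fixes h :: "real^'x \<Rightarrow> real^'y"
  assumes D: "D \<in> vec_subdiff h u" and p: "affine_map h \<or> 0 \<le> p"
  shows "p \<bullet> (h u - h v) \<le> (D *v p) \<bullet> (u - v)"
proof -
  have sub: "h u $ j + column j D \<bullet> (w - u) \<le> h w $ j" for j w
    using D by (auto simp: vec_subdiff_def subdiff_def)
  have "p $ j * (h u $ j - h v $ j) \<le> p $ j * (column j D \<bullet> (u - v))" for j
    using p
  proof
    assume "0 \<le> p"
    hence "0 \<le> p $ j" by (simp add: less_eq_vec_def)
    thus ?thesis using sub[of j v] by (intro mult_left_mono) (auto simp: inner_diff_right)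
  next
    assume "affine_map h"
    then obtain A b where h: "\<And>x. h x = A *v x + b" by (auto simp: affine_map_def)
    have "h (2 *\<^sub>R u - v) $ j = 2 * h u $ j - h v $ j"
      unfolding h by (simp add: matrix_vector_mult_diff_distrib matrix_vector_mult_scaleR)
    hence "column j D \<bullet> (u - v) = h u $ j - h v $ j"
      using sub[of j v] sub[of j "2 *\<^sub>R u - v"]
      by (simp add: inner_diff_right inner_add_right scaleR_2)
    thus ?thesis by simp
  qed
  hence "(\<Sum>j\<in>UNIV. p $ j * (h u $ j - h v $ j)) \<le> (\<Sum>j\<in>UNIV. p $ j * (column j D \<bullet> (u - v)))"
    by (intro sum_mono)
  also have "(\<Sum>j\<in>UNIV. p $ j * (h u $ j - h v $ j)) = p \<bullet> (h u - h v)"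
    by (simp add: inner_vec_def)
  finally show ?thesis unfolding matrix_vector_inner_columns .
qed

text \<open>
  Each component of the difference lies between the values of the two subgradients on \<open>u - v\<close>, so
  its square is at most the sum of their squares. This costs the factor \<open>sqrt 2\<close>.
\<close>

lemma subgradient_lipschitz:
  fixes h :: "real^'x \<Rightarrow> real^'y"
  assumes D: "D \<in> vec_subdiff h u" "norm D \<le> C" and E: "E \<in> vec_subdiff h v" "norm E \<le> C"
  shows "norm (h u - h v) \<le> sqrt 2 * C * norm (u - v)"
proof -
  have C: "0 \<le> C" using D(2) norm_ge_zero order_trans by blast
  define a b where "a = transpose D *v (u - v)" and "b = transpose E *v (u - v)"
  have comp: "a $ j = column j D \<bullet> (u - v)" "b $ j = column j E \<bullet> (u - v)" for j
    unfolding a_def b_def matrix_vector_mul_component by (simp_all add: column_def transpose_def inner_vec_def)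
  have sq: "((h u - h v) $ j)^2 \<le> (a $ j)^2 + (b $ j)^2" for j
  proof -
    have "h u $ j + column j D \<bullet> (v - u) \<le> h v $ j" "h v $ j + column j E \<bullet> (u - v) \<le> h u $ j"
      using D(1) E(1) by (auto simp: vec_subdiff_def subdiff_def)
    moreover have "column j D \<bullet> (v - u) = - (column j D \<bullet> (u - v))" by (simp add: inner_diff_right)
    ultimately have 1: "h u $ j - h v $ j \<le> a $ j" "b $ j \<le> h u $ j - h v $ j"
      unfolding comp by linarith+
    show ?thesis
    proof (cases "0 \<le> h u $ j - h v $ j")
      case True
      hence "(h u $ j - h v $ j)^2 \<le> (a $ j)^2" using 1 by (intro power_mono) auto
      thus ?thesis by (simp add: add_increasing2)
    next
      case False
      hence "(- (h u $ j - h v $ j))^2 \<le> (- (b $ j))^2" using 1 by (intro power_mono) auto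
      thus ?thesis by (simp add: add_increasing power2_commute[of "h u $ j"])
    qed
  qed
  have "(norm (h u - h v))^2 \<le> (norm a)^2 + (norm b)^2"
    unfolding power2_norm_eq_inner inner_vec_def sum.distrib[symmetric]
    using sq by (intro sum_mono) (auto simp: power2_eq_square)
  also have "\<dots> \<le> (C * norm (u - v))^2 + (C * norm (u - v))^2"
  proof -
    have "norm a \<le> C * norm (u - v)" "norm b \<le> C * norm (u - v)"
      using norm_matrix_vector_le[of "transpose D" "u - v"] norm_matrix_vector_le[of "transpose E" "u - v"]
        mult_right_mono[OF D(2) norm_ge_zero[of "u - v"]] mult_right_mono[OF E(2) norm_ge_zero[of "u - v"]]
      unfolding a_def b_def norm_transpose by linarith+
    thus ?thesis by (intro add_mono power_mono) auto
  qed
  also have "\<dots> = (sqrt 2 * C * norm (u - v))^2" by (simp add: power_mult_distrib)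
  finally show ?thesis by (rule power2_le_imp_le) (use C in simp)
qed

lemma convex_monotone_composition:
  fixes h :: "real^'x \<Rightarrow> real^'y"
  assumes cvx: "\<And>j. convex_on UNIV (\<lambda>u. h u $ j)" and p: "affine_map h \<or> 0 \<le> p"
  shows "convex_on UNIV (\<lambda>u. p \<bullet> h u)"
  using p
proof
  assume "0 \<le> p"
  show ?thesis
  proof (rule convex_onI)
    fix t :: real and x y :: "real^'x" assume t: "0 < t" "t < 1"
    have "p $ j * h ((1 - t) *\<^sub>R x + t *\<^sub>R y) $ j \<le> p $ j * ((1 - t) * h x $ j + t * h y $ j)" for j
      using convex_onD[OF cvx[of j], of t x y] t \<open>0 \<le> p\<close>
      by (intro mult_left_mono) (auto simp: less_eq_vec_def)
    hence "p \<bullet> h ((1 - t) *\<^sub>R x + t *\<^sub>R y) \<le> (\<Sum>j\<in>UNIV. p $ j * ((1 - t) * h x $ j + t * h y $ j))"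
      unfolding inner_vec_def by (simp add: sum_mono)
    also have "\<dots> = (1 - t) * (p \<bullet> h x) + t * (p \<bullet> h y)"
      unfolding inner_vec_def sum_distrib_left sum.distrib[symmetric]
      by (intro sum.cong refl) (simp add: algebra_simps)
    finally show "p \<bullet> h ((1 - t) *\<^sub>R x + t *\<^sub>R y) \<le> (1 - t) * (p \<bullet> h x) + t * (p \<bullet> h y)" .
  qed auto
next
  assume "affine_map h"
  then obtain A b where h: "\<And>x. h x = A *v x + b" by (auto simp: affine_map_def)
  show ?thesis
  proof (rule convex_onI)
    fix t :: real and x y :: "real^'x"
    show "p \<bullet> h ((1 - t) *\<^sub>R x + t *\<^sub>R y) \<le> (1 - t) * (p \<bullet> h x) + t * (p \<bullet> h y)"
      unfolding h by (simp add: matrix_vector_right_distrib matrix_vector_mult_scaleR inner_add_right algebra_simps)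
  qed auto
qed

text \<open>
  The recursion is \<open>(1 + \<tau>) y\<^bsub>t+1\<^esub> = (u\<^sub>t + \<epsilon>\<^sub>t) + \<tau> y\<^sub>t\<close> with \<open>\<tau> = t/2\<close>. It is a mirror step for the
  conjugate of \<open>\<phi>\<close>, and the Bregman distances \<open>B\<close> in the proof are those of the conjugate, written
  without it. They telescope because \<open>(t + 1)/2 \<le> 1 + t/2\<close>, and \<open>\<tau> = 0\<close> at the start removes the
  initial distance.
\<close>

lemma averaged_tracking:
  fixes \<phi> :: "'a::real_inner \<Rightarrow> real" and \<phi>' :: "'a \<Rightarrow> 'a" and u \<epsilon> y :: "nat \<Rightarrow> 'a"
  assumes tangent: "\<And>p q. \<phi> p + \<phi>' p \<bullet> (q - p) \<le> \<phi> q"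
    and y: "\<And>t. t < n \<Longrightarrow> y (Suc t) = (1 / (1 + real t / 2)) *\<^sub>R ((u t + \<epsilon> t) + (real t / 2) *\<^sub>R y t)"
  shows "(\<Sum>t<n. \<phi> r + \<phi>' r \<bullet> (u t - r)) + \<phi>' r \<bullet> (\<Sum>t<n. \<epsilon> t) - (\<Sum>t<n. \<phi>' (y (Suc t)) \<bullet> \<epsilon> t)
    \<le> (\<Sum>t<n. \<phi> (y (Suc t)) + \<phi>' (y (Suc t)) \<bullet> (u t - y (Suc t)))"
proof -
  define B where "B t = \<phi> (y t) - \<phi> r - \<phi>' r \<bullet> (y t - r)" for t
  have B: "0 \<le> B t" for t using tangent[of r "y t"] by (simp add: B_def)
  \<comment> \<open>An identity up to the dropped Bregman distance between \<open>y t\<close> and \<open>y (Suc t)\<close>.\<close>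
  have step: "\<phi> r + \<phi>' r \<bullet> (u t - r) + \<phi>' r \<bullet> \<epsilon> t - \<phi>' (y (Suc t)) \<bullet> \<epsilon> t
      + ((1 + real t / 2) * B (Suc t) - real t / 2 * B t)
      \<le> \<phi> (y (Suc t)) + \<phi>' (y (Suc t)) \<bullet> (u t - y (Suc t))" if t: "t < n" for t
  proof -
    define c where "c = real t / 2"
    have c: "0 \<le> c" by (simp add: c_def)
    have "(1 + c) *\<^sub>R y (Suc t) = (u t + \<epsilon> t) + c *\<^sub>R y t"
      using y[OF t] c unfolding c_def[symmetric] by simp
    hence u: "u t = (1 + c) *\<^sub>R y (Suc t) - c *\<^sub>R y t - \<epsilon> t" by (simp add: algebra_simps)
    have D: "0 \<le> c * (\<phi> (y t) - \<phi> (y (Suc t)) - \<phi>' (y (Suc t)) \<bullet> (y t - y (Suc t)))"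
      using tangent[of "y (Suc t)" "y t"] c by simp
    show ?thesis unfolding B_def u c_def[symmetric] using D
      by (simp add: inner_diff_right inner_add_right algebra_simps)
  qed
  have tel: "n * B n / 2 \<le> (\<Sum>t<n. (1 + real t / 2) * B (Suc t) - real t / 2 * B t)"
  proof (induction n)
    case (Suc n)
    have "Suc n * B (Suc n) / 2 \<le> (1 + real n / 2) * B (Suc n)"
      using B[of "Suc n"] by (simp add: field_simps)
    with Suc show ?case by simp
  qed simp
  have "(\<Sum>t<n. \<phi> r + \<phi>' r \<bullet> (u t - r)) + (\<Sum>t<n. \<phi>' r \<bullet> \<epsilon> t) - (\<Sum>t<n. \<phi>' (y (Suc t)) \<bullet> \<epsilon> t)
     + (\<Sum>t<n. (1 + real t / 2) * B (Suc t) - real t / 2 * B t)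
    = (\<Sum>t<n. \<phi> r + \<phi>' r \<bullet> (u t - r) + \<phi>' r \<bullet> \<epsilon> t - \<phi>' (y (Suc t)) \<bullet> \<epsilon> t
      + ((1 + real t / 2) * B (Suc t) - real t / 2 * B t))"
    by (simp add: sum.distrib sum_subtractf)
  also have "\<dots> \<le> (\<Sum>t<n. \<phi> (y (Suc t)) + \<phi>' (y (Suc t)) \<bullet> (u t - y (Suc t)))"
    using step by (intro sum_mono) auto
  finally have "(\<Sum>t<n. \<phi> r + \<phi>' r \<bullet> (u t - r)) + (\<Sum>t<n. \<phi>' r \<bullet> \<epsilon> t) - (\<Sum>t<n. \<phi>' (y (Suc t)) \<bullet> \<epsilon> t)
      + n * B n / 2 \<le> (\<Sum>t<n. \<phi> (y (Suc t)) + \<phi>' (y (Suc t)) \<bullet> (u t - y (Suc t)))"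
    using tel by linarith
  moreover have "0 \<le> n * B n / 2" using B by simp
  ultimately show ?thesis by (simp add: inner_sum_right)
qed

text \<open>
  A composition \<open>\<Phi> \<circ> h\<close>, for the objective (values in the reals) and for the constraints (values in
  a vector space) alike. Multipliers \<open>l \<ge> 0\<close> make \<open>l \<bullet> \<Phi>\<close> a convex function; \<open>der y\<close> is the derivative
  of \<open>\<Phi>\<close> at \<open>y\<close> and \<open>adj y\<close> its adjoint, so that \<open>adj y l\<close> is the gradient of \<open>l \<bullet> \<Phi>\<close>. The constants
  bound the outer gradients (\<open>C1\<close>), the inner subgradients (\<open>C2\<close>) and the Lipschitz modulus of the
  outer gradient (\<open>L\<close>).
\<close>

locale composite_layer =
  fixes X :: "(real^'x) set" and h :: "real^'x \<Rightarrow> real^'y"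
    and \<Phi> :: "real^'y \<Rightarrow> 'e::ordered_euclidean_space"
    and der :: "real^'y \<Rightarrow> real^'y \<Rightarrow> 'e" and adj :: "real^'y \<Rightarrow> 'e \<Rightarrow> real^'y"
    and C1 C2 L :: real
  assumes X: "closed X" "convex X"
    and C: "0 < C1" "0 < C2" "0 < L"
    and adj: "\<And>y d l. der y d \<bullet> l = d \<bullet> adj y l"
    and tangent: "\<And>l p q. 0 \<le> l \<Longrightarrow> l \<bullet> \<Phi> p + adj p l \<bullet> (q - p) \<le> l \<bullet> \<Phi> q"
    and adj_bound: "\<And>y l. norm (adj y l) \<le> C1 * norm l"
    and der_lipschitz: "\<And>y y' d. norm (der y d - der y' d) \<le> L * norm (y - y') * norm d"
    and subgradient: "\<And>u. u \<in> X \<Longrightarrow> \<exists>D \<in> vec_subdiff h u. norm D \<le> C2"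
    and h_convex: "\<And>j. convex_on UNIV (\<lambda>u. h u $ j)"
    and monotone: "\<And>y l. 0 \<le> l \<Longrightarrow> affine_map h \<or> 0 \<le> adj y l"
begin

lemma der_bound: "norm (der y d) \<le> C1 * norm d"
proof (cases "der y d = 0")
  case True thus ?thesis using C by simp
next
  case False
  have "(norm (der y d))^2 = d \<bullet> adj y (der y d)" by (simp add: power2_norm_eq_inner adj)
  also have "\<dots> \<le> norm d * norm (adj y (der y d))" by (rule norm_cauchy_schwarz)
  also have "\<dots> \<le> norm d * (C1 * norm (der y d))" by (intro mult_left_mono adj_bound) auto
  finally show ?thesis using False by (simp add: power2_eq_square mult.commute mult.left_commute)
qed

lemma h_lipschitz:
  assumes "u \<in> X" "v \<in> X"
  shows "norm (h u - h v) \<le> sqrt 2 * C2 * norm (u - v)"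
  using subgradient[OF assms(1)] subgradient[OF assms(2)] subgradient_lipschitz by metis

definition lin :: "real^'y \<Rightarrow> real^'y \<Rightarrow> 'e" where
  "lin y u = \<Phi> y + der y (u - y)"

lemma lin_inner: "lin y u \<bullet> l = l \<bullet> \<Phi> y + adj y l \<bullet> (u - y)"
  unfolding lin_def inner_add_left adj by (simp add: inner_commute)

text \<open>
  The tracking step with weight \<open>\<tau> = t/2\<close>. It is applied to noisy inner values by the method and to
  exact ones in the analysis; the latter result is independent of the fresh noise.
\<close>

definition damped :: "nat \<Rightarrow> real^'y \<Rightarrow> real^'y \<Rightarrow> real^'y" where
  "damped t u y = (1 / (1 + real t / 2)) *\<^sub>R (u + (real t / 2) *\<^sub>R y)"

text \<open>
  The three ways in which the value noise \<open>\<epsilon>\<close> enters: directly, through the derivative at the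
  noise-free tracking point, and through the displacement of the tracking point by the noise.
\<close>

definition noise :: "(nat \<Rightarrow> real^'x) \<Rightarrow> (nat \<Rightarrow> real^'y) \<Rightarrow> (nat \<Rightarrow> real^'y) \<Rightarrow> nat \<Rightarrow> real" where
  "noise x y \<epsilon> n = C1 * norm (\<Sum>t<n. \<epsilon> t) + norm (\<Sum>t<n. der (damped t (h (x t)) (y t)) (\<epsilon> t))
     + L * (\<Sum>t<n. 2 / (real t + 2) * (norm (\<epsilon> t))^2)"

text \<open>
  The reference point of the tracking inequality is the inner value at the averaged iterate. Then
  the linear terms have a nonnegative sum by Jensen's inequality. The average runs over
  \<open>x\<^sub>1, \<dots>, x\<^sub>n\<close> but the linearizations over \<open>x\<^sub>0, \<dots>, x\<^bsub>n-1\<^esub>\<close>; exchanging \<open>x\<^sub>0\<close> for \<open>x\<^sub>n\<close> costs a constant. The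
  bound is uniform in \<open>l\<close> with \<open>\<parallel>l\<parallel> \<le> K\<close>, so \<open>l\<close> may be chosen after the run.
\<close>

lemma composite_gap:
  assumes x: "\<And>t. t \<le> n \<Longrightarrow> x t \<in> X" and n: "0 < n"
    and D: "norm (x n - x 0) \<le> 2 * D"
    and y: "\<And>t. t < n \<Longrightarrow> y (Suc t) = damped t (h (x t) + \<epsilon> t) (y t)"
    and l: "0 \<le> l" "norm l \<le> K"
  shows "n * (\<Phi> (h ((1 / n) *\<^sub>R (\<Sum>t=1..n. x t))) \<bullet> l) - K * (2 * sqrt 2 * C1 * C2 * D + noise x y \<epsilon> n)
     \<le> (\<Sum>t<n. lin (y (Suc t)) (h (x t)) \<bullet> l)"
proof -
  define r where "r = h ((1 / n) *\<^sub>R (\<Sum>t=1..n. x t))"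
  define P where "P = adj r l"
  have normP: "norm P \<le> C1 * K"
    unfolding P_def using adj_bound[of r l] mult_left_mono[OF l(2), of C1] C by linarith
  have K: "0 \<le> K" using l(2) norm_ge_zero order_trans by blast
  have jensen: "(\<Sum>t=1..n. P \<bullet> (h (x t) - r)) \<ge> 0"
  proof -
    have cv: "convex_on UNIV (\<lambda>u. P \<bullet> h u)"
      unfolding P_def by (intro convex_monotone_composition h_convex monotone l)
    have "P \<bullet> h (\<Sum>t\<in>{1..n}. (1 / n) *\<^sub>R x t) \<le> (\<Sum>t\<in>{1..n}. (1 / n) * (P \<bullet> h (x t)))"
      using n by (intro convex_on_sum[OF _ _ cv]) auto
    hence "P \<bullet> r \<le> (1 / n) * (\<Sum>t\<in>{1..n}. P \<bullet> h (x t))"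
      unfolding r_def by (simp add: scaleR_right.sum sum_distrib_left)
    thus ?thesis using n by (simp add: inner_diff_right sum_subtractf field_simps)
  qed
  have shift: "(\<Sum>t<n. P \<bullet> (h (x t) - r)) \<ge> - K * (2 * sqrt 2 * C1 * C2 * D)"
  proof -
    have "(\<Sum>t<n. P \<bullet> (h (x t) - r)) = (\<Sum>t=1..n. P \<bullet> (h (x t) - r)) + P \<bullet> (h (x 0) - h (x n))"
      by (induction n) (auto simp: inner_diff_right)
    moreover have "norm (P \<bullet> (h (x 0) - h (x n))) \<le> C1 * K * (sqrt 2 * C2 * (2 * D))"
    proof -
      have "norm (P \<bullet> (h (x 0) - h (x n))) \<le> norm P * norm (h (x 0) - h (x n))"
        by (simp add: Cauchy_Schwarz_ineq2)
      also have "\<dots> \<le> C1 * K * (sqrt 2 * C2 * (2 * D))"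
      proof (intro mult_mono normP)
        have "norm (h (x 0) - h (x n)) \<le> sqrt 2 * C2 * norm (x 0 - x n)"
          by (intro h_lipschitz x) auto
        also have "\<dots> \<le> sqrt 2 * C2 * (2 * D)"
          using D C by (intro mult_left_mono) (auto simp: norm_minus_commute)
        finally show "norm (h (x 0) - h (x n)) \<le> sqrt 2 * C2 * (2 * D)" .
      qed (use C K in auto)
      finally show ?thesis .
    qed
    ultimately show ?thesis using jensen by (auto simp: abs_le_iff algebra_simps)
  qed
  define y' where "y' t = damped t (h (x t)) (y t)" for t
  have diff: "norm (y (Suc t) - y' t) = 2 / (real t + 2) * norm (\<epsilon> t)" if "t < n" for t
  proof -
    have "y (Suc t) - y' t = (1 / (1 + real t / 2)) *\<^sub>R \<epsilon> t"
      unfolding y[OF that] y'_def damped_def by (simp add: scaleR_diff_right[symmetric] del: scaleR_diff_right)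
    thus ?thesis by (simp add: field_simps)
  qed
  have n1: "P \<bullet> (\<Sum>t<n. \<epsilon> t) \<ge> - K * (C1 * norm (\<Sum>t<n. \<epsilon> t))"
  proof -
    have "norm (P \<bullet> (\<Sum>t<n. \<epsilon> t)) \<le> norm P * norm (\<Sum>t<n. \<epsilon> t)" by (simp add: Cauchy_Schwarz_ineq2)
    also have "\<dots> \<le> (C1 * K) * norm (\<Sum>t<n. \<epsilon> t)" by (intro mult_right_mono normP) auto
    finally show ?thesis by (auto simp: abs_le_iff algebra_simps)
  qed
  \<comment> \<open>The gradient at \<open>y (Suc t)\<close> depends on the noise it multiplies; replacing it by the one at the noise-free
    point \<open>y' t\<close> makes the leading term centred.\<close>
  have n2: "(\<Sum>t<n. adj (y (Suc t)) l \<bullet> \<epsilon> t)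
     \<le> K * (norm (\<Sum>t<n. der (y' t) (\<epsilon> t)) + L * (\<Sum>t<n. 2 / (real t + 2) * (norm (\<epsilon> t))^2))"
  proof -
    have "(\<Sum>t<n. adj (y (Suc t)) l \<bullet> \<epsilon> t) = (\<Sum>t<n. der (y (Suc t)) (\<epsilon> t) \<bullet> l)"
      unfolding adj by (rule sum.cong) (rule refl, rule inner_commute)
    also have "\<dots> = (\<Sum>t<n. der (y' t) (\<epsilon> t)) \<bullet> l + (\<Sum>t<n. (der (y (Suc t)) (\<epsilon> t) - der (y' t) (\<epsilon> t)) \<bullet> l)"
      by (simp add: inner_sum_left inner_diff_left sum_subtractf)
    also have "\<dots> \<le> norm (\<Sum>t<n. der (y' t) (\<epsilon> t)) * K + (\<Sum>t<n. L * (2 / (real t + 2) * (norm (\<epsilon> t))^2) * K)"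
    proof (intro add_mono sum_mono)
      show "(\<Sum>t<n. der (y' t) (\<epsilon> t)) \<bullet> l \<le> norm (\<Sum>t<n. der (y' t) (\<epsilon> t)) * K"
        by (rule order_trans[OF norm_cauchy_schwarz]) (use l in \<open>auto intro: mult_left_mono\<close>)
      fix t assume t: "t \<in> {..<n}"
      have "(der (y (Suc t)) (\<epsilon> t) - der (y' t) (\<epsilon> t)) \<bullet> l
          \<le> norm (der (y (Suc t)) (\<epsilon> t) - der (y' t) (\<epsilon> t)) * norm l"
        by (rule norm_cauchy_schwarz)
      also have "\<dots> \<le> (L * norm (y (Suc t) - y' t) * norm (\<epsilon> t)) * K"
        using C by (intro mult_mono der_lipschitz l) auto
      also have "\<dots> = L * (2 / (real t + 2) * (norm (\<epsilon> t))^2) * K"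
        using t by (simp add: diff power2_eq_square)
      finally show "(der (y (Suc t)) (\<epsilon> t) - der (y' t) (\<epsilon> t)) \<bullet> l \<le> L * (2 / (real t + 2) * (norm (\<epsilon> t))^2) * K" .
    qed
    also have "\<dots> = K * (norm (\<Sum>t<n. der (y' t) (\<epsilon> t)) + L * (\<Sum>t<n. 2 / (real t + 2) * (norm (\<epsilon> t))^2))"
      by (simp add: sum_distrib_left algebra_simps)
    finally show ?thesis .
  qed
  have "(\<Sum>t<n. l \<bullet> \<Phi> r + P \<bullet> (h (x t) - r)) + P \<bullet> (\<Sum>t<n. \<epsilon> t) - (\<Sum>t<n. adj (y (Suc t)) l \<bullet> \<epsilon> t)
    \<le> (\<Sum>t<n. l \<bullet> \<Phi> (y (Suc t)) + adj (y (Suc t)) l \<bullet> (h (x t) - y (Suc t)))"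
    unfolding P_def
    using y by (intro averaged_tracking[where \<phi> = "\<lambda>q. l \<bullet> \<Phi> q" and \<phi>' = "\<lambda>q. adj q l"] tangent l)
      (simp add: damped_def)
  moreover have "(\<Sum>t<n. l \<bullet> \<Phi> r + P \<bullet> (h (x t) - r)) = n * (\<Phi> r \<bullet> l) + (\<Sum>t<n. P \<bullet> (h (x t) - r))"
    by (simp add: sum.distrib inner_commute)
  ultimately show ?thesis
    using shift n1 n2 unfolding lin_inner noise_def r_def[symmetric] y'_def[symmetric]
    by (simp add: algebra_simps)
qed

lemma lin_le:
  assumes "0 \<le> l"
  shows "lin y u \<bullet> l \<le> \<Phi> u \<bullet> l"
  using tangent[OF assms, of y u] unfolding lin_inner by (simp add: inner_commute)

lemma lin_diff: "(lin y u - lin y v) \<bullet> l = adj y l \<bullet> (u - v)"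
  unfolding inner_diff_left lin_inner by (simp add: inner_diff_right)

lemma adj_step_bound:
  assumes "u \<in> X" "v \<in> X"
  shows "\<bar>adj y l \<bullet> (h u - h v)\<bar> \<le> C1 * norm l * (sqrt 2 * C2 * norm (u - v))"
proof -
  have "\<bar>adj y l \<bullet> (h u - h v)\<bar> \<le> norm (adj y l) * norm (h u - h v)" by (rule Cauchy_Schwarz_ineq2)
  also have "\<dots> \<le> C1 * norm l * (sqrt 2 * C2 * norm (u - v))"
    using C by (intro mult_mono adj_bound h_lipschitz assms) auto
  finally show ?thesis .
qed

end

text \<open>
  Testing the tangent inequalities with the basis vectors bounds every coordinate. The dimension
  factor does not enter the rates: the lemma serves to show linear growth and measurability.
\<close>

lemma (in composite_layer) Phi_lipschitz:
  "norm (\<Phi> q - \<Phi> p) \<le> DIM('e) * C1 * norm (q - p)"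
proof -
  have "\<bar>(\<Phi> q - \<Phi> p) \<bullet> b\<bar> \<le> C1 * norm (q - p)" if b: "b \<in> Basis" for b
  proof -
    have b0: "0 \<le> b" using b by (subst eucl_le) (simp add: inner_Basis)
    have "\<bar>adj r b \<bullet> d\<bar> \<le> C1 * norm d" for r d
      using Cauchy_Schwarz_ineq2[of "adj r b" d] mult_right_mono[OF adj_bound[of r b], of "norm d"] b by simp
    from this[of p "q - p"] this[of q "p - q"] show ?thesis
      using tangent[OF b0, of p q] tangent[OF b0, of q p]
      unfolding inner_diff_left inner_commute[of "\<Phi> _" b] abs_le_iff norm_minus_commute[of p q] by linarith
  qed
  hence "(\<Sum>b\<in>Basis. \<bar>(\<Phi> q - \<Phi> p) \<bullet> b\<bar>) \<le> (\<Sum>b\<in>(Basis::'e set). C1 * norm (q - p))"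
    by (intro sum_mono)
  thus ?thesis using norm_le_l1[of "\<Phi> q - \<Phi> p"] by simp
qed

lemma (in composite_layer) Phi_measurable: "\<Phi> \<in> borel_measurable borel"
proof -
  have "(DIM('e) * C1)-lipschitz_on UNIV \<Phi>"
    using C by (intro lipschitz_onI) (auto simp: dist_norm Phi_lipschitz)
  thus ?thesis by (intro borel_measurable_continuous_onI lipschitz_on_continuous_on)
qed

section \<open>Pathwise primal-dual gap\<close>

locale composite_program =
  f: composite_layer X f2 f1 derf adjf Cf1 Cf2 Lf1 + g: composite_layer X g2 g1 derg adjg Cg1 Cg2 Lg1
  for X :: "(real^'x) set"
    and f2 :: "real^'x \<Rightarrow> real^'y" and f1 :: "real^'y \<Rightarrow> real" and derf adjf Cf1 Cf2 Lf1
    and g2 :: "real^'x \<Rightarrow> real^'z" and g1 :: "real^'z \<Rightarrow> real^'m" and derg adjg Cg1 Cg2 Lg1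
begin

text \<open>
  The dual step multiplies the constraint linearization by the new multiplier \<open>lam'\<close>, the primal step
  by the old one. Splitting the linearization at \<open>x\<^sub>t\<close> into its value \<open>b\<close> at the saddle point and the
  increment \<open>a\<close> resolves this: \<open>b \<bullet> lam' \<le> 0\<close> by feasibility, and \<open>a\<close> is bounded by the diameter, so the
  mismatch \<open>a \<bullet> (lam' - lam)\<close> is absorbed by Young's inequality.
\<close>

lemma primal_dual_step:
  assumes xt: "xt \<in> X" and xs: "xs \<in> X" "g1 (g2 xs) \<le> 0" and D: "norm (xt - xs) \<le> D"
    and pos: "0 < \<eta>" "0 < \<alpha>" and lam: "0 \<le> lam" and l: "0 \<le> l"
    and xt': "xt' = closest_point X (xt - (1 / \<eta>) *\<^sub>R w)"
    and lam': "lam' = pos_part (lam + (1 / \<alpha>) *\<^sub>R (g.lin z (g2 xt) + \<delta>))"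
  shows "f.lin y (f2 xt) - f1 (f2 xs) + g.lin z (g2 xt) \<bullet> l
    \<le> (adjf y 1 \<bullet> (f2 xt - f2 xs) + adjg z lam \<bullet> (g2 xt - g2 xs) - w \<bullet> (xt - xs))
      + \<eta> / 2 * ((norm (xt - xs))^2 - (norm (xt' - xs))^2) + (norm w)^2 / (2 * \<eta>)
      + \<alpha> / 2 * ((norm (lam - l))^2 - (norm (lam' - l))^2)
      + (2 * (Cg1 * Cg2 * D)^2 + (norm \<delta>)^2) / \<alpha> + \<delta> \<bullet> lam - \<delta> \<bullet> l"
proof -
  define a b where "a = g.lin z (g2 xt) - g.lin z (g2 xs)" and "b = g.lin z (g2 xs)"
  have lam'0: "0 \<le> lam'" unfolding lam' by (rule pos_part_nonneg)
  have primal: "w \<bullet> (xt - xs) \<le> \<eta> / 2 * ((norm (xt - xs))^2 - (norm (xt' - xs))^2) + (norm w)^2 / (2 * \<eta>)"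
    unfolding xt' by (rule projected_step[OF f.X xs(1) pos(1)])
  have dual: "(g.lin z (g2 xt) + \<delta>) \<bullet> (l - lam')
      \<le> \<alpha> / 2 * ((norm (lam - l))^2 - (norm (lam' - l))^2 - (norm (lam' - lam))^2)"
    unfolding lam' by (rule dual_step[OF pos(2) l])
  have objective: "f.lin y (f2 xt) - f1 (f2 xs) \<le> adjf y 1 \<bullet> (f2 xt - f2 xs)"
    using f.lin_diff[of y "f2 xt" "f2 xs" 1] f.lin_le[of 1 y "f2 xs"] by simp
  have a: "a \<bullet> q = adjg z q \<bullet> (g2 xt - g2 xs)" for q unfolding a_def by (rule g.lin_diff)
  have b: "b \<bullet> lam' \<le> 0"
  proof -
    have "b \<bullet> lam' \<le> g1 (g2 xs) \<bullet> lam'" unfolding b_def by (rule g.lin_le[OF lam'0])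
    also have "\<dots> \<le> 0"
      using inner_nonneg_vec[of "- g1 (g2 xs)" lam'] xs(2) lam'0 by simp
    finally show ?thesis .
  qed
  have anorm: "(norm a)^2 \<le> 2 * (Cg1 * Cg2 * D)^2"
  proof -
    have D0: "0 \<le> D" using D norm_ge_zero order_trans by blast
    have "norm a * norm a = adjg z a \<bullet> (g2 xt - g2 xs)"
      unfolding a[symmetric] by (simp add: power2_norm_eq_inner flip: power2_eq_square)
    also have "\<dots> \<le> Cg1 * norm a * (sqrt 2 * Cg2 * norm (xt - xs))"
      using g.adj_step_bound[OF xt xs(1), of z a] by (simp add: abs_le_iff)
    also have "\<dots> \<le> norm a * (sqrt 2 * (Cg1 * Cg2 * D))"
      using mult_left_mono[OF D, of "Cg1 * norm a * (sqrt 2 * Cg2)"] g.C by (simp add: algebra_simps)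
    finally have "norm a * norm a \<le> norm a * (sqrt 2 * (Cg1 * Cg2 * D))" .
    hence "norm a \<le> sqrt 2 * (Cg1 * Cg2 * D)"
      using g.C D0 by (cases "a = 0") auto
    hence "(norm a)^2 \<le> (sqrt 2 * (Cg1 * Cg2 * D))^2" by (intro power_mono) auto
    thus ?thesis by (simp add: power_mult_distrib)
  qed
  have young: "(a + \<delta>) \<bullet> (lam' - lam) \<le> ((norm a)^2 + (norm \<delta>)^2) / \<alpha> + \<alpha> / 2 * (norm (lam' - lam))^2"
  proof -
    have "0 \<le> (norm ((a + \<delta>) - \<alpha> *\<^sub>R (lam' - lam)))^2" by simp
    also have "\<dots> = (norm (a + \<delta>))^2 - 2 * \<alpha> * ((a + \<delta>) \<bullet> (lam' - lam)) + \<alpha>^2 * (norm (lam' - lam))^2"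
      unfolding power2_norm_eq_inner
      by (simp add: inner_diff_left inner_diff_right inner_add_left inner_add_right inner_commute
            power2_eq_square algebra_simps)
    finally have 1: "2 * \<alpha> * ((a + \<delta>) \<bullet> (lam' - lam)) \<le> (norm (a + \<delta>))^2 + \<alpha>^2 * (norm (lam' - lam))^2"
      by simp
    have "0 \<le> (norm (a - \<delta>))^2" by simp
    hence "(norm (a + \<delta>))^2 \<le> 2 * (norm a)^2 + 2 * (norm \<delta>)^2"
      unfolding power2_norm_eq_inner
      by (simp add: inner_diff_left inner_diff_right inner_add_left inner_add_right inner_commute)
    moreover have "2 * \<alpha> * (((norm a)^2 + (norm \<delta>)^2) / \<alpha> + \<alpha> / 2 * (norm (lam' - lam))^2)
        = 2 * (norm a)^2 + 2 * (norm \<delta>)^2 + \<alpha>^2 * (norm (lam' - lam))^2"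
      using pos(2) by (simp add: power2_eq_square field_simps)
    ultimately have "2 * \<alpha> * ((a + \<delta>) \<bullet> (lam' - lam))
        \<le> 2 * \<alpha> * (((norm a)^2 + (norm \<delta>)^2) / \<alpha> + \<alpha> / 2 * (norm (lam' - lam))^2)"
      using 1 by linarith
    thus ?thesis using pos(2) by (subst (asm) mult_le_cancel_left_pos) auto
  qed
  have "((norm a)^2 + (norm \<delta>)^2) / \<alpha> \<le> (2 * (Cg1 * Cg2 * D)^2 + (norm \<delta>)^2) / \<alpha>"
    using anorm pos(2) by (intro divide_right_mono) auto
  moreover have "g.lin z (g2 xt) = a + b" by (simp add: a_def b_def)
  ultimately show ?thesis
    using primal dual objective b young a[of lam]
    by (simp add: inner_diff_right inner_add_left algebra_simps)
qed

text \<open>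
  Sum of the primal-dual steps, with the linearizations bounded below by \<open>composite_gap\<close> for the
  objective (multiplier \<open>1\<close>) and for the constraints (multiplier \<open>l\<close>). On the right, \<open>l\<close> occurs only
  through its norm.
\<close>

lemma pathwise_gap:
  fixes n :: nat
  assumes n: "0 < n" and x: "\<And>t. t \<le> n \<Longrightarrow> x t \<in> X"
    and xs: "xs \<in> X" "g1 (g2 xs) \<le> 0" and D: "\<And>u. u \<in> X \<Longrightarrow> norm (u - xs) \<le> D"
    and pos: "0 < \<eta>" "0 < \<alpha>"
    and y: "\<And>t. t < n \<Longrightarrow> y (Suc t) = f.damped t (f2 (x t) + \<epsilon>f t) (y t)"
    and z: "\<And>t. t < n \<Longrightarrow> z (Suc t) = g.damped t (g2 (x t) + \<epsilon>g t) (z t)"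
    and x_step: "\<And>t. t < n \<Longrightarrow> x (Suc t) = closest_point X (x t - (1 / \<eta>) *\<^sub>R w t)"
    and lam: "lam 0 = 0"
      "\<And>t. t < n \<Longrightarrow> lam (Suc t) = pos_part (lam t + (1 / \<alpha>) *\<^sub>R (g.lin (z (Suc t)) (g2 (x t)) + \<delta> t))"
    and l: "0 \<le> l" "norm l \<le> K"
  defines "xb \<equiv> (1 / n) *\<^sub>R (\<Sum>t=1..n. x t)"
  shows "n * (f1 (f2 xb) - f1 (f2 xs) + g1 (g2 xb) \<bullet> l) + \<alpha> / 2 * (norm (lam n - l))^2
    \<le> \<eta> / 2 * (norm (x 0 - xs))^2 + \<alpha> / 2 * (norm l)^2
      + (\<Sum>t<n. (adjf (y (Suc t)) 1 \<bullet> (f2 (x t) - f2 xs) + adjg (z (Suc t)) (lam t) \<bullet> (g2 (x t) - g2 xs)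
            - w t \<bullet> (x t - xs))
          + (norm (w t))^2 / (2 * \<eta>) + (2 * (Cg1 * Cg2 * D)^2 + (norm (\<delta> t))^2) / \<alpha> + \<delta> t \<bullet> lam t)
      + (2 * sqrt 2 * Cf1 * Cf2 * D + f.noise x y \<epsilon>f n)
      + K * (2 * sqrt 2 * Cg1 * Cg2 * D + g.noise x z \<epsilon>g n + norm (\<Sum>t<n. \<delta> t))"
    (is "_ \<le> _ + (\<Sum>t<n. ?r t) + _ + _")
proof -
  have lam0: "0 \<le> lam t" if "t \<le> n" for t
    using that lam by (cases t) (auto intro: pos_part_nonneg)
  have "(\<Sum>t<n. f.lin (y (Suc t)) (f2 (x t)) - f1 (f2 xs) + g.lin (z (Suc t)) (g2 (x t)) \<bullet> l)
     \<le> (\<Sum>t<n. ?r t + \<eta> / 2 * ((norm (x t - xs))^2 - (norm (x (Suc t) - xs))^2)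
          + \<alpha> / 2 * ((norm (lam t - l))^2 - (norm (lam (Suc t) - l))^2) - \<delta> t \<bullet> l)"
  proof (rule sum_mono)
    fix t assume "t \<in> {..<n}"
    hence t: "t < n" by simp
    show "f.lin (y (Suc t)) (f2 (x t)) - f1 (f2 xs) + g.lin (z (Suc t)) (g2 (x t)) \<bullet> l
      \<le> ?r t + \<eta> / 2 * ((norm (x t - xs))^2 - (norm (x (Suc t) - xs))^2)
          + \<alpha> / 2 * ((norm (lam t - l))^2 - (norm (lam (Suc t) - l))^2) - \<delta> t \<bullet> l"
      using primal_dual_step[OF x xs D[OF x] pos lam0 l(1) x_step[OF t] lam(2)[OF t], of "y (Suc t)"] t
      by simp
  qed
  also have "\<dots> = (\<Sum>t<n. ?r t) + \<eta> / 2 * (\<Sum>t<n. (norm (x t - xs))^2 - (norm (x (Suc t) - xs))^2)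
          + \<alpha> / 2 * (\<Sum>t<n. (norm (lam t - l))^2 - (norm (lam (Suc t) - l))^2) - (\<Sum>t<n. \<delta> t) \<bullet> l"
    unfolding sum_distrib_left inner_sum_left sum.distrib[symmetric] sum_subtractf[symmetric] ..
  also have "\<dots> \<le> (\<Sum>t<n. ?r t) + \<eta> / 2 * (norm (x 0 - xs))^2
      + \<alpha> / 2 * ((norm l)^2 - (norm (lam n - l))^2) + K * norm (\<Sum>t<n. \<delta> t)"
  proof -
    have "- ((\<Sum>t<n. \<delta> t) \<bullet> l) \<le> norm (\<Sum>t<n. \<delta> t) * norm l"
      using Cauchy_Schwarz_ineq2[of "\<Sum>t<n. \<delta> t" l] by linarith
    also have "\<dots> \<le> K * norm (\<Sum>t<n. \<delta> t)" using l(2) by (simp add: mult.commute mult_right_mono)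
    finally have "- ((\<Sum>t<n. \<delta> t) \<bullet> l) \<le> K * norm (\<Sum>t<n. \<delta> t)" .
    moreover have "\<eta> / 2 * (\<Sum>t<n. (norm (x t - xs))^2 - (norm (x (Suc t) - xs))^2) \<le> \<eta> / 2 * (norm (x 0 - xs))^2"
      using pos sum_lessThan_telescope'[of "\<lambda>t. (norm (x t - xs))^2" n] by (intro mult_left_mono) auto
    moreover have "(\<Sum>t<n. (norm (lam t - l))^2 - (norm (lam (Suc t) - l))^2) = (norm l)^2 - (norm (lam n - l))^2"
      using sum_lessThan_telescope'[of "\<lambda>t. (norm (lam t - l))^2" n] lam(1) by simp
    ultimately show ?thesis by simp
  qed
  finally have upper: "(\<Sum>t<n. f.lin (y (Suc t)) (f2 (x t)) - f1 (f2 xs) + g.lin (z (Suc t)) (g2 (x t)) \<bullet> l)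
     \<le> (\<Sum>t<n. ?r t) + \<eta> / 2 * (norm (x 0 - xs))^2
      + \<alpha> / 2 * ((norm l)^2 - (norm (lam n - l))^2) + K * norm (\<Sum>t<n. \<delta> t)" .
  have Dn: "norm (x n - x 0) \<le> 2 * D"
    using norm_triangle_ineq4[of "x n - xs" "x 0 - xs"] D[OF x[of n]] D[OF x[of 0]] by simp
  have lf: "n * f1 (f2 xb) - (2 * sqrt 2 * Cf1 * Cf2 * D + f.noise x y \<epsilon>f n) \<le> (\<Sum>t<n. f.lin (y (Suc t)) (f2 (x t)))"
    using f.composite_gap[of n x D y \<epsilon>f 1 1, OF x n Dn y] unfolding xb_def by simp
  have lg: "n * (g1 (g2 xb) \<bullet> l) - K * (2 * sqrt 2 * Cg1 * Cg2 * D + g.noise x z \<epsilon>g n)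
      \<le> (\<Sum>t<n. g.lin (z (Suc t)) (g2 (x t)) \<bullet> l)"
    using g.composite_gap[of n x D z \<epsilon>g l K, OF x n Dn z l] unfolding xb_def by simp
  have "(\<Sum>t<n. f.lin (y (Suc t)) (f2 (x t)) - f1 (f2 xs) + g.lin (z (Suc t)) (g2 (x t)) \<bullet> l)
    = (\<Sum>t<n. f.lin (y (Suc t)) (f2 (x t))) - n * f1 (f2 xs) + (\<Sum>t<n. g.lin (z (Suc t)) (g2 (x t)) \<bullet> l)"
    by (simp add: sum.distrib sum_subtractf)
  with upper lf lg show ?thesis by (simp add: algebra_simps)
qed

end

section \<open>Square-integrable random vectors\<close>

lemma matrix_vector_measurable [measurable (raw)]:
  fixes f :: "'w \<Rightarrow> real^'k^'d"
  assumes "f \<in> borel_measurable M" "g \<in> borel_measurable M"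
  shows "(\<lambda>\<omega>. f \<omega> *v g \<omega>) \<in> borel_measurable M"
  using assms
  by (rule borel_measurable_continuous_Pair)
     (auto simp: matrix_vector_mult_def split_beta intro!: continuous_intros)

lemma transpose_measurable [measurable (raw)]:
  fixes f :: "'w \<Rightarrow> real^'k^'d"
  assumes "f \<in> borel_measurable M"
  shows "(\<lambda>\<omega>. transpose (f \<omega>)) \<in> borel_measurable M"
proof -
  have "continuous_on UNIV (transpose :: real^'k^'d \<Rightarrow> _)"
    by (auto simp: transpose_def[abs_def] intro!: continuous_intros)
  from borel_measurable_continuous_onI[OF this] assms show ?thesis by simp
qed

context prob_space
begin

definition square_integrable :: "('a \<Rightarrow> 'v::euclidean_space) \<Rightarrow> bool" where
  "square_integrable Y \<longleftrightarrow> Y \<in> borel_measurable M \<and> integrable M (\<lambda>\<omega>. (norm (Y \<omega>))^2)"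

lemma square_integrableD:
  assumes "square_integrable Y"
  shows "Y \<in> borel_measurable M" "integrable M (\<lambda>\<omega>. (norm (Y \<omega>))^2)"
  using assms by (auto simp: square_integrable_def)

text \<open>The constant absorbs operator norms, so that images under bounded derivatives are covered.\<close>

lemma square_integrable_mono:
  assumes Y: "square_integrable Y" and [measurable]: "Z \<in> borel_measurable M"
    and "\<And>\<omega>. norm (Z \<omega>) \<le> c * norm (Y \<omega>)"
  shows "square_integrable Z"
  unfolding square_integrable_def
proof
  note [measurable] = square_integrableD(1)[OF Y]
  show "integrable M (\<lambda>\<omega>. (norm (Z \<omega>))^2)"
  proof (rule Bochner_Integration.integrable_bound)
    show "integrable M (\<lambda>\<omega>. c^2 * (norm (Y \<omega>))^2)"
      using square_integrableD(2)[OF Y] by simp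
    show "AE \<omega> in M. norm ((norm (Z \<omega>))^2) \<le> norm (c^2 * (norm (Y \<omega>))^2)"
      using assms(3) by (auto simp flip: power_mult_distrib intro!: power_mono)
  qed measurable
qed fact

lemma square_integrable_const [simp]: "square_integrable (\<lambda>_. c)"
  by (simp add: square_integrable_def)

lemma square_integrable_bounded:
  assumes "Z \<in> borel_measurable M" "\<And>\<omega>. norm (Z \<omega>) \<le> c"
  shows "square_integrable Z"
  by (rule square_integrable_mono[of "\<lambda>_. 1::real" _ c]) (use assms in auto)

lemma square_integrable_add:
  assumes Y: "square_integrable Y" and Z: "square_integrable Z"
  shows "square_integrable (\<lambda>\<omega>. Y \<omega> + Z \<omega>)"
  unfolding square_integrable_def
proof
  note [measurable] = square_integrableD(1)[OF Y] square_integrableD(1)[OF Z]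
  show "(\<lambda>\<omega>. Y \<omega> + Z \<omega>) \<in> borel_measurable M" by measurable
  show "integrable M (\<lambda>\<omega>. (norm (Y \<omega> + Z \<omega>))^2)"
  proof (rule Bochner_Integration.integrable_bound)
    show "integrable M (\<lambda>\<omega>. 2 * (norm (Y \<omega>))^2 + 2 * (norm (Z \<omega>))^2)"
      using square_integrableD(2)[OF Y] square_integrableD(2)[OF Z] by simp
    have "(norm (Y \<omega> + Z \<omega>))^2 \<le> 2 * (norm (Y \<omega>))^2 + 2 * (norm (Z \<omega>))^2" for \<omega>
    proof -
      have "(norm (Y \<omega> + Z \<omega>))^2 \<le> (norm (Y \<omega>) + norm (Z \<omega>))^2"
        by (intro power_mono norm_triangle_ineq) auto
      also have "\<dots> \<le> 2 * (norm (Y \<omega>))^2 + 2 * (norm (Z \<omega>))^2"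
        using sum_squares_bound[of "norm (Y \<omega>)" "norm (Z \<omega>)"] by (simp add: power2_sum)
      finally show ?thesis .
    qed
    thus "AE \<omega> in M. norm ((norm (Y \<omega> + Z \<omega>))^2) \<le> norm (2 * (norm (Y \<omega>))^2 + 2 * (norm (Z \<omega>))^2)"
      by auto
  qed measurable
qed

lemma square_integrable_scaleR:
  assumes "square_integrable Y"
  shows "square_integrable (\<lambda>\<omega>. c *\<^sub>R Y \<omega>)"
  using assms by (auto simp: square_integrable_def power_mult_distrib)

lemma square_integrable_diff:
  assumes "square_integrable Y" "square_integrable Z"
  shows "square_integrable (\<lambda>\<omega>. Y \<omega> - Z \<omega>)"
  using square_integrable_add[OF assms(1) square_integrable_scaleR[OF assms(2), of "-1"]] by simp

lemma square_integrable_sum: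
  assumes "\<And>t. t \<in> T \<Longrightarrow> square_integrable (Y t)"
  shows "square_integrable (\<lambda>\<omega>. \<Sum>t\<in>T. Y t \<omega>)"
  using assms by (induction T rule: infinite_finite_induct) (auto intro: square_integrable_add)

lemma square_integrable_inner:
  assumes Y: "square_integrable Y" and Z: "square_integrable Z"
  shows "integrable M (\<lambda>\<omega>. Y \<omega> \<bullet> Z \<omega>)"
proof (rule Bochner_Integration.integrable_bound)
  note [measurable] = square_integrableD(1)[OF Y] square_integrableD(1)[OF Z]
  show "(\<lambda>\<omega>. Y \<omega> \<bullet> Z \<omega>) \<in> borel_measurable M" by measurable
  show "integrable M (\<lambda>\<omega>. (norm (Y \<omega>))^2 + (norm (Z \<omega>))^2)"
    using square_integrableD(2)[OF Y] square_integrableD(2)[OF Z] by simp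
  have "\<bar>Y \<omega> \<bullet> Z \<omega>\<bar> \<le> (norm (Y \<omega>))^2 + (norm (Z \<omega>))^2" for \<omega>
    using Cauchy_Schwarz_ineq2[of "Y \<omega>" "Z \<omega>"] sum_squares_bound[of "norm (Y \<omega>)" "norm (Z \<omega>)"]
      mult_nonneg_nonneg[of "norm (Y \<omega>)" "norm (Z \<omega>)"] norm_ge_zero[of "Y \<omega>"] norm_ge_zero[of "Z \<omega>"]
    by linarith
  thus "AE \<omega> in M. norm (Y \<omega> \<bullet> Z \<omega>) \<le> norm ((norm (Y \<omega>))^2 + (norm (Z \<omega>))^2)" by auto
qed

lemma square_integrable_integrable:
  assumes "square_integrable Y"
  shows "integrable M (\<lambda>\<omega>. norm (Y \<omega>))"
proof -
  have "square_integrable (\<lambda>\<omega>. norm (Y \<omega>))"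
    using assms by (auto simp: square_integrable_def)
  from square_integrable_inner[OF this square_integrable_const[of 1]] show ?thesis by simp
qed

lemma expectation_norm_le:
  assumes Y: "square_integrable Y" and c: "expectation (\<lambda>\<omega>. (norm (Y \<omega>))^2) \<le> c^2" "0 \<le> c"
  shows "expectation (\<lambda>\<omega>. norm (Y \<omega>)) \<le> c"
proof -
  let ?m = "expectation (\<lambda>\<omega>. norm (Y \<omega>))"
  note i = square_integrable_integrable[OF Y] square_integrableD(2)[OF Y]
  have "0 \<le> expectation (\<lambda>\<omega>. (norm (Y \<omega>) - ?m)^2)" by simp
  also have "\<dots> = expectation (\<lambda>\<omega>. (norm (Y \<omega>))^2) - 2 * ?m * ?m + ?m^2"
    using i by (simp add: power2_diff prob_space algebra_simps)
  finally have "?m^2 \<le> c^2" using c(1) by (simp add: power2_eq_square)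
  thus ?thesis using c(2) by (rule power2_le_imp_le)
qed

text \<open>
  Pythagoras for the squared norms, then Jensen. This is where the sums of noise terms gain the
  factor \<open>sqrt n\<close> instead of \<open>n\<close>.
\<close>

lemma orthogonal_sum_norm:
  fixes n :: nat
  assumes Y: "\<And>t. t < n \<Longrightarrow> square_integrable (e t)"
    and c: "\<And>t. t < n \<Longrightarrow> expectation (\<lambda>\<omega>. (norm (e t \<omega>))^2) \<le> c^2" "0 \<le> c"
    and orth: "\<And>s t. s < t \<Longrightarrow> t < n \<Longrightarrow> expectation (\<lambda>\<omega>. e s \<omega> \<bullet> e t \<omega>) = 0"
  shows "expectation (\<lambda>\<omega>. norm (\<Sum>t<n. e t \<omega>)) \<le> sqrt n * c"
proof (rule expectation_norm_le)
  show "square_integrable (\<lambda>\<omega>. \<Sum>t<n. e t \<omega>)" using Y by (intro square_integrable_sum) auto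
  have "m \<le> n \<Longrightarrow> expectation (\<lambda>\<omega>. (norm (\<Sum>t<m. e t \<omega>))^2) \<le> m * c^2" for m :: nat
  proof (induction m)
    case (Suc m)
    let ?S = "\<lambda>\<omega>. \<Sum>t<m. e t \<omega>"
    have S: "square_integrable ?S" using Y Suc.prems by (intro square_integrable_sum) auto
    have em: "square_integrable (e m)" using Y Suc.prems by auto
    have "expectation (\<lambda>\<omega>. ?S \<omega> \<bullet> e m \<omega>) = (\<Sum>t<m. expectation (\<lambda>\<omega>. e t \<omega> \<bullet> e m \<omega>))"
      unfolding inner_sum_left
      using Y Suc.prems em by (intro Bochner_Integration.integral_sum square_integrable_inner) auto
    also have "\<dots> = 0" using orth Suc.prems by (intro sum.neutral) auto
    finally have 0: "expectation (\<lambda>\<omega>. ?S \<omega> \<bullet> e m \<omega>) = 0" .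
    have "(\<lambda>\<omega>. (norm (\<Sum>t<Suc m. e t \<omega>))^2)
        = (\<lambda>\<omega>. (norm (?S \<omega>))^2 + 2 * (?S \<omega> \<bullet> e m \<omega>) + (norm (e m \<omega>))^2)"
      unfolding power2_norm_eq_inner by (simp add: inner_add_left inner_add_right inner_commute algebra_simps)
    hence "expectation (\<lambda>\<omega>. (norm (\<Sum>t<Suc m. e t \<omega>))^2)
        = expectation (\<lambda>\<omega>. (norm (?S \<omega>))^2) + expectation (\<lambda>\<omega>. (norm (e m \<omega>))^2)"
      using square_integrableD(2)[OF S] square_integrableD(2)[OF em] square_integrable_inner[OF S em] 0
      by simp
    thus ?case using Suc c(1)[of m] by (simp add: algebra_simps)
  qed simp
  from this[of n] show "expectation (\<lambda>\<omega>. (norm (\<Sum>t<n. e t \<omega>))^2) \<le> (sqrt n * c)^2"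
    by (simp add: power_mult_distrib)
qed (use c in auto)

lemma square_integrable_nnI:
  assumes "Y \<in> borel_measurable M" "(\<integral>\<^sup>+\<omega>. ennreal ((norm (Y \<omega>))^2) \<partial>M) \<le> ennreal c" "0 \<le> c"
  shows "square_integrable Y" "expectation (\<lambda>\<omega>. (norm (Y \<omega>))^2) \<le> c"
proof -
  have [measurable]: "Y \<in> borel_measurable M" by fact
  have "integrable M (\<lambda>\<omega>. (norm (Y \<omega>))^2)"
    using assms(2) by (intro integrableI_nonneg) (auto intro: le_less_trans)
  thus "square_integrable Y" using assms(1) by (simp add: square_integrable_def)
  with assms(2,3) show "expectation (\<lambda>\<omega>. (norm (Y \<omega>))^2) \<le> c"
    by (subst (asm) nn_integral_eq_integral) (auto simp: square_integrable_def)
qed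

lemma second_moment_leD:
  assumes "second_moment_le M Y c"
  shows "(\<integral>\<^sup>+\<omega>. ennreal ((norm (Y \<omega>))^2) \<partial>M) \<le> ennreal c"
  using assms unfolding second_moment_le_def
  by (subst nn_integral_eq_integral) (auto intro: ennreal_leI)

lemma mean_norm_le:
  fixes Y :: "'a \<Rightarrow> 'v::euclidean_space"
  assumes "has_bochner_integral M Y v" "second_moment_le M Y (c^2)" "0 \<le> c"
  shows "norm v \<le> c"
proof -
  have Y: "square_integrable Y"
    using assms by (auto simp: square_integrable_def second_moment_le_def has_bochner_integral_iff)
  have "norm v = norm (expectation Y)" using assms by (simp add: has_bochner_integral_iff)
  also have "\<dots> \<le> expectation (\<lambda>\<omega>. norm (Y \<omega>))" by (rule integral_norm_bound)
  also have "\<dots> \<le> c"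
    using assms by (intro expectation_norm_le[OF Y]) (auto simp: second_moment_le_def)
  finally show ?thesis .
qed

end

lemma is_copy_of_has_bochner_integral:
  fixes \<phi> :: "'b::topological_space \<Rightarrow> 'v::{banach, second_countable_topology}"
  assumes Y: "is_copy_of M Y Y0" and Y0: "Y0 \<in> borel_measurable M" and \<phi>: "\<phi> \<in> borel_measurable borel"
    and int: "has_bochner_integral M (\<lambda>\<omega>. \<phi> (Y0 \<omega>)) v"
  shows "has_bochner_integral M (\<lambda>\<omega>. \<phi> (Y \<omega>)) v"
proof -
  have Ym: "Y \<in> borel_measurable M" and eq: "distr M borel Y = distr M borel Y0"
    using Y by (auto simp: is_copy_of_def)
  have "integrable (distr M borel Y) \<phi>" "integral\<^sup>L (distr M borel Y) \<phi> = v"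
    unfolding eq using int
    by (auto simp: integrable_distr_eq[OF Y0 \<phi>] integral_distr[OF Y0 \<phi>] has_bochner_integral_iff)
  thus ?thesis
    by (auto simp: integrable_distr_eq[OF Ym \<phi>] integral_distr[OF Ym \<phi>] has_bochner_integral_iff)
qed

lemma is_copy_of_second_moment_le:
  fixes \<phi> :: "'b::topological_space \<Rightarrow> 'v::{real_normed_vector, second_countable_topology}"
  assumes Y: "is_copy_of M Y Y0" and Y0: "Y0 \<in> borel_measurable M" and \<phi>: "\<phi> \<in> borel_measurable borel"
    and le: "second_moment_le M (\<lambda>\<omega>. \<phi> (Y0 \<omega>)) c"
  shows "second_moment_le M (\<lambda>\<omega>. \<phi> (Y \<omega>)) c"
proof -
  have m: "(\<lambda>s. (norm (\<phi> s))^2) \<in> borel_measurable borel" using \<phi> by measurable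
  have "has_bochner_integral M (\<lambda>\<omega>. (norm (\<phi> (Y0 \<omega>)))^2) (\<integral>\<omega>. (norm (\<phi> (Y0 \<omega>)))^2 \<partial>M)"
    using le by (auto simp: second_moment_le_def has_bochner_integral_iff)
  from is_copy_of_has_bochner_integral[OF Y Y0 m this] le show ?thesis
    by (auto simp: second_moment_le_def has_bochner_integral_iff)
qed

lemma jointly_measurable_section:
  assumes "jointly_measurable orc"
  shows "orc u \<in> borel_measurable borel"
proof -
  have "(\<lambda>s. (u, s)) \<in> measurable borel (borel \<Otimes>\<^sub>M borel)" by measurable
  from measurable_compose[OF this assms[unfolded jointly_measurable_def]] show ?thesis by simp
qed

text \<open>
  Integrating a conditional variance removes the conditioning. Of the conditional mean, the
  projection argument needs the measurability.
\<close>

lemma (in prob_space) conditional_variance_integral: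
  fixes Y :: "'a \<Rightarrow> 'b::topological_space" and H :: "'a \<Rightarrow> real^'k"
  assumes Y: "Y \<in> borel_measurable M" and H: "H \<in> borel_measurable M"
    and le: "AE \<omega> in M. cond_variance M (generated_algebra M Y) H \<omega> \<le> ennreal c"
  shows "cond_mean M (generated_algebra M Y) H \<in> borel_measurable (generated_algebra M Y)"
    and "(\<integral>\<^sup>+\<omega>. ennreal ((norm (H \<omega> - cond_mean M (generated_algebra M Y) H \<omega>))^2) \<partial>M) \<le> ennreal c"
proof -
  let ?A = "generated_algebra M Y"
  have sub: "subalgebra M ?A"
    unfolding subalgebra_def using Y by (auto simp: sets_vimage_algebra2 measurable_sets)
  interpret finite_measure_subalgebra M ?A by unfold_locales (rule sub)
  show m: "cond_mean M ?A H \<in> borel_measurable ?A"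
    unfolding cond_mean_def
    by (subst borel_measurable_euclidean_space) (auto simp: Basis_vec_def inner_axis)
  note [measurable] = measurable_from_subalg[OF sub m] H
  have "(\<integral>\<^sup>+\<omega>. ennreal ((norm (H \<omega> - cond_mean M ?A H \<omega>))^2) \<partial>M)
      = (\<integral>\<^sup>+\<omega>. cond_variance M ?A H \<omega> \<partial>M)"
    using nn_cond_exp_intg[of "\<lambda>_. 1" "\<lambda>\<omega>. ennreal ((norm (H \<omega> - cond_mean M ?A H \<omega>))^2)"]
    by (simp add: cond_variance_def)
  also have "\<dots> \<le> (\<integral>\<^sup>+\<omega>. ennreal c \<partial>M)" by (rule nn_integral_mono_AE[OF le])
  also have "\<dots> = ennreal c" by (simp add: emeasure_space_1)
  finally show "(\<integral>\<^sup>+\<omega>. ennreal ((norm (H \<omega> - cond_mean M ?A H \<omega>))^2) \<partial>M) \<le> ennreal c" .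
qed

section \<open>Independent samples and their histories\<close>

text \<open>
  The algebra \<open>A i\<close> consists of the events determined by the \<open>i\<close>-th sample. Working with algebras
  allows samples of different types.
\<close>

locale sample_space = prob_space M for M :: "'w measure" +
  fixes A :: "'i \<Rightarrow> 'w set set" and I :: "'i set"
  assumes indep: "indep_sets A I" and Int_stable: "\<And>i. i \<in> I \<Longrightarrow> Int_stable (A i)"
begin

text \<open>The information carried by the samples with index in \<open>J\<close>.\<close>

definition hist :: "'i set \<Rightarrow> 'w measure" where
  "hist J = sigma (space M) (\<Union>i\<in>J. A i)"

lemma A_events: "i \<in> I \<Longrightarrow> A i \<subseteq> events"
  using indep by (auto simp: indep_sets_def)

lemma A_Pow: "J \<subseteq> I \<Longrightarrow> (\<Union>i\<in>J. A i) \<subseteq> Pow (space M)"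
  using A_events sets.space_closed by blast

lemma space_hist [simp]: "space (hist J) = space M"
  unfolding hist_def by (rule space_measure_of_conv)

lemma sets_hist: "J \<subseteq> I \<Longrightarrow> sets (hist J) = sigma_sets (space M) (\<Union>i\<in>J. A i)"
  unfolding hist_def by (rule sets_measure_of[OF A_Pow])

lemma hist_subalgebra: "J \<subseteq> I \<Longrightarrow> subalgebra M (hist J)"
  unfolding subalgebra_def using A_events by (auto simp: sets_hist intro!: sets.sigma_sets_subset)

lemma hist_mono:
  assumes "f \<in> measurable (hist J) N" "J \<subseteq> K" "K \<subseteq> I"
  shows "f \<in> measurable (hist K) N"
proof -
  have "subalgebra (hist K) (hist J)"
    using assms by (auto simp: subalgebra_def sets_hist intro!: sigma_sets_mono')
  thus ?thesis using assms(1) by (rule measurable_from_subalg)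
qed

lemma hist_measurable:
  assumes "f \<in> measurable (hist J) N" "J \<subseteq> I"
  shows "f \<in> measurable M N"
  using measurable_from_subalg[OF hist_subalgebra[OF assms(2)] assms(1)] .

lemma hist_indep:
  assumes J: "J \<subseteq> I" "K \<subseteq> I" "J \<inter> K = {}" and a: "a \<in> sets (hist J)" and b: "b \<in> sets (hist K)"
  shows "prob (a \<inter> b) = prob a * prob b"
proof -
  have "indep_sets (\<lambda>c. sigma_sets (space M) (\<Union>i\<in>(case c of True \<Rightarrow> J | False \<Rightarrow> K). A i)) UNIV"
  proof (rule indep_sets_collect_sigma)
    show "indep_sets A (\<Union>c. case c of True \<Rightarrow> J | False \<Rightarrow> K)"
      using J by (intro indep_sets_mono_index[OF _ indep]) (auto split: bool.splits)
    show "Int_stable (A i)" if "i \<in> (case c of True \<Rightarrow> J | False \<Rightarrow> K)" for c i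
      using that J by (intro Int_stable) (auto split: bool.splits)
    show "disjoint_family_on (\<lambda>c. case c of True \<Rightarrow> J | False \<Rightarrow> K) UNIV"
      using J(3) by (auto simp: disjoint_family_on_def split: bool.splits)
  qed
  moreover have "(\<lambda>c. sigma_sets (space M) (\<Union>i\<in>(case c of True \<Rightarrow> J | False \<Rightarrow> K). A i))
    = case_bool (sigma_sets (space M) (\<Union>i\<in>J. A i)) (sigma_sets (space M) (\<Union>i\<in>K. A i))"
    by (auto split: bool.splits)
  ultimately have "indep_set (sets (hist J)) (sets (hist K))"
    using J by (simp add: indep_set_def sets_hist)
  thus ?thesis using a b unfolding indep_sets2_eq by blast
qed

text \<open>
  Freezing the history: in \<open>h(\<omega>, S \<omega>)\<close>, where \<open>h\<close> depends on \<open>\<omega>\<close> only through the samples in \<open>J\<close> and \<open>S\<close> is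
  determined by other samples, the two occurrences of \<open>\<omega>\<close> may be integrated separately. Indeed the
  law of \<open>(\<omega>, S \<omega>)\<close> is a product by independence. Keeping \<open>\<omega>\<close> itself as the first component avoids
  listing the random variables that make up the history.
\<close>

lemma
  fixes S :: "'w \<Rightarrow> 't" and T :: "'t measure"
  assumes J: "J \<subseteq> I" "K \<subseteq> I" "J \<inter> K = {}" and S: "S \<in> measurable (hist K) T"
  shows freeze_nn: "\<And>h :: 'w \<times> 't \<Rightarrow> ennreal. h \<in> borel_measurable (hist J \<Otimes>\<^sub>M T) \<Longrightarrow>
      (\<integral>\<^sup>+\<omega>. h (\<omega>, S \<omega>) \<partial>M) = (\<integral>\<^sup>+\<omega>. (\<integral>\<^sup>+\<omega>'. h (\<omega>, S \<omega>') \<partial>M) \<partial>M)"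
    and freeze_integral: "\<And>h :: 'w \<times> 't \<Rightarrow> real. h \<in> borel_measurable (hist J \<Otimes>\<^sub>M T) \<Longrightarrow>
      integrable M (\<lambda>\<omega>. h (\<omega>, S \<omega>)) \<Longrightarrow>
      has_bochner_integral M (\<lambda>\<omega>. \<integral>\<omega>'. h (\<omega>, S \<omega>') \<partial>M) (\<integral>\<omega>. h (\<omega>, S \<omega>) \<partial>M)"
proof -
  have id [measurable]: "(\<lambda>\<omega>. \<omega>) \<in> measurable M (hist J)"
    by (rule measurable_from_subalg[OF hist_subalgebra[OF J(1)]]) simp
  have Sm [measurable]: "S \<in> measurable M T" using S J by (rule_tac hist_measurable)
  have distr: "distr M (hist J) (\<lambda>\<omega>. \<omega>) \<Otimes>\<^sub>M distr M T S = distr M (hist J \<Otimes>\<^sub>M T) (\<lambda>\<omega>. (\<omega>, S \<omega>))"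
  proof (rule pair_measure_eqI)
    fix a b assume "a \<in> sets (distr M (hist J) (\<lambda>\<omega>. \<omega>))" "b \<in> sets (distr M T S)"
    hence a [measurable]: "a \<in> sets (hist J)" and b [measurable]: "b \<in> sets T" by auto
    have a': "a \<in> events" using a hist_subalgebra[OF J(1)] by (auto simp: subalgebra_def)
    have "S -` b \<inter> space M \<in> sets (hist K)" using measurable_sets[OF S b] by simp
    from hist_indep[OF J a this]
    have "emeasure M (a \<inter> (S -` b \<inter> space M)) = emeasure M a * emeasure M (S -` b \<inter> space M)"
      by (simp add: emeasure_eq_measure ennreal_mult)
    moreover have "a \<inter> space M = a" using sets.sets_into_space[OF a'] by auto
    moreover have "(\<lambda>\<omega>. (\<omega>, S \<omega>)) -` (a \<times> b) \<inter> space M = a \<inter> (S -` b \<inter> space M)"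
      using sets.sets_into_space[OF a'] by auto
    ultimately show "emeasure (distr M (hist J) (\<lambda>\<omega>. \<omega>)) a * emeasure (distr M T S) b
        = emeasure (distr M (hist J \<Otimes>\<^sub>M T) (\<lambda>\<omega>. (\<omega>, S \<omega>))) (a \<times> b)"
      by (simp add: emeasure_distr)
  qed (auto intro!: sets_pair_measure_cong prob_space_imp_sigma_finite prob_space_distr)
  interpret D1: prob_space "distr M (hist J) (\<lambda>\<omega>. \<omega>)" by (rule prob_space_distr) measurable
  interpret D2: prob_space "distr M T S" by (rule prob_space_distr) measurable
  interpret P: pair_sigma_finite "distr M (hist J) (\<lambda>\<omega>. \<omega>)" "distr M T S" ..
  have sets_eq: "sets (distr M (hist J) (\<lambda>\<omega>. \<omega>) \<Otimes>\<^sub>M distr M T S) = sets (hist J \<Otimes>\<^sub>M T)"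
    by (intro sets_pair_measure_cong) auto
  show "(\<integral>\<^sup>+\<omega>. h (\<omega>, S \<omega>) \<partial>M) = (\<integral>\<^sup>+\<omega>. (\<integral>\<^sup>+\<omega>'. h (\<omega>, S \<omega>') \<partial>M) \<partial>M)"
    if h [measurable]: "h \<in> borel_measurable (hist J \<Otimes>\<^sub>M T)" for h :: "'w \<times> 't \<Rightarrow> ennreal"
  proof -
    have h': "h \<in> borel_measurable (distr M (hist J) (\<lambda>\<omega>. \<omega>) \<Otimes>\<^sub>M distr M T S)"
      by (simp cong: measurable_cong_sets add: sets_eq)
    have "(\<integral>\<^sup>+\<omega>. h (\<omega>, S \<omega>) \<partial>M) = (\<integral>\<^sup>+p. h p \<partial>distr M (hist J \<Otimes>\<^sub>M T) (\<lambda>\<omega>. (\<omega>, S \<omega>)))"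
      by (subst nn_integral_distr) auto
    also have "\<dots> = (\<integral>\<^sup>+\<omega>. (\<integral>\<^sup>+s. h (\<omega>, s) \<partial>distr M T S) \<partial>distr M (hist J) (\<lambda>\<omega>. \<omega>))"
      unfolding distr[symmetric] by (rule D2.nn_integral_fst[symmetric, OF h'])
    also have "\<dots> = (\<integral>\<^sup>+\<omega>. (\<integral>\<^sup>+s. h (\<omega>, s) \<partial>distr M T S) \<partial>M)"
      using D2.borel_measurable_nn_integral_fst[OF h'] by (subst nn_integral_distr) auto
    also have "\<dots> = (\<integral>\<^sup>+\<omega>. (\<integral>\<^sup>+\<omega>'. h (\<omega>, S \<omega>') \<partial>M) \<partial>M)"
      by (intro nn_integral_cong, subst nn_integral_distr) auto
    finally show ?thesis .
  qed
  fix h :: "'w \<times> 't \<Rightarrow> real"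
  assume h [measurable]: "h \<in> borel_measurable (hist J \<Otimes>\<^sub>M T)"
    and int: "integrable M (\<lambda>\<omega>. h (\<omega>, S \<omega>))"
  have int': "integrable (distr M (hist J) (\<lambda>\<omega>. \<omega>) \<Otimes>\<^sub>M distr M T S) h"
    unfolding distr using int by (subst integrable_distr_eq) auto
  have inner: "(\<integral>s. h (\<omega>, s) \<partial>distr M T S) = (\<integral>\<omega>'. h (\<omega>, S \<omega>') \<partial>M)" if "\<omega> \<in> space M" for \<omega>
    using that by (subst integral_distr) auto
  have "(\<integral>\<omega>. h (\<omega>, S \<omega>) \<partial>M) = (\<integral>p. h p \<partial>distr M (hist J \<Otimes>\<^sub>M T) (\<lambda>\<omega>. (\<omega>, S \<omega>)))"
    by (subst integral_distr) auto
  also have "\<dots> = (\<integral>\<omega>. (\<integral>s. h (\<omega>, s) \<partial>distr M T S) \<partial>distr M (hist J) (\<lambda>\<omega>. \<omega>))"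
    unfolding distr[symmetric] by (rule P.integral_fst'[symmetric, OF int'])
  also have "\<dots> = (\<integral>\<omega>. (\<integral>s. h (\<omega>, s) \<partial>distr M T S) \<partial>M)"
    using borel_measurable_integrable[OF P.integrable_fst'[OF int']] by (subst integral_distr) auto
  also have "\<dots> = (\<integral>\<omega>. (\<integral>\<omega>'. h (\<omega>, S \<omega>') \<partial>M) \<partial>M)"
    by (intro Bochner_Integration.integral_cong refl inner)
  finally have eq: "(\<integral>\<omega>. h (\<omega>, S \<omega>) \<partial>M) = (\<integral>\<omega>. (\<integral>\<omega>'. h (\<omega>, S \<omega>') \<partial>M) \<partial>M)" .
  have "integrable M (\<lambda>\<omega>. (\<integral>s. h (\<omega>, s) \<partial>distr M T S))"
    using P.integrable_fst'[OF int'] by (subst (asm) integrable_distr_eq) auto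
  hence "integrable M (\<lambda>\<omega>. (\<integral>\<omega>'. h (\<omega>, S \<omega>') \<partial>M))"
    by (subst (asm) Bochner_Integration.integrable_cong[OF refl inner]) auto
  with eq show "has_bochner_integral M (\<lambda>\<omega>. \<integral>\<omega>'. h (\<omega>, S \<omega>') \<partial>M) (\<integral>\<omega>. h (\<omega>, S \<omega>) \<partial>M)"
    by (simp add: has_bochner_integral_iff)
qed

text \<open>
  Centred relative to the history \<open>J\<close>, stated as orthogonality to all square-integrable
  history-measurable vectors instead of through a conditional expectation.
\<close>

definition uncorrelated :: "'i set \<Rightarrow> ('w \<Rightarrow> 'v::euclidean_space) \<Rightarrow> bool" where
  "uncorrelated J e \<longleftrightarrow> square_integrable e \<and>
     (\<forall>k. square_integrable k \<longrightarrow> k \<in> borel_measurable (hist J) \<longrightarrow> expectation (\<lambda>\<omega>. k \<omega> \<bullet> e \<omega>) = 0)"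

lemma uncorrelatedD:
  assumes "uncorrelated J e"
  shows "square_integrable e"
    and "\<And>k. square_integrable k \<Longrightarrow> k \<in> borel_measurable (hist J) \<Longrightarrow> expectation (\<lambda>\<omega>. k \<omega> \<bullet> e \<omega>) = 0"
  using assms by (auto simp: uncorrelated_def)

text \<open>
  Projection in \<open>L^2\<close>: among history-measurable vectors, the conditional mean \<open>m\<close> is closest to \<open>H\<close>. It
  allows a variance bound relative to a coarser algebra, whose conditional mean \<open>m'\<close> need not be
  computed, to be used for the deviation from \<open>m\<close>.
\<close>

lemma conditional_variance_minimal:
  assumes e: "uncorrelated J (\<lambda>\<omega>. H \<omega> - m \<omega>)" and J: "J \<subseteq> I"
    and m: "square_integrable m" "m \<in> borel_measurable (hist J)" and m' [measurable]: "m' \<in> borel_measurable (hist J)"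
    and c: "(\<integral>\<^sup>+\<omega>. ennreal ((norm (H \<omega> - m' \<omega>))^2) \<partial>M) \<le> ennreal c" "0 \<le> c"
  shows "expectation (\<lambda>\<omega>. (norm (H \<omega> - m \<omega>))^2) \<le> c"
proof -
  note e1 = uncorrelatedD(1)[OF e]
  have H: "square_integrable H" using square_integrable_add[OF e1 m(1)] by simp
  note [measurable] = square_integrableD(1)[OF H] m(2) hist_measurable[OF m' J]
  have d: "square_integrable (\<lambda>\<omega>. H \<omega> - m' \<omega>)" "expectation (\<lambda>\<omega>. (norm (H \<omega> - m' \<omega>))^2) \<le> c"
    using c by (intro square_integrable_nnI; measurable)+
  have mm: "square_integrable (\<lambda>\<omega>. m \<omega> - m' \<omega>)"
    using square_integrable_diff[OF d(1) e1] by simp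
  have 0: "expectation (\<lambda>\<omega>. (m \<omega> - m' \<omega>) \<bullet> (H \<omega> - m \<omega>)) = 0"
    by (intro uncorrelatedD(2)[OF e] mm) measurable
  have "(\<lambda>\<omega>. (norm (H \<omega> - m' \<omega>))^2)
      = (\<lambda>\<omega>. (norm (H \<omega> - m \<omega>))^2 + 2 * ((m \<omega> - m' \<omega>) \<bullet> (H \<omega> - m \<omega>)) + (norm (m \<omega> - m' \<omega>))^2)"
    unfolding power2_norm_eq_inner by (simp add: inner_diff_left inner_diff_right inner_commute algebra_simps)
  hence "expectation (\<lambda>\<omega>. (norm (H \<omega> - m' \<omega>))^2)
      = expectation (\<lambda>\<omega>. (norm (H \<omega> - m \<omega>))^2) + expectation (\<lambda>\<omega>. (norm (m \<omega> - m' \<omega>))^2)"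
    using square_integrableD(2)[OF e1] square_integrableD(2)[OF mm] square_integrable_inner[OF mm e1] 0
    by simp
  moreover have "0 \<le> expectation (\<lambda>\<omega>. (norm (m \<omega> - m' \<omega>))^2)" by simp
  ultimately show ?thesis using d(2) by linarith
qed

end

lemma (in sample_space) generated_algebra_subalgebra:
  assumes "Y \<in> borel_measurable (hist J)"
  shows "subalgebra (hist J) (generated_algebra M Y)"
  unfolding subalgebra_def using assms measurable_sets[OF assms] by (auto simp: sets_vimage_algebra2)

lemma (in sample_space) hist_sample_measurable:
  fixes Y :: "'w \<Rightarrow> 'b::topological_space"
  assumes "i \<in> I" "A i = sets (generated_algebra M Y)"
  shows "Y \<in> borel_measurable (hist {i})"
proof (rule measurableI)
  fix B :: "'b set" assume "B \<in> sets borel"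
  hence "Y -` B \<inter> space M \<in> A i" unfolding assms(2) by (rule in_vimage_algebra)
  thus "Y -` B \<inter> space (hist {i}) \<in> sets (hist {i})"
    using assms(1) by (auto simp: sets_hist)
qed auto

section \<open>Stochastic oracles at adapted query points\<close>

context sample_space
begin

text \<open>A moment bound for every fixed query point carries over to adapted query points.\<close>

lemma frozen_moment:
  fixes h :: "'w \<Rightarrow> 's::topological_space \<Rightarrow> 'v::euclidean_space"
  assumes J: "J \<subseteq> I" "i \<in> I - J" and S: "S \<in> borel_measurable (hist {i})"
    and h: "(\<lambda>(\<omega>, s). h \<omega> s) \<in> borel_measurable (hist J \<Otimes>\<^sub>M borel)"
    and moment: "\<And>\<omega>. (\<integral>\<^sup>+\<omega>'. ennreal ((norm (h \<omega> (S \<omega>')))^2) \<partial>M) \<le> ennreal (\<kappa> \<omega>)"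
    and \<kappa>: "integrable M \<kappa>" "\<And>\<omega>. 0 \<le> \<kappa> \<omega>"
  shows "square_integrable (\<lambda>\<omega>. h \<omega> (S \<omega>))"
    and "expectation (\<lambda>\<omega>. (norm (h \<omega> (S \<omega>)))^2) \<le> expectation \<kappa>"
proof -
  have JK: "{i} \<subseteq> I" "J \<inter> {i} = {}" using J(2) by auto
  have id: "(\<lambda>\<omega>. \<omega>) \<in> measurable M (hist J)"
    by (rule measurable_from_subalg[OF hist_subalgebra[OF J(1)]]) simp
  have hS: "(\<lambda>\<omega>. h \<omega> (S \<omega>)) \<in> borel_measurable M"
    using measurable_compose[OF measurable_Pair[OF id hist_measurable[OF S JK(1)]] h] by simp
  have "(\<integral>\<^sup>+\<omega>. ennreal ((norm (h \<omega> (S \<omega>)))^2) \<partial>M)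
      = (\<integral>\<^sup>+\<omega>. (\<integral>\<^sup>+\<omega>'. ennreal ((norm (h \<omega> (S \<omega>')))^2) \<partial>M) \<partial>M)"
    using freeze_nn[OF J(1) JK S, of "\<lambda>p. ennreal ((norm ((\<lambda>(\<omega>, s). h \<omega> s) p))^2)"] h by simp
  also have "\<dots> \<le> (\<integral>\<^sup>+\<omega>. ennreal (\<kappa> \<omega>) \<partial>M)" by (intro nn_integral_mono moment)
  also have "\<dots> = ennreal (expectation \<kappa>)" using \<kappa> by (intro nn_integral_eq_integral) auto
  finally show "square_integrable (\<lambda>\<omega>. h \<omega> (S \<omega>))"
    and "expectation (\<lambda>\<omega>. (norm (h \<omega> (S \<omega>)))^2) \<le> expectation \<kappa>"
    using square_integrable_nnI[OF hS] \<kappa>(2) by simp_all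
qed

lemma frozen_mean:
  fixes h :: "'w \<Rightarrow> 's::topological_space \<Rightarrow> real"
  assumes J: "J \<subseteq> I" "i \<in> I - J" and S: "S \<in> borel_measurable (hist {i})"
    and h: "(\<lambda>(\<omega>, s). h \<omega> s) \<in> borel_measurable (hist J \<Otimes>\<^sub>M borel)"
    and int: "integrable M (\<lambda>\<omega>. h \<omega> (S \<omega>))"
    and mean: "\<And>\<omega>. has_bochner_integral M (\<lambda>\<omega>'. h \<omega> (S \<omega>')) (b \<omega>)"
  shows "has_bochner_integral M b (expectation (\<lambda>\<omega>. h \<omega> (S \<omega>)))"
proof -
  have JK: "{i} \<subseteq> I" "J \<inter> {i} = {}" using J(2) by auto
  have "b = (\<lambda>\<omega>. \<integral>\<omega>'. h \<omega> (S \<omega>') \<partial>M)"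
    using mean by (auto simp: has_bochner_integral_iff)
  thus ?thesis
    using freeze_integral[OF J(1) JK S h] int by simp
qed

lemma oracle_pair_measurable:
  assumes "jointly_measurable orc" "xt \<in> borel_measurable (hist J)"
  shows "(\<lambda>(\<omega>, s). orc (xt \<omega>) s) \<in> borel_measurable (hist J \<Otimes>\<^sub>M borel)"
proof -
  have "(\<lambda>p. (xt (fst p), snd p)) \<in> measurable (hist J \<Otimes>\<^sub>M borel) (borel \<Otimes>\<^sub>M borel)"
    using assms(2) by measurable
  from measurable_compose[OF this assms(1)[unfolded jointly_measurable_def]]
  show ?thesis by (simp add: case_prod_beta)
qed

lemma oracle_hist_measurable:
  assumes "jointly_measurable orc" "xt \<in> borel_measurable (hist J)" "S \<in> borel_measurable (hist K)"
    "J \<subseteq> K'" "K \<subseteq> K'" "K' \<subseteq> I"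
  shows "(\<lambda>\<omega>. orc (xt \<omega>) (S \<omega>)) \<in> borel_measurable (hist K')"
proof -
  note [measurable] = hist_mono[OF assms(2,4,6)] hist_mono[OF assms(3,5,6)]
  have "(\<lambda>\<omega>. (xt \<omega>, S \<omega>)) \<in> measurable (hist K') (borel \<Otimes>\<^sub>M borel)" by measurable
  from measurable_compose[OF this assms(1)[unfolded jointly_measurable_def]] show ?thesis by simp
qed

lemma value_noise:
  fixes orc :: "'u::{second_countable_topology,real_normed_vector} \<Rightarrow> 's::topological_space \<Rightarrow> 'v::euclidean_space"
  assumes J: "J \<subseteq> I" "i \<in> I - J" and S: "S \<in> borel_measurable (hist {i})"
    and orc: "jointly_measurable orc" and h: "h \<in> borel_measurable borel"
    and xt: "xt \<in> borel_measurable (hist J)" "\<And>\<omega>. xt \<omega> \<in> U"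
    and mean: "\<And>u. has_bochner_integral M (\<lambda>\<omega>. orc u (S \<omega>)) (h u)"
    and moment: "\<And>u. u \<in> U \<Longrightarrow> second_moment_le M (\<lambda>\<omega>. orc u (S \<omega>) - h u) c"
    and c: "0 \<le> c"
  shows "uncorrelated J (\<lambda>\<omega>. orc (xt \<omega>) (S \<omega>) - h (xt \<omega>))"
    and "expectation (\<lambda>\<omega>. (norm (orc (xt \<omega>) (S \<omega>) - h (xt \<omega>)))^2) \<le> c"
proof -
  note [measurable] = oracle_pair_measurable[OF orc xt(1)] measurable_compose[OF xt(1) h]
  have m: "(\<lambda>(\<omega>, s). orc (xt \<omega>) s - h (xt \<omega>)) \<in> borel_measurable (hist J \<Otimes>\<^sub>M borel)"
    by measurable
  note mo = frozen_moment[OF J S m, of "\<lambda>_. c"]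
  have e: "square_integrable (\<lambda>\<omega>. orc (xt \<omega>) (S \<omega>) - h (xt \<omega>))"
    using second_moment_leD[OF moment[OF xt(2)]] c by (intro mo) auto
  show "expectation (\<lambda>\<omega>. (norm (orc (xt \<omega>) (S \<omega>) - h (xt \<omega>)))^2) \<le> c"
    using second_moment_leD[OF moment[OF xt(2)]] c mo(2) by (auto simp: prob_space)
  show "uncorrelated J (\<lambda>\<omega>. orc (xt \<omega>) (S \<omega>) - h (xt \<omega>))"
    unfolding uncorrelated_def
  proof (intro conjI allI impI e)
    fix k :: "'w \<Rightarrow> 'v" assume k: "square_integrable k" and [measurable]: "k \<in> borel_measurable (hist J)"
    have "has_bochner_integral M (\<lambda>_. 0) (expectation (\<lambda>\<omega>. k \<omega> \<bullet> (orc (xt \<omega>) (S \<omega>) - h (xt \<omega>))))"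
    proof (rule frozen_mean[OF J S, where h = "\<lambda>\<omega> s. k \<omega> \<bullet> (orc (xt \<omega>) s - h (xt \<omega>))"])
      show "(\<lambda>(\<omega>, s). k \<omega> \<bullet> (orc (xt \<omega>) s - h (xt \<omega>))) \<in> borel_measurable (hist J \<Otimes>\<^sub>M borel)"
        by measurable
      show "integrable M (\<lambda>\<omega>. k \<omega> \<bullet> (orc (xt \<omega>) (S \<omega>) - h (xt \<omega>)))"
        by (rule square_integrable_inner[OF k e])
      fix \<omega>
      have "has_bochner_integral M (\<lambda>\<omega>'. orc (xt \<omega>) (S \<omega>') - h (xt \<omega>)) (h (xt \<omega>) - h (xt \<omega>))"
        using mean[of "xt \<omega>"] by (auto simp: has_bochner_integral_iff prob_space)
      from has_bochner_integral_inner_right[of "k \<omega>", OF this]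
      show "has_bochner_integral M (\<lambda>\<omega>'. k \<omega> \<bullet> (orc (xt \<omega>) (S \<omega>') - h (xt \<omega>))) 0" by simp
    qed
    thus "expectation (\<lambda>\<omega>. k \<omega> \<bullet> (orc (xt \<omega>) (S \<omega>) - h (xt \<omega>))) = 0"
      by (auto simp: has_bochner_integral_iff)
  qed
qed

lemma bounded_linear_matrix_vector_left: "bounded_linear (\<lambda>B :: real^'k^'d. B *v v)"
  by (rule bounded_linear_intro[where K = "norm v"])
     (auto simp: matrix_vector_mult_add_rdistrib scaleR_matrix_vector_assoc norm_matrix_vector_le)

text \<open>
  The matrix \<open>P\<close> at \<open>x\<^sub>t\<close> and the vector \<open>Rv\<close> use different fresh samples, so the product is frozen twice:
  first the sample of \<open>Rv\<close> (the sample of \<open>P\<close> belonging to the history), then that of \<open>P\<close>. The mean of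
  \<open>P\<close> is some subgradient, which may depend on the query point in a non-measurable way; hence the
  conclusion is the inequality that all subgradients satisfy, not an equation for the mean.
\<close>

lemma composite_gradient_oracle:
  fixes P :: "real^'x \<Rightarrow> 's2::topological_space \<Rightarrow> real^'y^'x" and Rv :: "'w \<Rightarrow> 's1::topological_space \<Rightarrow> real^'y"
  assumes J: "J \<subseteq> I" "i1 \<in> I - J" "i2 \<in> I - J" "i1 \<noteq> i2"
    and S: "S1 \<in> borel_measurable (hist {i1})" "S2 \<in> borel_measurable (hist {i2})"
    and P: "jointly_measurable P"
      "\<And>u. u \<in> U \<Longrightarrow> \<exists>D \<in> vec_subdiff h u. has_bochner_integral M (\<lambda>\<omega>. P u (S2 \<omega>)) D"
      "\<And>u. u \<in> U \<Longrightarrow> second_moment_le M (\<lambda>\<omega>. P u (S2 \<omega>)) (C^2)"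
    and xt: "xt \<in> borel_measurable (hist J)" "\<And>\<omega>. xt \<omega> \<in> U"
    and v: "\<And>\<omega>. norm (xt \<omega> - v) \<le> D"
    and Rv: "(\<lambda>(\<omega>, s). Rv \<omega> s) \<in> borel_measurable (hist J \<Otimes>\<^sub>M borel)"
      "\<And>\<omega>. has_bochner_integral M (\<lambda>\<omega>'. Rv \<omega> (S1 \<omega>')) (Rb \<omega>)"
      "\<And>\<omega>. (\<integral>\<^sup>+\<omega>'. ennreal ((norm (Rv \<omega> (S1 \<omega>')))^2) \<partial>M) \<le> ennreal (\<kappa> \<omega>)"
    and Rb: "square_integrable Rb" "Rb \<in> borel_measurable (hist J)" "\<And>\<omega>. affine_map h \<or> 0 \<le> Rb \<omega>"
      "\<And>\<omega>. (norm (Rb \<omega>))^2 \<le> \<kappa> \<omega>"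
    and \<kappa>: "integrable M \<kappa>" "\<kappa> \<in> borel_measurable (hist J)"
    and h: "h \<in> borel_measurable borel" "\<And>\<omega>. norm (h (xt \<omega>) - h v) \<le> B"
  shows "square_integrable (\<lambda>\<omega>. P (xt \<omega>) (S2 \<omega>) *v Rv \<omega> (S1 \<omega>))"
    and "expectation (\<lambda>\<omega>. (norm (P (xt \<omega>) (S2 \<omega>) *v Rv \<omega> (S1 \<omega>)))^2) \<le> C^2 * expectation \<kappa>"
    and "expectation (\<lambda>\<omega>. Rb \<omega> \<bullet> (h (xt \<omega>) - h v))
        \<le> expectation (\<lambda>\<omega>. (P (xt \<omega>) (S2 \<omega>) *v Rv \<omega> (S1 \<omega>)) \<bullet> (xt \<omega> - v))"
proof -
  have \<kappa>0: "0 \<le> \<kappa> \<omega>" for \<omega> using Rb(4)[of \<omega>] by (rule order_trans[rotated]) simp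
  have sI: "{i1} \<subseteq> I" "{i2} \<subseteq> I" using J by auto
  define J' where "J' = insert i2 J"
  have J': "J' \<subseteq> I" "i1 \<in> I - J'" "J \<subseteq> J'" "{i2} \<subseteq> J'" using J by (auto simp: J'_def)
  note [measurable] = oracle_hist_measurable[OF P(1) xt(1) S(2) J'(3,4,1)] hist_mono[OF xt(1) J'(3,1)]
    hist_mono[OF Rb(2) J'(3,1)]
  have PM: "(\<lambda>\<omega>. P (xt \<omega>) (S2 \<omega>)) \<in> borel_measurable M" "xt \<in> borel_measurable M" "Rb \<in> borel_measurable M"
    by (rule hist_measurable[OF _ J'(1)], measurable)+
  have Rv' [measurable]: "(\<lambda>(\<omega>, s). Rv \<omega> s) \<in> borel_measurable (hist J' \<Otimes>\<^sub>M borel)"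
  proof -
    have "subalgebra (hist J') (hist J)"
      using J' by (auto simp: subalgebra_def sets_hist intro!: sigma_sets_mono')
    hence id: "(\<lambda>\<omega>. \<omega>) \<in> measurable (hist J') (hist J)" by (rule measurable_from_subalg) simp
    have "(\<lambda>p. (fst p, snd p)) \<in> measurable (hist J' \<Otimes>\<^sub>M borel) (hist J \<Otimes>\<^sub>M borel)"
      using measurable_compose[OF measurable_fst id] by measurable
    from measurable_compose[OF this Rv(1)] show ?thesis by simp
  qed
  \<comment> \<open>Scaling by \<open>sqrt \<kappa>\<close> turns the product of two second moments into a single one.\<close>
  have bnd: "square_integrable (\<lambda>\<omega>. sqrt (\<kappa> \<omega>) *\<^sub>R P (xt \<omega>) (S2 \<omega>))"
      "expectation (\<lambda>\<omega>. (norm (sqrt (\<kappa> \<omega>) *\<^sub>R P (xt \<omega>) (S2 \<omega>)))^2) \<le> expectation (\<lambda>\<omega>. C^2 * \<kappa> \<omega>)"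
  proof -
    note [measurable] = oracle_pair_measurable[OF P(1) xt(1)] \<kappa>(2)
    have m: "(\<lambda>(\<omega>, s). sqrt (\<kappa> \<omega>) *\<^sub>R P (xt \<omega>) s) \<in> borel_measurable (hist J \<Otimes>\<^sub>M borel)" by measurable
    have mo: "(\<integral>\<^sup>+\<omega>'. ennreal ((norm (sqrt (\<kappa> \<omega>) *\<^sub>R P (xt \<omega>) (S2 \<omega>')))^2) \<partial>M) \<le> ennreal (C^2 * \<kappa> \<omega>)" for \<omega>
    proof -
      have "second_moment_le M (\<lambda>\<omega>'. sqrt (\<kappa> \<omega>) *\<^sub>R P (xt \<omega>) (S2 \<omega>')) (C^2 * \<kappa> \<omega>)"
        using P(3)[OF xt(2)[of \<omega>]] \<kappa>0[of \<omega>]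
        by (auto simp: second_moment_le_def power_mult_distrib mult.commute[of "C^2"] intro!: mult_left_mono)
      thus ?thesis by (rule second_moment_leD)
    qed
    have p: "integrable M (\<lambda>\<omega>. C^2 * \<kappa> \<omega>)" "\<And>\<omega>. 0 \<le> C^2 * \<kappa> \<omega>" using \<kappa> \<kappa>0 by auto
    show "square_integrable (\<lambda>\<omega>. sqrt (\<kappa> \<omega>) *\<^sub>R P (xt \<omega>) (S2 \<omega>))"
      "expectation (\<lambda>\<omega>. (norm (sqrt (\<kappa> \<omega>) *\<^sub>R P (xt \<omega>) (S2 \<omega>)))^2) \<le> expectation (\<lambda>\<omega>. C^2 * \<kappa> \<omega>)"
      by (rule frozen_moment[OF J(1,3) S(2) m mo p])+
  qed
  have m1: "(\<lambda>(\<omega>, s). P (xt \<omega>) (S2 \<omega>) *v Rv \<omega> s) \<in> borel_measurable (hist J' \<Otimes>\<^sub>M borel)"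
    by measurable
  have mo1: "(\<integral>\<^sup>+\<omega>'. ennreal ((norm (P (xt \<omega>) (S2 \<omega>) *v Rv \<omega> (S1 \<omega>')))^2) \<partial>M)
      \<le> ennreal ((norm (sqrt (\<kappa> \<omega>) *\<^sub>R P (xt \<omega>) (S2 \<omega>)))^2)" for \<omega>
  proof -
    let ?a = "norm (P (xt \<omega>) (S2 \<omega>))"
    have [measurable]: "(\<lambda>\<omega>'. Rv \<omega> (S1 \<omega>')) \<in> borel_measurable M"
      using Rv(2)[of \<omega>] by (auto simp: has_bochner_integral_iff)
    have "(\<integral>\<^sup>+\<omega>'. ennreal ((norm (P (xt \<omega>) (S2 \<omega>) *v Rv \<omega> (S1 \<omega>')))^2) \<partial>M)
        \<le> (\<integral>\<^sup>+\<omega>'. ennreal (?a^2) * ennreal ((norm (Rv \<omega> (S1 \<omega>')))^2) \<partial>M)"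
      by (intro nn_integral_mono)
         (auto simp flip: ennreal_mult power_mult_distrib intro!: ennreal_leI power_mono norm_matrix_vector_le)
    also have "\<dots> = ennreal (?a^2) * (\<integral>\<^sup>+\<omega>'. ennreal ((norm (Rv \<omega> (S1 \<omega>')))^2) \<partial>M)"
      by (rule nn_integral_cmult) measurable
    also have "\<dots> \<le> ennreal (?a^2) * ennreal (\<kappa> \<omega>)" by (intro mult_left_mono Rv(3)) auto
    also have "\<dots> = ennreal ((norm (sqrt (\<kappa> \<omega>) *\<^sub>R P (xt \<omega>) (S2 \<omega>)))^2)"
      using \<kappa>0[of \<omega>] by (simp add: power_mult_distrib mult.commute flip: ennreal_mult)
    finally show ?thesis .
  qed
  note mom = frozen_moment[OF J'(1,2) S(1) m1 mo1 square_integrableD(2)[OF bnd(1)]]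
  show sq: "square_integrable (\<lambda>\<omega>. P (xt \<omega>) (S2 \<omega>) *v Rv \<omega> (S1 \<omega>))" by (rule mom(1)) auto
  show "expectation (\<lambda>\<omega>. (norm (P (xt \<omega>) (S2 \<omega>) *v Rv \<omega> (S1 \<omega>)))^2) \<le> C^2 * expectation \<kappa>"
    using order_trans[OF mom(2) bnd(2)] by simp
  have dxt: "square_integrable (\<lambda>\<omega>. xt \<omega> - v)"
    by (rule square_integrable_bounded[OF borel_measurable_diff[OF PM(2) borel_measurable_const] v])
  have s1: "has_bochner_integral M (\<lambda>\<omega>. (P (xt \<omega>) (S2 \<omega>) *v Rb \<omega>) \<bullet> (xt \<omega> - v))
      (expectation (\<lambda>\<omega>. (P (xt \<omega>) (S2 \<omega>) *v Rv \<omega> (S1 \<omega>)) \<bullet> (xt \<omega> - v)))"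
  proof (rule frozen_mean[OF J'(1,2) S(1), where h = "\<lambda>\<omega> s. (P (xt \<omega>) (S2 \<omega>) *v Rv \<omega> s) \<bullet> (xt \<omega> - v)"])
    show "(\<lambda>(\<omega>, s). (P (xt \<omega>) (S2 \<omega>) *v Rv \<omega> s) \<bullet> (xt \<omega> - v)) \<in> borel_measurable (hist J' \<Otimes>\<^sub>M borel)"
      by measurable
    show "integrable M (\<lambda>\<omega>. (P (xt \<omega>) (S2 \<omega>) *v Rv \<omega> (S1 \<omega>)) \<bullet> (xt \<omega> - v))"
      by (rule square_integrable_inner[OF sq dxt])
    show "has_bochner_integral M (\<lambda>\<omega>'. (P (xt \<omega>) (S2 \<omega>) *v Rv \<omega> (S1 \<omega>')) \<bullet> (xt \<omega> - v))
        ((P (xt \<omega>) (S2 \<omega>) *v Rb \<omega>) \<bullet> (xt \<omega> - v))" for \<omega>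
      using has_bochner_integral_bounded_linear[OF matrix_vector_mul_bounded_linear Rv(2)[of \<omega>]]
      by (rule has_bochner_integral_inner_left)
  qed
  define g where "g \<omega> = expectation (\<lambda>\<omega>'. (P (xt \<omega>) (S2 \<omega>') *v Rb \<omega>) \<bullet> (xt \<omega> - v))" for \<omega>
  have gD: "has_bochner_integral M (\<lambda>\<omega>'. (P (xt \<omega>) (S2 \<omega>') *v Rb \<omega>) \<bullet> (xt \<omega> - v)) (g \<omega>) \<and>
      Rb \<omega> \<bullet> (h (xt \<omega>) - h v) \<le> g \<omega>" for \<omega>
  proof -
    obtain D where D: "D \<in> vec_subdiff h (xt \<omega>)" "has_bochner_integral M (\<lambda>\<omega>'. P (xt \<omega>) (S2 \<omega>')) D"
      using P(2)[OF xt(2)[of \<omega>]] by blast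
    have "has_bochner_integral M (\<lambda>\<omega>'. (P (xt \<omega>) (S2 \<omega>') *v Rb \<omega>) \<bullet> (xt \<omega> - v)) ((D *v Rb \<omega>) \<bullet> (xt \<omega> - v))"
      using has_bochner_integral_bounded_linear[OF bounded_linear_matrix_vector_left D(2)]
      by (rule has_bochner_integral_inner_left)
    moreover from this have "g \<omega> = (D *v Rb \<omega>) \<bullet> (xt \<omega> - v)"
      by (simp add: g_def has_bochner_integral_iff)
    moreover have "Rb \<omega> \<bullet> (h (xt \<omega>) - h v) \<le> (D *v Rb \<omega>) \<bullet> (xt \<omega> - v)"
      by (rule subdiff_monotone_composition[OF D(1) Rb(3)])
    ultimately show ?thesis by simp
  qed
  have s2: "has_bochner_integral M g (expectation (\<lambda>\<omega>. (P (xt \<omega>) (S2 \<omega>) *v Rb \<omega>) \<bullet> (xt \<omega> - v)))"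
  proof (rule frozen_mean[OF J(1,3) S(2), where h = "\<lambda>\<omega> s. (P (xt \<omega>) s *v Rb \<omega>) \<bullet> (xt \<omega> - v)"])
    note [measurable] = oracle_pair_measurable[OF P(1) xt(1)] xt(1) Rb(2)
    show "(\<lambda>(\<omega>, s). (P (xt \<omega>) s *v Rb \<omega>) \<bullet> (xt \<omega> - v)) \<in> borel_measurable (hist J \<Otimes>\<^sub>M borel)"
      by measurable
    show "integrable M (\<lambda>\<omega>. (P (xt \<omega>) (S2 \<omega>) *v Rb \<omega>) \<bullet> (xt \<omega> - v))"
      using s1 by (simp add: has_bochner_integral_iff)
  qed (use gD in blast)
  have hm: "square_integrable (\<lambda>\<omega>. h (xt \<omega>) - h v)"
    by (rule square_integrable_bounded[OF borel_measurable_diff[OF measurable_compose[OF PM(2) h(1)] borel_measurable_const] h(2)])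
  have "expectation (\<lambda>\<omega>. Rb \<omega> \<bullet> (h (xt \<omega>) - h v)) \<le> expectation g"
    using gD s2 by (intro integral_mono square_integrable_inner[OF Rb(1) hm]) (auto simp: has_bochner_integral_iff)
  also have "\<dots> = expectation (\<lambda>\<omega>. (P (xt \<omega>) (S2 \<omega>) *v Rv \<omega> (S1 \<omega>)) \<bullet> (xt \<omega> - v))"
    using s1 s2 by (simp add: has_bochner_integral_iff)
  finally show "expectation (\<lambda>\<omega>. Rb \<omega> \<bullet> (h (xt \<omega>) - h v))
        \<le> expectation (\<lambda>\<omega>. (P (xt \<omega>) (S2 \<omega>) *v Rv \<omega> (S1 \<omega>)) \<bullet> (xt \<omega> - v))" .
qed

text \<open>
  The estimator of the linearized constraint multiplies a gradient sample (\<open>i1\<close>) by an inner value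
  sample (\<open>i2\<close>). Freezing \<open>i1\<close> with \<open>i2\<close> in the history leaves the exact gradient times the noise of
  the inner value, which is uncorrelated by assumption. The value and the gradient of \<open>g1\<close> may share
  their sample, because they enter additively.
\<close>

lemma linearized_value_oracle:
  fixes gs :: "real^'z \<Rightarrow> 's1::topological_space \<Rightarrow> real^'m" and dgs :: "real^'z \<Rightarrow> 's1 \<Rightarrow> real^'m^'z"
  assumes J: "J \<subseteq> I" "i1 \<in> I - J" "i2 \<in> I - J" "i1 \<noteq> i2"
    and S: "S1 \<in> borel_measurable (hist {i1})"
    and orc: "jointly_measurable gs" "jointly_measurable dgs"
    and meas: "g \<in> borel_measurable borel" "dg \<in> borel_measurable borel"
    and gs: "\<And>u. has_bochner_integral M (\<lambda>\<omega>. gs u (S1 \<omega>)) (g u)"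
      "\<And>u. second_moment_le M (\<lambda>\<omega>. gs u (S1 \<omega>) - g u) c"
    and dgs: "\<And>u. has_bochner_integral M (\<lambda>\<omega>. dgs u (S1 \<omega>)) (dg u)"
      "\<And>u. second_moment_le M (\<lambda>\<omega>. dgs u (S1 \<omega>)) (C^2)"
    and C: "0 \<le> C" "0 \<le> c"
    and zt: "square_integrable zt" "zt \<in> borel_measurable (hist J)"
    and u: "square_integrable u" "u \<in> borel_measurable (hist J)"
    and ut: "uncorrelated J (\<lambda>\<omega>. ut \<omega> - u \<omega>)" "ut \<in> borel_measurable (hist (insert i2 J))"
  shows "uncorrelated J (\<lambda>\<omega>. (gs (zt \<omega>) (S1 \<omega>) - transpose (dgs (zt \<omega>) (S1 \<omega>)) *v zt \<omega>
            + transpose (dgs (zt \<omega>) (S1 \<omega>)) *v ut \<omega>) - (g (zt \<omega>) + transpose (dg (zt \<omega>)) *v (u \<omega> - zt \<omega>)))"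
proof -
  define J' where "J' = insert i2 J"
  have J': "J' \<subseteq> I" "i1 \<in> I - J'" "J \<subseteq> J'" using J by (auto simp: J'_def)
  have dg: "norm (dg q) \<le> C" for q using mean_norm_le[OF dgs(1,2) C(1)] .
  note ut' = ut(2)[folded J'_def]
  note [measurable] = ut' hist_mono[OF zt(2) J'(3,1)] hist_mono[OF u(2) J'(3,1)] meas
    oracle_pair_measurable[OF orc(1) hist_mono[OF zt(2) J'(3,1)]]
    oracle_pair_measurable[OF orc(2) hist_mono[OF zt(2) J'(3,1)]]
  define d where "d \<omega> = ut \<omega> - zt \<omega>" for \<omega>
  have usq: "square_integrable ut" using square_integrable_add[OF uncorrelatedD(1)[OF ut(1)] u(1)] by simp
  have dsq: "square_integrable d" unfolding d_def by (rule square_integrable_diff[OF usq zt(1)])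
  have dm [measurable]: "d \<in> borel_measurable (hist J')" unfolding d_def by measurable
  have e1: "square_integrable (\<lambda>\<omega>. gs (zt \<omega>) (S1 \<omega>) - g (zt \<omega>))"
    by (rule uncorrelatedD(1)[OF value_noise(1)[OF J(1,2) S orc(1) meas(1) zt(2) UNIV_I gs C(2)]])
  have e2: "square_integrable (\<lambda>\<omega>. transpose (dgs (zt \<omega>) (S1 \<omega>)) *v d \<omega>)"
  proof (rule frozen_moment(1)[OF J'(1,2) S, where h = "\<lambda>\<omega> s. transpose (dgs (zt \<omega>) s) *v d \<omega>"
        and \<kappa> = "\<lambda>\<omega>. C^2 * (norm (d \<omega>))^2"])
    show "(\<lambda>(\<omega>, s). transpose (dgs (zt \<omega>) s) *v d \<omega>) \<in> borel_measurable (hist J' \<Otimes>\<^sub>M borel)" by measurable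
    show "integrable M (\<lambda>\<omega>. C^2 * (norm (d \<omega>))^2)" using square_integrableD(2)[OF dsq] by simp
    fix \<omega>
    have [measurable]: "(\<lambda>\<omega>'. dgs (zt \<omega>) (S1 \<omega>')) \<in> borel_measurable M"
      using dgs(1)[of "zt \<omega>"] by (auto simp: has_bochner_integral_iff)
    have "(\<integral>\<^sup>+\<omega>'. ennreal ((norm (transpose (dgs (zt \<omega>) (S1 \<omega>')) *v d \<omega>))^2) \<partial>M)
        \<le> (\<integral>\<^sup>+\<omega>'. ennreal ((norm (dgs (zt \<omega>) (S1 \<omega>')))^2) * ennreal ((norm (d \<omega>))^2) \<partial>M)"
      using norm_matrix_vector_le[of "transpose (dgs (zt \<omega>) (S1 _))" "d \<omega>"]
      by (intro nn_integral_mono)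
         (auto simp flip: ennreal_mult power_mult_distrib simp: norm_transpose
            simp del: transpose_matrix_vector intro!: ennreal_leI power_mono)
    also have "\<dots> = (\<integral>\<^sup>+\<omega>'. ennreal ((norm (dgs (zt \<omega>) (S1 \<omega>')))^2) \<partial>M) * ennreal ((norm (d \<omega>))^2)"
      by (rule nn_integral_multc) measurable
    also have "\<dots> \<le> ennreal (C^2) * ennreal ((norm (d \<omega>))^2)"
      by (intro mult_right_mono second_moment_leD dgs) auto
    also have "\<dots> = ennreal (C^2 * (norm (d \<omega>))^2)" by (simp add: ennreal_mult)
    finally show "(\<integral>\<^sup>+\<omega>'. ennreal ((norm (transpose (dgs (zt \<omega>) (S1 \<omega>')) *v d \<omega>))^2) \<partial>M)
        \<le> ennreal (C^2 * (norm (d \<omega>))^2)" .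
  qed auto
  have e3: "square_integrable (\<lambda>\<omega>. transpose (dg (zt \<omega>)) *v (u \<omega> - zt \<omega>))"
  proof (rule square_integrable_mono[OF square_integrable_diff[OF u(1) zt(1)], of _ C])
    show "(\<lambda>\<omega>. transpose (dg (zt \<omega>)) *v (u \<omega> - zt \<omega>)) \<in> borel_measurable M"
      by (rule hist_measurable[OF _ J'(1)]) measurable
    show "norm (transpose (dg (zt \<omega>)) *v (u \<omega> - zt \<omega>)) \<le> C * norm (u \<omega> - zt \<omega>)" for \<omega>
      by (rule order_trans[OF norm_matrix_vector_le]) (simp add: norm_transpose dg mult_right_mono)
  qed
  have rewr: "(gs (zt \<omega>) s - transpose (dgs (zt \<omega>) s) *v zt \<omega> + transpose (dgs (zt \<omega>) s) *v ut \<omega>)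
       - (g (zt \<omega>) + transpose (dg (zt \<omega>)) *v (u \<omega> - zt \<omega>))
     = (gs (zt \<omega>) s - g (zt \<omega>)) + transpose (dgs (zt \<omega>) s) *v d \<omega> - transpose (dg (zt \<omega>)) *v (u \<omega> - zt \<omega>)" for \<omega> s
    unfolding d_def by (simp add: matrix_vector_mult_diff_distrib del: transpose_matrix_vector)
  define E where "E \<omega> s = (gs (zt \<omega>) s - g (zt \<omega>)) + transpose (dgs (zt \<omega>) s) *v d \<omega>
      - transpose (dg (zt \<omega>)) *v (u \<omega> - zt \<omega>)" for \<omega> s
  have Esq: "square_integrable (\<lambda>\<omega>. E \<omega> (S1 \<omega>))"
    unfolding E_def by (intro square_integrable_diff square_integrable_add e1 e2 e3)
  show ?thesis
    unfolding rewr E_def[symmetric] uncorrelated_def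
  proof (intro conjI allI impI Esq)
    fix k :: "'w \<Rightarrow> real^'m" assume k: "square_integrable k" and kJ: "k \<in> borel_measurable (hist J)"
    note [measurable] = hist_mono[OF kJ J'(3,1)]
    have fr: "has_bochner_integral M (\<lambda>\<omega>. k \<omega> \<bullet> (transpose (dg (zt \<omega>)) *v (ut \<omega> - u \<omega>)))
        (expectation (\<lambda>\<omega>. k \<omega> \<bullet> E \<omega> (S1 \<omega>)))"
    proof (rule frozen_mean[OF J'(1,2) S, where h = "\<lambda>\<omega> s. k \<omega> \<bullet> E \<omega> s"])
      show "(\<lambda>(\<omega>, s). k \<omega> \<bullet> E \<omega> s) \<in> borel_measurable (hist J' \<Otimes>\<^sub>M borel)" unfolding E_def by measurable
      show "integrable M (\<lambda>\<omega>. k \<omega> \<bullet> E \<omega> (S1 \<omega>))" by (rule square_integrable_inner[OF k Esq])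
      fix \<omega>
      have lin: "bounded_linear (\<lambda>B :: real^'m^'z. transpose B *v d \<omega>)"
      proof (rule bounded_linear_intro[where K = "norm (d \<omega>)"])
        show "norm (transpose B *v d \<omega>) \<le> norm B * norm (d \<omega>)" for B :: "real^'m^'z"
          using norm_matrix_vector_le[of "transpose B" "d \<omega>"] by (simp add: norm_transpose del: transpose_matrix_vector)
      qed (auto simp: vector_matrix_mult_def vec_eq_iff sum.distrib algebra_simps sum_distrib_left)
      have "has_bochner_integral M (\<lambda>\<omega>'. E \<omega> (S1 \<omega>'))
          ((g (zt \<omega>) - g (zt \<omega>)) + transpose (dg (zt \<omega>)) *v d \<omega> - transpose (dg (zt \<omega>)) *v (u \<omega> - zt \<omega>))"
        unfolding E_def
        by (intro has_bochner_integral_diff has_bochner_integral_add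
              has_bochner_integral_bounded_linear[OF lin] gs dgs)
           (auto simp: has_bochner_integral_iff prob_space)
      also have "(g (zt \<omega>) - g (zt \<omega>)) + transpose (dg (zt \<omega>)) *v d \<omega> - transpose (dg (zt \<omega>)) *v (u \<omega> - zt \<omega>)
          = transpose (dg (zt \<omega>)) *v (ut \<omega> - u \<omega>)"
        unfolding d_def by (simp add: matrix_vector_mult_diff_distrib del: transpose_matrix_vector)
      finally show "has_bochner_integral M (\<lambda>\<omega>'. k \<omega> \<bullet> E \<omega> (S1 \<omega>'))
          (k \<omega> \<bullet> (transpose (dg (zt \<omega>)) *v (ut \<omega> - u \<omega>)))"
        by (rule has_bochner_integral_inner_right)
    qed
    have "expectation (\<lambda>\<omega>. k \<omega> \<bullet> E \<omega> (S1 \<omega>)) = expectation (\<lambda>\<omega>. (dg (zt \<omega>) *v k \<omega>) \<bullet> (ut \<omega> - u \<omega>))"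
      using fr unfolding inner_commute[of "k _"] transpose_vector_inner
      by (simp add: has_bochner_integral_iff inner_commute)
    also have "\<dots> = 0"
    proof (rule uncorrelatedD(2)[OF ut(1)])
      show km: "(\<lambda>\<omega>. dg (zt \<omega>) *v k \<omega>) \<in> borel_measurable (hist J)"
        using kJ zt(2) meas(2) by measurable
      show "square_integrable (\<lambda>\<omega>. dg (zt \<omega>) *v k \<omega>)"
        using hist_measurable[OF km J(1)]
        by (rule square_integrable_mono[OF k, of _ C])
           (rule order_trans[OF norm_matrix_vector_le], simp add: dg mult_right_mono)
    qed
    finally show "expectation (\<lambda>\<omega>. k \<omega> \<bullet> E \<omega> (S1 \<omega>)) = 0" .
  qed
qed

end

section \<open>Expected gap\<close>

text \<open>
  The sum is logarithmic, but \<open>sqrt n\<close> is the order of the other noise terms. The induction rests on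
  \<open>1 / (n + 2) \<le> sqrt (n + 1) - sqrt n\<close>.
\<close>

lemma sum_harmonic_le_sqrt: "(\<Sum>t<n. 2 / (real t + 2)) \<le> 2 * sqrt n"
proof (induction n)
  case (Suc n)
  have "sqrt n * sqrt (Suc n) \<le> real n + 1/2"
    using arith_geo_mean_sqrt[of "real n" "real (Suc n)"] unfolding real_sqrt_mult by simp
  moreover have "(sqrt n + sqrt (Suc n))^2 = n + Suc n + 2 * (sqrt n * sqrt (Suc n))"
    by (simp add: power2_sum)
  moreover have "(real n + 2)^2 = (real n)^2 + 4 * n + 4" by (simp add: power2_sum)
  ultimately have "(sqrt n + sqrt (Suc n))^2 \<le> (real n + 2)^2"
    using zero_le_power2[of "real n"] unfolding of_nat_Suc by linarith
  hence "sqrt n + sqrt (Suc n) \<le> real n + 2" by (rule power2_le_imp_le) simp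
  moreover have "(sqrt (Suc n) - sqrt n) * (sqrt n + sqrt (Suc n)) = 1"
    by (simp add: algebra_simps)
  moreover have "sqrt n \<le> sqrt (Suc n)" by simp
  ultimately have "1 \<le> (sqrt (Suc n) - sqrt n) * (real n + 2)"
    by (metis diff_ge_0_iff_ge mult_left_mono)
  hence "2 / (real n + 2) \<le> 2 * (sqrt (Suc n) - sqrt n)" by (simp add: field_simps)
  with Suc show ?case by simp
qed simp

locale stochastic_layer = composite_layer X h \<Phi> der adj C1 C2 L + sample_space M A I
  for X :: "(real^'x) set" and h :: "real^'x \<Rightarrow> real^'y"
    and \<Phi> :: "real^'y \<Rightarrow> 'e::ordered_euclidean_space" and der adj C1 C2 L
    and M :: "'w measure" and A :: "'i \<Rightarrow> 'w set set" and I +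
  assumes der_measurable: "\<And>(N :: 'w measure) f g. f \<in> borel_measurable N \<Longrightarrow> g \<in> borel_measurable N
      \<Longrightarrow> (\<lambda>\<omega>. der (f \<omega>) (g \<omega>)) \<in> borel_measurable N"
    and adj_measurable: "\<And>(N :: 'w measure) f g. f \<in> borel_measurable N \<Longrightarrow> g \<in> borel_measurable N
      \<Longrightarrow> (\<lambda>\<omega>. adj (f \<omega>) (g \<omega>)) \<in> borel_measurable N"
begin

text \<open>
  The derivative is taken at the tracking point before the fresh noise is added, so the terms
  \<open>der (y' t) (\<epsilon> t)\<close> are orthogonal: moving \<open>der\<close> to the other factor by its adjoint leaves a vector
  known before \<open>\<epsilon> t\<close>. Each of the two vector sums contributes \<open>C1 \<sigma> sqrt n\<close>, the displacement
  \<open>2 L \<sigma>^2 sqrt n\<close>.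
\<close>

lemma expected_noise:
  fixes n :: nat and x :: "nat \<Rightarrow> 'w \<Rightarrow> real^'x" and y \<epsilon> :: "nat \<Rightarrow> 'w \<Rightarrow> real^'y"
  assumes J: "\<And>t. t < n \<Longrightarrow> J t \<subseteq> I"
    and eps: "\<And>t. t < n \<Longrightarrow> uncorrelated (J t) (\<epsilon> t)"
      "\<And>t. t < n \<Longrightarrow> expectation (\<lambda>\<omega>. (norm (\<epsilon> t \<omega>))^2) \<le> \<sigma>^2"
      "\<And>s t. s < t \<Longrightarrow> t < n \<Longrightarrow> \<epsilon> s \<in> borel_measurable (hist (J t))"
    and hx: "\<And>s t. s \<le> t \<Longrightarrow> t < n \<Longrightarrow> (\<lambda>\<omega>. h (x s \<omega>)) \<in> borel_measurable (hist (J t))"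
    and y: "\<And>s t. s \<le> t \<Longrightarrow> t < n \<Longrightarrow> y s \<in> borel_measurable (hist (J t))"
    and \<sigma>: "0 \<le> \<sigma>"
  shows "integrable M (\<lambda>\<omega>. noise (\<lambda>t. x t \<omega>) (\<lambda>t. y t \<omega>) (\<lambda>t. \<epsilon> t \<omega>) n)" (is ?int)
    and "expectation (\<lambda>\<omega>. noise (\<lambda>t. x t \<omega>) (\<lambda>t. y t \<omega>) (\<lambda>t. \<epsilon> t \<omega>) n)
      \<le> sqrt n * (2 * C1 * \<sigma> + 2 * L * \<sigma>^2)" (is ?bound)
proof -
  define y' where "y' t \<omega> = damped t (h (x t \<omega>)) (y t \<omega>)" for t \<omega>
  define e where "e t \<omega> = der (y' t \<omega>) (\<epsilon> t \<omega>)" for t \<omega>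
  have y'm: "y' s \<in> borel_measurable (hist (J t))" if "s \<le> t" "t < n" for s t
    unfolding y'_def damped_def using hx[OF that] y[OF that] by measurable
  have esq: "square_integrable (\<epsilon> t)" if "t < n" for t using uncorrelatedD(1)[OF eps(1)[OF that]] .
  have em: "e s \<in> borel_measurable (hist (J t))" if "s < t" "t < n" for s t
    unfolding e_def using that by (intro der_measurable y'm eps(3)) auto
  have e2: "square_integrable (e t)" if t: "t < n" for t
    unfolding e_def
  proof (rule square_integrable_mono[OF esq[OF t]])
    show "(\<lambda>\<omega>. der (y' t \<omega>) (\<epsilon> t \<omega>)) \<in> borel_measurable M"
      by (intro der_measurable hist_measurable[OF y'm[OF order_refl t] J[OF t]] square_integrableD(1)[OF esq[OF t]])
  qed (rule der_bound)
  have i1: "expectation (\<lambda>\<omega>. norm (\<Sum>t<n. \<epsilon> t \<omega>)) \<le> sqrt n * \<sigma>"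
  proof (rule orthogonal_sum_norm[OF esq eps(2) \<sigma>])
    fix s t assume st: "s < t" "t < n"
    show "expectation (\<lambda>\<omega>. \<epsilon> s \<omega> \<bullet> \<epsilon> t \<omega>) = 0"
      using st by (intro uncorrelatedD(2)[OF eps(1)] esq eps(3)) auto
  qed auto
  have i2: "expectation (\<lambda>\<omega>. norm (\<Sum>t<n. e t \<omega>)) \<le> sqrt n * (C1 * \<sigma>)"
  proof (rule orthogonal_sum_norm[OF e2])
    fix t assume t: "t < n"
    have "expectation (\<lambda>\<omega>. (norm (e t \<omega>))^2) \<le> expectation (\<lambda>\<omega>. C1^2 * (norm (\<epsilon> t \<omega>))^2)"
    proof (rule integral_mono)
      show "(norm (e t \<omega>))^2 \<le> C1^2 * (norm (\<epsilon> t \<omega>))^2" for \<omega>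
        unfolding e_def power_mult_distrib[symmetric] by (intro power_mono der_bound) auto
    qed (use square_integrableD(2)[OF e2[OF t]] square_integrableD(2)[OF esq[OF t]] in auto)
    also have "\<dots> \<le> (C1 * \<sigma>)^2"
      using eps(2)[OF t] by (simp add: power_mult_distrib mult_left_mono)
    finally show "expectation (\<lambda>\<omega>. (norm (e t \<omega>))^2) \<le> (C1 * \<sigma>)^2" .
  next
    fix s t assume st: "s < t" "t < n"
    have sn: "s < n" using st by simp
    have k: "(\<lambda>\<omega>. adj (y' t \<omega>) (e s \<omega>)) \<in> borel_measurable (hist (J t))"
      using st by (intro adj_measurable y'm em) auto
    have "expectation (\<lambda>\<omega>. e s \<omega> \<bullet> e t \<omega>) = expectation (\<lambda>\<omega>. adj (y' t \<omega>) (e s \<omega>) \<bullet> \<epsilon> t \<omega>)"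
      unfolding inner_commute[of "e s _"] e_def[of t] adj by (simp add: inner_commute)
    also have "\<dots> = 0"
      by (rule uncorrelatedD(2)[OF eps(1)[OF st(2)] square_integrable_mono[OF e2[OF sn]
            hist_measurable[OF k J[OF st(2)]] adj_bound] k])
    finally show "expectation (\<lambda>\<omega>. e s \<omega> \<bullet> e t \<omega>) = 0" .
  qed (use C \<sigma> in auto)
  have int1: "integrable M (\<lambda>\<omega>. norm (\<Sum>t<n. \<epsilon> t \<omega>))" "integrable M (\<lambda>\<omega>. norm (\<Sum>t<n. e t \<omega>))"
    using esq e2 by (auto intro!: square_integrable_integrable square_integrable_sum)
  have int2: "integrable M (\<lambda>\<omega>. \<Sum>t<n. 2 / (real t + 2) * (norm (\<epsilon> t \<omega>))^2)"
    using square_integrableD(2)[OF esq] by (intro Bochner_Integration.integrable_sum) auto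
  have i3: "expectation (\<lambda>\<omega>. \<Sum>t<n. 2 / (real t + 2) * (norm (\<epsilon> t \<omega>))^2) \<le> 2 * sqrt n * \<sigma>^2"
  proof -
    have "expectation (\<lambda>\<omega>. \<Sum>t<n. 2 / (real t + 2) * (norm (\<epsilon> t \<omega>))^2)
        = (\<Sum>t<n. 2 / (real t + 2) * expectation (\<lambda>\<omega>. (norm (\<epsilon> t \<omega>))^2))"
      using square_integrableD(2)[OF esq] by (subst Bochner_Integration.integral_sum) auto
    also have "\<dots> \<le> (\<Sum>t<n. 2 / (real t + 2) * \<sigma>^2)"
      by (intro sum_mono mult_left_mono eps(2)) auto
    also have "\<dots> = (\<Sum>t<n. 2 / (real t + 2)) * \<sigma>^2" by (simp add: sum_distrib_right)
    also have "\<dots> \<le> 2 * sqrt n * \<sigma>^2" by (intro mult_right_mono sum_harmonic_le_sqrt) auto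
    finally show ?thesis .
  qed
  show ?int unfolding noise_def y'_def[symmetric] e_def[symmetric] using int1 int2 by simp
  have "expectation (\<lambda>\<omega>. noise (\<lambda>t. x t \<omega>) (\<lambda>t. y t \<omega>) (\<lambda>t. \<epsilon> t \<omega>) n)
     = C1 * expectation (\<lambda>\<omega>. norm (\<Sum>t<n. \<epsilon> t \<omega>)) + expectation (\<lambda>\<omega>. norm (\<Sum>t<n. e t \<omega>))
      + L * expectation (\<lambda>\<omega>. \<Sum>t<n. 2 / (real t + 2) * (norm (\<epsilon> t \<omega>))^2)"
    unfolding noise_def y'_def[symmetric] e_def[symmetric] using int1 int2 by simp
  also have "\<dots> \<le> C1 * (sqrt n * \<sigma>) + sqrt n * (C1 * \<sigma>) + L * (2 * sqrt n * \<sigma>^2)"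
    using C i1 i2 i3 by (intro add_mono mult_left_mono) auto
  also have "\<dots> = sqrt n * (2 * C1 * \<sigma> + 2 * L * \<sigma>^2)" by (simp add: algebra_simps)
  finally show ?bound .
qed

end

lemma (in stochastic_layer) lin_square_integrable:
  assumes y: "square_integrable y" and u: "square_integrable u"
  shows "square_integrable (\<lambda>\<omega>. lin (y \<omega>) (u \<omega>))"
proof -
  note m = square_integrableD(1)[OF y] square_integrableD(1)[OF u]
  have 1: "square_integrable (\<lambda>\<omega>. \<Phi> (y \<omega>) - \<Phi> 0)"
  proof (rule square_integrable_mono[OF y])
    show "norm (\<Phi> (y \<omega>) - \<Phi> 0) \<le> DIM('e) * C1 * norm (y \<omega>)" for \<omega>
      using Phi_lipschitz[of "y \<omega>" 0] by simp
  qed (use measurable_compose[OF m(1) Phi_measurable] in measurable)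
  have 2: "square_integrable (\<lambda>\<omega>. der (y \<omega>) (u \<omega> - y \<omega>))"
    by (rule square_integrable_mono[OF square_integrable_diff[OF u y] der_measurable der_bound]) (use m in measurable)
  show ?thesis
    using square_integrable_add[OF square_integrable_add[OF 1 square_integrable_const[of "\<Phi> 0"]] 2]
    by (simp add: lin_def)
qed

locale stochastic_program = sample_space M A I +
  f: stochastic_layer X f2 f1 derf adjf Cf1 Cf2 Lf1 M A I +
  g: stochastic_layer X g2 g1 derg adjg Cg1 Cg2 Lg1 M A I
  for X :: "(real^'x) set"
    and f2 :: "real^'x \<Rightarrow> real^'y" and f1 :: "real^'y \<Rightarrow> real" and derf adjf Cf1 Cf2 Lf1
    and g2 :: "real^'x \<Rightarrow> real^'z" and g1 :: "real^'z \<Rightarrow> real^'m" and derg adjg Cg1 Cg2 Lg1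
    and M :: "'w measure" and A :: "'i \<Rightarrow> 'w set set" and I
begin

sublocale composite_program X f2 f1 derf adjf Cf1 Cf2 Lf1 g2 g1 derg adjg Cg1 Cg2 Lg1
  by unfold_locales

text \<open>
  Here \<open>J t\<close> is the history before iteration \<open>t\<close> and \<open>J' t\<close> also contains the sample that enters
  \<open>z\<^bsub>t+1\<^esub>\<close>. The random variables \<open>W\<close> and \<open>V\<close> are chosen before \<open>l\<close>, and the inequality between them holds
  for every outcome and every \<open>l\<close>; so \<open>l\<close> may be any function of the outcome.
\<close>

lemma expected_gap:
  fixes n :: nat and x w :: "nat \<Rightarrow> 'w \<Rightarrow> real^'x" and y \<epsilon>f :: "nat \<Rightarrow> 'w \<Rightarrow> real^'y"
    and z \<epsilon>g :: "nat \<Rightarrow> 'w \<Rightarrow> real^'z" and lam \<delta> :: "nat \<Rightarrow> 'w \<Rightarrow> real^'m"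
  assumes n: "0 < n" and x: "\<And>t \<omega>. t \<le> n \<Longrightarrow> x t \<omega> \<in> X" "\<And>\<omega>. x 0 \<omega> = x0"
    and xs: "xs \<in> X" "g1 (g2 xs) \<le> 0" and D: "\<And>u. u \<in> X \<Longrightarrow> norm (u - xs) \<le> D"
    and pos: "0 < \<eta>" "0 < \<alpha>" "0 \<le> \<sigma>f" "0 \<le> \<sigma>g" "0 \<le> \<sigma>H"
    and y: "\<And>t \<omega>. t < n \<Longrightarrow> y (Suc t) \<omega> = f.damped t (f2 (x t \<omega>) + \<epsilon>f t \<omega>) (y t \<omega>)"
    and z: "\<And>t \<omega>. t < n \<Longrightarrow> z (Suc t) \<omega> = g.damped t (g2 (x t \<omega>) + \<epsilon>g t \<omega>) (z t \<omega>)"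
    and x_step: "\<And>t \<omega>. t < n \<Longrightarrow> x (Suc t) \<omega> = closest_point X (x t \<omega> - (1 / \<eta>) *\<^sub>R w t \<omega>)"
    and lam: "\<And>\<omega>. lam 0 \<omega> = 0"
      "\<And>t \<omega>. t < n \<Longrightarrow> lam (Suc t) \<omega>
          = pos_part (lam t \<omega> + (1 / \<alpha>) *\<^sub>R (g.lin (z (Suc t) \<omega>) (g2 (x t \<omega>)) + \<delta> t \<omega>))"
    and J: "\<And>t. t < n \<Longrightarrow> J t \<subseteq> I" "\<And>t. t < n \<Longrightarrow> J' t \<subseteq> I"
    and \<epsilon>f: "\<And>t. t < n \<Longrightarrow> uncorrelated (J t) (\<epsilon>f t)"
      "\<And>t. t < n \<Longrightarrow> expectation (\<lambda>\<omega>. (norm (\<epsilon>f t \<omega>))^2) \<le> \<sigma>f^2"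
      "\<And>s t. s < t \<Longrightarrow> t < n \<Longrightarrow> \<epsilon>f s \<in> borel_measurable (hist (J t))"
    and \<epsilon>g: "\<And>t. t < n \<Longrightarrow> uncorrelated (J t) (\<epsilon>g t)"
      "\<And>t. t < n \<Longrightarrow> expectation (\<lambda>\<omega>. (norm (\<epsilon>g t \<omega>))^2) \<le> \<sigma>g^2"
      "\<And>s t. s < t \<Longrightarrow> t < n \<Longrightarrow> \<epsilon>g s \<in> borel_measurable (hist (J t))"
    and \<delta>: "\<And>t. t < n \<Longrightarrow> uncorrelated (J' t) (\<delta> t)"
      "\<And>t. t < n \<Longrightarrow> expectation (\<lambda>\<omega>. (norm (\<delta> t \<omega>))^2) \<le> \<sigma>H^2"
      "\<And>s t. s < t \<Longrightarrow> t < n \<Longrightarrow> \<delta> s \<in> borel_measurable (hist (J' t))"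
    and meas: "\<And>s t. s \<le> t \<Longrightarrow> t < n \<Longrightarrow> (\<lambda>\<omega>. f2 (x s \<omega>)) \<in> borel_measurable (hist (J t))"
      "\<And>s t. s \<le> t \<Longrightarrow> t < n \<Longrightarrow> (\<lambda>\<omega>. g2 (x s \<omega>)) \<in> borel_measurable (hist (J t))"
      "\<And>s t. s \<le> t \<Longrightarrow> t < n \<Longrightarrow> y s \<in> borel_measurable (hist (J t))"
      "\<And>s t. s \<le> t \<Longrightarrow> t < n \<Longrightarrow> z s \<in> borel_measurable (hist (J t))"
      "\<And>t. t < n \<Longrightarrow> lam t \<in> borel_measurable (hist (J' t))"
    and lam_sq: "\<And>t. t < n \<Longrightarrow> square_integrable (lam t)"
    and w: "\<And>t. t < n \<Longrightarrow> square_integrable (w t)"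
      "\<And>t. t < n \<Longrightarrow> expectation (\<lambda>\<omega>. (norm (w t \<omega>))^2)
          \<le> 2 * (Cf1 * Cf2)^2 + 2 * (Cg1 * Cg2)^2 * expectation (\<lambda>\<omega>. (norm (lam t \<omega>))^2)"
    and drift: "\<And>t. t < n \<Longrightarrow> integrable M (\<lambda>\<omega>. adjf (y (Suc t) \<omega>) 1 \<bullet> (f2 (x t \<omega>) - f2 xs)
          + adjg (z (Suc t) \<omega>) (lam t \<omega>) \<bullet> (g2 (x t \<omega>) - g2 xs) - w t \<omega> \<bullet> (x t \<omega> - xs))"
      "\<And>t. t < n \<Longrightarrow> expectation (\<lambda>\<omega>. adjf (y (Suc t) \<omega>) 1 \<bullet> (f2 (x t \<omega>) - f2 xs)
          + adjg (z (Suc t) \<omega>) (lam t \<omega>) \<bullet> (g2 (x t \<omega>) - g2 xs) - w t \<omega> \<bullet> (x t \<omega> - xs)) \<le> 0"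
  shows "\<exists>W V. integrable M W \<and> integrable M V \<and>
    (\<forall>\<omega> l K. 0 \<le> l \<longrightarrow> norm l \<le> K \<longrightarrow>
       n * (f1 (f2 ((1 / n) *\<^sub>R (\<Sum>t=1..n. x t \<omega>))) - f1 (f2 xs) + g1 (g2 ((1 / n) *\<^sub>R (\<Sum>t=1..n. x t \<omega>))) \<bullet> l)
         + \<alpha> / 2 * (norm (lam n \<omega> - l))^2 \<le> \<alpha> / 2 * (norm l)^2 + W \<omega> + K * V \<omega>) \<and>
    expectation W \<le> \<eta> / 2 * (norm (x0 - xs))^2
      + ((Cf1 * Cf2)^2 * n + (Cg1 * Cg2)^2 * (\<Sum>t<n. expectation (\<lambda>\<omega>. (norm (lam t \<omega>))^2))) / \<eta>
      + (2 * (Cg1 * Cg2 * D)^2 + \<sigma>H^2) * n / \<alpha>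
      + 2 * sqrt 2 * Cf1 * Cf2 * D + sqrt n * (2 * Cf1 * \<sigma>f + 2 * Lf1 * \<sigma>f^2) \<and>
    expectation V \<le> 2 * sqrt 2 * Cg1 * Cg2 * D + sqrt n * (2 * Cg1 * \<sigma>g + 2 * Lg1 * \<sigma>g^2 + \<sigma>H)"
proof -
  define dr where "dr t \<omega> = adjf (y (Suc t) \<omega>) 1 \<bullet> (f2 (x t \<omega>) - f2 xs)
          + adjg (z (Suc t) \<omega>) (lam t \<omega>) \<bullet> (g2 (x t \<omega>) - g2 xs) - w t \<omega> \<bullet> (x t \<omega> - xs)" for t \<omega>
  define r where "r t \<omega> = dr t \<omega> + (norm (w t \<omega>))^2 / (2 * \<eta>)
      + (2 * (Cg1 * Cg2 * D)^2 + (norm (\<delta> t \<omega>))^2) / \<alpha> + \<delta> t \<omega> \<bullet> lam t \<omega>" for t \<omega>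
  define nf where "nf \<omega> = f.noise (\<lambda>t. x t \<omega>) (\<lambda>t. y t \<omega>) (\<lambda>t. \<epsilon>f t \<omega>) n" for \<omega>
  define ng where "ng \<omega> = g.noise (\<lambda>t. x t \<omega>) (\<lambda>t. z t \<omega>) (\<lambda>t. \<epsilon>g t \<omega>) n" for \<omega>
  define W where "W \<omega> = \<eta> / 2 * (norm (x0 - xs))^2 + (\<Sum>t<n. r t \<omega>)
      + (2 * sqrt 2 * Cf1 * Cf2 * D + nf \<omega>)" for \<omega>
  define V where "V \<omega> = 2 * sqrt 2 * Cg1 * Cg2 * D + ng \<omega> + norm (\<Sum>t<n. \<delta> t \<omega>)" for \<omega>
  note dsq = uncorrelatedD(1)[OF \<delta>(1)]
  have path: "n * (f1 (f2 ((1 / n) *\<^sub>R (\<Sum>t=1..n. x t \<omega>))) - f1 (f2 xs) + g1 (g2 ((1 / n) *\<^sub>R (\<Sum>t=1..n. x t \<omega>))) \<bullet> l)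
         + \<alpha> / 2 * (norm (lam n \<omega> - l))^2 \<le> \<alpha> / 2 * (norm l)^2 + W \<omega> + K * V \<omega>"
    if l: "0 \<le> l" "norm l \<le> K" for \<omega> l K
    using pathwise_gap[of n "\<lambda>t. x t \<omega>" xs D \<eta> \<alpha> "\<lambda>t. y t \<omega>" "\<lambda>t. \<epsilon>f t \<omega>" "\<lambda>t. z t \<omega>" "\<lambda>t. \<epsilon>g t \<omega>"
        "\<lambda>t. w t \<omega>" "\<lambda>t. lam t \<omega>" "\<lambda>t. \<delta> t \<omega>" l K, OF n x(1) xs D pos(1,2) y z x_step lam l]
    unfolding W_def V_def r_def dr_def nf_def ng_def x(2) by simp
  note nfI = f.expected_noise[of n J \<epsilon>f \<sigma>f x y, OF J(1) \<epsilon>f meas(1,3) pos(3), folded nf_def]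
  note ngI = g.expected_noise[of n J \<epsilon>g \<sigma>g x z, OF J(1) \<epsilon>g meas(2,4) pos(4), folded ng_def]
  have dl: "integrable M (\<lambda>\<omega>. \<delta> t \<omega> \<bullet> lam t \<omega>)" "expectation (\<lambda>\<omega>. \<delta> t \<omega> \<bullet> lam t \<omega>) = 0" if "t < n" for t
    using square_integrable_inner[OF dsq[OF that] lam_sq[OF that]]
      uncorrelatedD(2)[OF \<delta>(1) lam_sq meas(5), OF that that that] by (auto simp: inner_commute)
  note ints = drift(1)[folded dr_def] square_integrableD(2)[OF w(1)] square_integrableD(2)[OF dsq] dl(1)
  have rI: "integrable M (r t)" if "t < n" for t
    unfolding r_def using ints[OF that] by simp
  have rE: "expectation (r t) \<le> (2 * (Cf1 * Cf2)^2 + 2 * (Cg1 * Cg2)^2 * expectation (\<lambda>\<omega>. (norm (lam t \<omega>))^2)) / (2 * \<eta>)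
      + (2 * (Cg1 * Cg2 * D)^2 + \<sigma>H^2) / \<alpha>" if t: "t < n" for t
  proof -
    have "expectation (r t) = expectation (dr t) + expectation (\<lambda>\<omega>. (norm (w t \<omega>))^2) / (2 * \<eta>)
      + (2 * (Cg1 * Cg2 * D)^2 + expectation (\<lambda>\<omega>. (norm (\<delta> t \<omega>))^2)) / \<alpha> + 0"
      unfolding r_def dl(2)[OF t, symmetric] using ints[OF t] by (simp add: prob_space)
    also have "\<dots> \<le> 0 + (2 * (Cf1 * Cf2)^2 + 2 * (Cg1 * Cg2)^2 * expectation (\<lambda>\<omega>. (norm (lam t \<omega>))^2)) / (2 * \<eta>)
      + (2 * (Cg1 * Cg2 * D)^2 + \<sigma>H^2) / \<alpha> + 0"
      using pos by (intro add_mono divide_right_mono drift(2)[folded dr_def] w(2) \<delta>(2) t order_refl) auto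
    finally show ?thesis by simp
  qed
  have "expectation (\<lambda>\<omega>. \<Sum>t<n. r t \<omega>) = (\<Sum>t<n. expectation (r t))"
    using rI by (intro Bochner_Integration.integral_sum) auto
  also have "\<dots> \<le> (\<Sum>t<n. (2 * (Cf1 * Cf2)^2 + 2 * (Cg1 * Cg2)^2 * expectation (\<lambda>\<omega>. (norm (lam t \<omega>))^2)) / (2 * \<eta>)
      + (2 * (Cg1 * Cg2 * D)^2 + \<sigma>H^2) / \<alpha>)"
    using rE by (intro sum_mono) auto
  also have "\<dots> = ((Cf1 * Cf2)^2 * n + (Cg1 * Cg2)^2 * (\<Sum>t<n. expectation (\<lambda>\<omega>. (norm (lam t \<omega>))^2))) / \<eta>
      + (2 * (Cg1 * Cg2 * D)^2 + \<sigma>H^2) * n / \<alpha>"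
  proof -
    have "(\<Sum>t<n. (2 * a + 2 * b * c t) / (2 * \<eta>) + B / \<alpha>) = (a * n + b * (\<Sum>t<n. c t)) / \<eta> + B * n / \<alpha>"
      for a b B :: real and c :: "nat \<Rightarrow> real"
    proof -
      have "(2 * a + 2 * b * c t) / (2 * \<eta>) = a / \<eta> + b / \<eta> * c t" for t
        using pos(1) by (simp add: field_simps)
      thus ?thesis by (simp add: sum.distrib add_divide_distrib sum_divide_distrib sum_distrib_left mult.commute)
    qed
    thus ?thesis .
  qed
  finally have sumE: "expectation (\<lambda>\<omega>. \<Sum>t<n. r t \<omega>)
      \<le> ((Cf1 * Cf2)^2 * n + (Cg1 * Cg2)^2 * (\<Sum>t<n. expectation (\<lambda>\<omega>. (norm (lam t \<omega>))^2))) / \<eta>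
      + (2 * (Cg1 * Cg2 * D)^2 + \<sigma>H^2) * n / \<alpha>" .
  have sI: "integrable M (\<lambda>\<omega>. \<Sum>t<n. r t \<omega>)" using rI by (intro Bochner_Integration.integrable_sum) auto
  have dI: "integrable M (\<lambda>\<omega>. norm (\<Sum>t<n. \<delta> t \<omega>))"
    using dsq by (intro square_integrable_integrable square_integrable_sum) auto
  have dE: "expectation (\<lambda>\<omega>. norm (\<Sum>t<n. \<delta> t \<omega>)) \<le> sqrt n * \<sigma>H"
  proof (rule orthogonal_sum_norm[OF dsq \<delta>(2) pos(5)])
    fix s t assume st: "s < t" "t < n"
    thus "expectation (\<lambda>\<omega>. \<delta> s \<omega> \<bullet> \<delta> t \<omega>) = 0"
      by (intro uncorrelatedD(2)[OF \<delta>(1)] dsq \<delta>(3)) auto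
  qed auto
  have WI: "integrable M W" unfolding W_def using sI nfI(1) by simp
  have VI: "integrable M V" unfolding V_def using dI ngI(1) by simp
  have WE: "expectation W \<le> \<eta> / 2 * (norm (x0 - xs))^2
      + ((Cf1 * Cf2)^2 * n + (Cg1 * Cg2)^2 * (\<Sum>t<n. expectation (\<lambda>\<omega>. (norm (lam t \<omega>))^2))) / \<eta>
      + (2 * (Cg1 * Cg2 * D)^2 + \<sigma>H^2) * n / \<alpha>
      + 2 * sqrt 2 * Cf1 * Cf2 * D + sqrt n * (2 * Cf1 * \<sigma>f + 2 * Lf1 * \<sigma>f^2)"
    using sumE nfI(2) unfolding W_def using sI nfI(1) by (simp add: prob_space)
  have VE: "expectation V \<le> 2 * sqrt 2 * Cg1 * Cg2 * D + sqrt n * (2 * Cg1 * \<sigma>g + 2 * Lg1 * \<sigma>g^2 + \<sigma>H)"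
    using dE ngI(2) unfolding V_def using dI ngI(1) by (simp add: prob_space algebra_simps)
  show ?thesis using WI VI WE VE path by blast
qed

end

section \<open>Scalar-valued and vector-valued outer functions\<close>

lemma convex_components_continuous:
  fixes h :: "real^'n \<Rightarrow> real^'k"
  assumes "\<And>j. convex_on UNIV (\<lambda>u. h u $ j)"
  shows "continuous_on UNIV h"
proof -
  have "continuous_on UNIV (\<lambda>u. \<chi> j. h u $ j)"
    by (intro continuous_on_vec_lambda convex_on_continuous assms) auto
  thus ?thesis by simp
qed

lemma composite_layer_scalar:
  fixes f2 :: "real^'x \<Rightarrow> real^'y" and f1 :: "real^'y \<Rightarrow> real"
  assumes X: "closed X" "convex X" and C: "0 < C1" "0 < C2" "0 < L"
    and f1: "convex_on UNIV f1" "\<And>u. GDERIV f1 u :> df1 u" "\<And>u. norm (df1 u) \<le> C1" "L-lipschitz_on UNIV df1"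
    and f2: "\<And>u. u \<in> X \<Longrightarrow> \<exists>D \<in> vec_subdiff f2 u. norm D \<le> C2" "\<And>j. convex_on UNIV (\<lambda>u. f2 u $ j)"
    and mono: "\<And>u. \<not> affine_map f2 \<Longrightarrow> 0 \<le> df1 u"
  shows "composite_layer X f2 f1 (\<lambda>y d. df1 y \<bullet> d) (\<lambda>y l. l *\<^sub>R df1 y) C1 C2 L"
proof
  show "l \<bullet> f1 p + (l *\<^sub>R df1 p) \<bullet> (q - p) \<le> l \<bullet> f1 q" if "0 \<le> l" for l :: real and p q
    using mult_left_mono[OF convex_tangent_le[OF f1(1,2)] that, of p q] by (simp add: algebra_simps)
  show "norm (df1 y \<bullet> d - df1 y' \<bullet> d) \<le> L * norm (y - y') * norm d" for y y' d
  proof -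
    have "norm (df1 y \<bullet> d - df1 y' \<bullet> d) \<le> norm (df1 y - df1 y') * norm d"
      using Cauchy_Schwarz_ineq2[of "df1 y - df1 y'" d] by (simp add: inner_diff_left)
    also have "\<dots> \<le> L * norm (y - y') * norm d"
      using lipschitz_onD[OF f1(4), of y y'] by (intro mult_right_mono) (auto simp: dist_norm)
    finally show ?thesis .
  qed
  show "affine_map f2 \<or> 0 \<le> l *\<^sub>R df1 y" if "0 \<le> l" for y and l :: real
    using mono[of y] that by (auto simp: less_eq_vec_def)
  show "norm (l *\<^sub>R df1 y) \<le> C1 * norm l" for y and l :: real
    using mult_right_mono[OF f1(3)[of y], of "\<bar>l\<bar>"] by (simp add: mult.commute)
qed (use assms in \<open>auto simp: inner_commute\<close>)

lemma composite_layer_vector: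
  fixes g2 :: "real^'x \<Rightarrow> real^'z" and g1 :: "real^'z \<Rightarrow> real^'m"
  assumes X: "closed X" "convex X" and C: "0 < C1" "0 < C2" "0 < L"
    and g1: "\<And>j. convex_on UNIV (\<lambda>u. g1 u $ j)" "\<And>u. vec_has_gradient g1 (dg1 u) u"
      "\<And>u. norm (dg1 u) \<le> C1" "L-lipschitz_on UNIV dg1"
    and g2: "\<And>u. u \<in> X \<Longrightarrow> \<exists>D \<in> vec_subdiff g2 u. norm D \<le> C2" "\<And>j. convex_on UNIV (\<lambda>u. g2 u $ j)"
    and mono: "\<And>j. \<not> affine_map g2 \<Longrightarrow> mono (\<lambda>u. g1 u $ j)"
  shows "composite_layer X g2 g1 (\<lambda>z d. transpose (dg1 z) *v d) (\<lambda>z l. dg1 z *v l) C1 C2 L"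
proof
  have grad: "GDERIV (\<lambda>u. g1 u $ j) u :> column j (dg1 u)" for j u
    using g1(2)[of u] by (simp add: vec_has_gradient_def)
  show "(transpose (dg1 y) *v d) \<bullet> l = d \<bullet> (dg1 y *v l)" for y d l by (rule transpose_vector_inner)
  show "l \<bullet> g1 p + (dg1 p *v l) \<bullet> (q - p) \<le> l \<bullet> g1 q" if l: "0 \<le> l" for l p q
  proof -
    have "l \<bullet> g1 p + (dg1 p *v l) \<bullet> (q - p) = (\<Sum>j\<in>UNIV. l $ j * (g1 p $ j + column j (dg1 p) \<bullet> (q - p)))"
      by (simp add: matrix_vector_inner_columns inner_vec_def[of l] sum.distrib distrib_left)
    also have "\<dots> \<le> (\<Sum>j\<in>UNIV. l $ j * g1 q $ j)"
      using l by (intro sum_mono mult_left_mono convex_tangent_le[OF g1(1) grad]) (auto simp: less_eq_vec_def)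
    finally show ?thesis by (simp add: inner_vec_def)
  qed
  show "norm (dg1 y *v l) \<le> C1 * norm l" for y l
    using norm_matrix_vector_le[of "dg1 y" l] mult_right_mono[OF g1(3)[of y], of "norm l"] by simp
  show "norm (transpose (dg1 y) *v d - transpose (dg1 y') *v d) \<le> L * norm (y - y') * norm d" for y y' d
  proof -
    have "transpose (dg1 y) *v d - transpose (dg1 y') *v d = transpose (dg1 y - dg1 y') *v d"
      by (simp add: vec_eq_iff matrix_vector_mult_def transpose_def sum_subtractf left_diff_distrib
            del: transpose_matrix_vector)
    hence "norm (transpose (dg1 y) *v d - transpose (dg1 y') *v d) \<le> norm (dg1 y - dg1 y') * norm d"
      using norm_matrix_vector_le[of "transpose (dg1 y - dg1 y')" d] by (simp add: norm_transpose)
    also have "\<dots> \<le> L * norm (y - y') * norm d"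
      using lipschitz_onD[OF g1(4), of y y'] by (intro mult_right_mono) (auto simp: dist_norm)
    finally show ?thesis .
  qed
  show "affine_map g2 \<or> 0 \<le> dg1 y *v l" if l: "0 \<le> l" for y l
  proof (cases "affine_map g2")
    case False
    have "0 \<le> column j (dg1 y)" for j by (rule mono_gradient_nonneg[OF mono[OF False] grad])
    hence "0 \<le> dg1 y $ i $ j" for i j by (simp add: less_eq_vec_def column_def)
    hence "0 \<le> dg1 y *v l" using l by (auto simp: less_eq_vec_def matrix_vector_mult_def intro!: sum_nonneg)
    thus ?thesis ..
  qed simp
qed (use assms in auto)

section \<open>Numerical bounds\<close>

lemma mult_le_squares:
  fixes a b q :: real
  assumes "0 < q"
  shows "2 * a * b \<le> 4 * a^2 / q + q * b^2 / 4"
proof -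
  have "0 \<le> (4 * a - q * b)^2 / (4 * q)" using assms by simp
  also have "(4 * a - q * b)^2 / (4 * q) = 4 * a^2 / q + q * b^2 / 4 - 2 * a * b"
    using assms by (simp add: field_simps power2_eq_square)
  finally show ?thesis by simp
qed

text \<open>
  Step sizes inserted: every term of the expected gap is at most \<open>sqrt N\<close> times a constant. The
  boundary term \<open>2 sqrt 2 cD\<close> fits because \<open>sqrt 2 \<le> sqrt N\<close>, which is where \<open>N \<ge> 2\<close> is used.
\<close>

lemma scaled_gap_bound:
  fixes n N :: nat and q p F cD S b d :: real
  assumes nN: "n \<le> N" "2 \<le> N" and pos: "0 < q" "0 \<le> p" "0 \<le> F" "0 \<le> cD" "0 \<le> S" "0 \<le> b"
  shows "15 * q * sqrt N / 2 / 2 * d + (p * n + q * S) / (15 * q * sqrt N / 2) + b * n / (2 * sqrt N)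
       + 2 * sqrt 2 * cD + sqrt n * F
    \<le> sqrt N * (15 * q / 4 * d + 2 * p / (15 * q) + 2 / 15 * (S / N) + b / 2 + 2 * cD + F)"
proof -
  define s where "s = sqrt N"
  have s: "0 < s" "real N = s * s" using nN by (auto simp: s_def)
  have "p * n / (15 * q * s / 2) \<le> s * (2 * p / (15 * q))"
  proof -
    have "p * n \<le> p * (s * s)" using nN pos s by (intro mult_left_mono) auto
    thus ?thesis using s pos by (simp add: field_simps)
  qed
  moreover have "q * S / (15 * q * s / 2) = s * (2 / 15 * (S / N))"
    using s pos unfolding s(2) by (simp add: field_simps)
  moreover have "b * n / (2 * s) \<le> s * (b / 2)"
  proof -
    have "b * n \<le> b * (s * s)" using nN pos s by (intro mult_left_mono) auto
    thus ?thesis using s by (simp add: field_simps)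
  qed
  moreover have "2 * sqrt 2 * cD \<le> s * (2 * cD)"
    using nN pos mult_right_mono[of "sqrt 2" s "2 * cD"] unfolding s_def by simp
  moreover have "sqrt n * F \<le> s * F" unfolding s_def using nN pos by (intro mult_right_mono) auto
  ultimately show ?thesis unfolding s_def[symmetric] by (simp add: algebra_simps add_divide_distrib)
qed

text \<open>
  Here \<open>c\<close> and \<open>g\<close> stand for \<open>Cf1 Cf2\<close> and \<open>Cg1 Cg2\<close>, \<open>d\<close> for the squared initial distance, and the \<open>F\<close>s and
  \<open>G\<close>s for the noise constants of the two layers. The products \<open>c D\<close> and \<open>g D k\<close>, which have no
  counterpart in \<open>R\<close>, are split by Young's inequality so that each uses a quarter of \<open>(g D)^2\<close>.
\<close>

lemma constants_bound:
  fixes c g D m d F1 F2 G1 G2 \<sigma> :: real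
  assumes g: "0 < g" and nonneg: "0 \<le> m" "0 \<le> d" "0 \<le> F1" "0 \<le> F2" "0 \<le> G1" "0 \<le> G2" "0 \<le> \<sigma>"
  defines "a \<equiv> 15 * g^2 / 4 * d + 2 * c^2 / (15 * g^2) + (2 * (g * D)^2 + \<sigma>^2) / 2 + 2 * (c * D) + (2 * F2 + 2 * F1)"
    and "b \<equiv> 2 * (g * D) + (2 * G2 + 2 * G1 + \<sigma>)"
    and "R \<equiv> 7 * c^2 / g^2 + 6 * m^2 + ((g * D)^2 + \<sigma>^2) / 2 + 15 * g^2 / 4 * d + m^2
        + (2 * G1 * m + 3 * G2 * m + m * \<sigma> + 2 * F1 + 3 * F2)"
  shows "m^2 + a + m * b \<le> 3 * R" and "7 * m^2 \<le> R" and "0 \<le> R" and "a \<le> 3 * R"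
    and "a + k * b \<le> 4 * k^2 + 7 / 2 * R + k * (2 * G2 + 2 * G1 + \<sigma>)"
proof -
  have g2: "0 < g^2" using g by simp
  have nn: "0 \<le> G1 * m" "0 \<le> G2 * m" "0 \<le> m * \<sigma>" "0 \<le> g^2 * d" "0 \<le> c^2 / g^2" "0 \<le> m^2" "0 \<le> (g * D)^2" "0 \<le> \<sigma>^2"
    using nonneg by auto
  have e1: "2 * (c * D) \<le> 4 * (c^2 / g^2) + (g * D)^2 / 4"
    using mult_le_squares[OF g2, of c D] by (simp add: power_mult_distrib)
  have e2: "2 * (g * D) * k \<le> 4 * k^2 + (g * D)^2 / 4" for k :: real
    using mult_le_squares[of 1 k "g * D"] by (simp add: mult.commute mult.left_commute)
  have a: "a = 15 / 4 * (g^2 * d) + 2 / 15 * (c^2 / g^2) + (g * D)^2 + \<sigma>^2 / 2 + 2 * (c * D) + 2 * F2 + 2 * F1"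
    by (simp add: a_def add_divide_distrib)
  have b: "k * b = 2 * (g * D) * k + 2 * (G2 * k) + 2 * (G1 * k) + k * \<sigma>" for k
    by (simp add: b_def algebra_simps)
  have R: "R = 7 * (c^2 / g^2) + 7 * m^2 + (g * D)^2 / 2 + \<sigma>^2 / 2 + 15 / 4 * (g^2 * d)
        + 2 * (G1 * m) + 3 * (G2 * m) + m * \<sigma> + 2 * F1 + 3 * F2"
    by (simp add: R_def add_divide_distrib)
  define t u v w where "t = c^2 / g^2" and "u = (g * D)^2" and "v = g^2 * d" and "w = m^2"
  note atoms = t_def[symmetric] u_def[symmetric] v_def[symmetric] w_def[symmetric]
  show "m^2 + a + m * b \<le> 3 * R"
    using nn nonneg e1 e2[of m] unfolding a b R atoms by argo
  show "7 * m^2 \<le> R"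
    using nn nonneg unfolding R atoms by argo
  show "0 \<le> R"
    using nn nonneg unfolding R atoms by argo
  show "a \<le> 3 * R"
    using nn nonneg e1 unfolding a R atoms by argo
  have kb: "k * (2 * G2 + 2 * G1 + \<sigma>) = 2 * (G2 * k) + 2 * (G1 * k) + k * \<sigma>"
    by (simp add: algebra_simps)
  show "a + k * b \<le> 4 * k^2 + 7 / 2 * R + k * (2 * G2 + 2 * G1 + \<sigma>)"
    using nn nonneg e1 e2[of k] unfolding a b R kb atoms by argo
qed

text \<open>
  A strong induction: if all earlier values are at most \<open>B\<close>, so is their average, and \<open>B\<close> is chosen
  to be preserved. The average is over \<open>N\<close> although only \<open>n \<le> N\<close> terms are present.
\<close>

lemma averaged_recursion_bound:
  fixes \<Lambda> :: "nat \<Rightarrow> real" and B :: real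
  assumes rec: "\<And>n. 0 < n \<Longrightarrow> n \<le> N \<Longrightarrow> \<Lambda> n \<le> a + c * ((\<Sum>t<n. \<Lambda> t) / N)" and zero: "\<Lambda> 0 \<le> B"
    and B: "a + c * B \<le> B" and c: "0 \<le> c" "0 \<le> B" and n: "n \<le> N"
  shows "\<Lambda> n \<le> B" and "(\<Sum>t<n. \<Lambda> t) / N \<le> B"
proof -
  have sum: "(\<Sum>t<n. \<Lambda> t) / N \<le> B" if "\<And>t. t < n \<Longrightarrow> \<Lambda> t \<le> B" "n \<le> N" for n
  proof -
    have "(\<Sum>t<n. \<Lambda> t) \<le> n * B" using sum_mono[of "{..<n}" \<Lambda> "\<lambda>_. B"] that(1) by simp
    also have "\<dots> \<le> N * B" using that(2) c(2) by (intro mult_right_mono) auto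
    finally show ?thesis by (cases "N = 0") (use c(2) in \<open>auto simp: field_simps\<close>)
  qed
  have main: "n \<le> N \<Longrightarrow> \<Lambda> n \<le> B" for n
  proof (induction n rule: less_induct)
    case (less n)
    show ?case
    proof (cases "n = 0")
      case False
      hence "\<Lambda> n \<le> a + c * ((\<Sum>t<n. \<Lambda> t) / N)" using less.prems by (intro rec) auto
      also have "\<dots> \<le> a + c * B"
        using less c(1) by (intro add_left_mono mult_left_mono sum) auto
      finally show ?thesis using B by simp
    qed (use zero in simp)
  qed
  show "\<Lambda> n \<le> B" using main n by simp
  show "(\<Sum>t<n. \<Lambda> t) / N \<le> B" using n by (intro sum main) auto
qed

section \<open>Convergence of the stochastic compositional method\<close>

theorem theorem4:
  fixes M :: "'w measure"
    and X :: "(real^'x) set"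
    \<comment> \<open>expected functions and their gradients\<close>
    and f1 :: "real^'y \<Rightarrow> real" and f2 :: "real^'x \<Rightarrow> real^'y"
    and g1 :: "real^'z \<Rightarrow> real^'m" and g2 :: "real^'x \<Rightarrow> real^'z"
    and df1 :: "real^'y \<Rightarrow> real^'y" and dg1 :: "real^'z \<Rightarrow> real^'m^'z"
    and F :: "real^'x \<Rightarrow> real" and G :: "real^'x \<Rightarrow> real^'m"
    and Lagr :: "real^'x \<Rightarrow> real^'m \<Rightarrow> real"
    \<comment> \<open>sampling oracles\<close>
    and f1s :: "real^'y \<Rightarrow> real^'p1 \<Rightarrow> real" and df1s :: "real^'y \<Rightarrow> real^'p1 \<Rightarrow> real^'y"
    and f2s :: "real^'x \<Rightarrow> real^'p2 \<Rightarrow> real^'y" and df2s :: "real^'x \<Rightarrow> real^'p2 \<Rightarrow> real^'y^'x"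
    and g1s :: "real^'z \<Rightarrow> real^'q1 \<Rightarrow> real^'m" and dg1s :: "real^'z \<Rightarrow> real^'q1 \<Rightarrow> real^'m^'z"
    and g2s :: "real^'x \<Rightarrow> real^'q2 \<Rightarrow> real^'z" and dg2s :: "real^'x \<Rightarrow> real^'q2 \<Rightarrow> real^'z^'x"
    \<comment> \<open>random vectors and samples (superscript, time)\<close>
    and \<xi>\<^sub>1 :: "'w \<Rightarrow> real^'p1" and \<xi>\<^sub>2 :: "'w \<Rightarrow> real^'p2"
    and \<zeta>\<^sub>1 :: "'w \<Rightarrow> real^'q1" and \<zeta>\<^sub>2 :: "'w \<Rightarrow> real^'q2"
    and xi1 :: "nat \<Rightarrow> nat \<Rightarrow> 'w \<Rightarrow> real^'p1" and xi2 :: "nat \<Rightarrow> nat \<Rightarrow> 'w \<Rightarrow> real^'p2"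
    and zeta1 :: "nat \<Rightarrow> nat \<Rightarrow> 'w \<Rightarrow> real^'q1" and zeta2 :: "nat \<Rightarrow> nat \<Rightarrow> 'w \<Rightarrow> real^'q2"
    \<comment> \<open>saddle point and constants\<close>
    and xstar :: "real^'x" and lstar :: "real^'m"
    and Cf1 Cf2 \<sigma>f1 \<sigma>f2 Lf1 DX Cg1 Cg2 \<sigma>g1 \<sigma>g2 Lg1 \<sigma>H Q R nlt :: real
    \<comment> \<open>step sizes and iterates\<close>
    and N :: nat and \<alpha> \<eta> \<tau> \<rho> :: "nat \<Rightarrow> real"
    and x0 :: "real^'x" and lam0 :: "real^'m"
    and x :: "nat \<Rightarrow> 'w \<Rightarrow> real^'x" and y :: "nat \<Rightarrow> 'w \<Rightarrow> real^'y"
    and z :: "nat \<Rightarrow> 'w \<Rightarrow> real^'z" and lam H :: "nat \<Rightarrow> 'w \<Rightarrow> real^'m"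
    and v1 :: "nat \<Rightarrow> 'w \<Rightarrow> real^'m^'z" and v2 :: "nat \<Rightarrow> 'w \<Rightarrow> real^'z^'x"
    and xbar :: "'w \<Rightarrow> real^'x"
  assumes M: "prob_space M"
    and rv: "\<xi>\<^sub>1 \<in> borel_measurable M" "\<xi>\<^sub>2 \<in> borel_measurable M"
            "\<zeta>\<^sub>1 \<in> borel_measurable M" "\<zeta>\<^sub>2 \<in> borel_measurable M"
    and samples: "independent_copies M N \<xi>\<^sub>1 \<xi>\<^sub>2 \<zeta>\<^sub>1 \<zeta>\<^sub>2 xi1 xi2 zeta1 zeta2"
    and oracles: "jointly_measurable f1s" "jointly_measurable df1s"
                 "jointly_measurable f2s" "jointly_measurable df2s"
                 "jointly_measurable g1s" "jointly_measurable dg1s"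
                 "jointly_measurable g2s" "jointly_measurable dg2s"
    and F_def: "\<And>u. F u = f1 (f2 u)"
    and G_def: "\<And>u. G u = g1 (g2 u)"
    and X: "closed X" "convex X" "bounded X"
    and positive: "Cf1 > 0" "Cf2 > 0" "\<sigma>f1 > 0" "\<sigma>f2 > 0" "Lf1 > 0" "DX > 0"
                  "Cg1 > 0" "Cg2 > 0" "\<sigma>g1 > 0" "\<sigma>g2 > 0" "Lg1 > 0" "\<sigma>H > 0"
    \<comment> \<open>saddle point\<close>
    and Lagr_def: "\<And>u l. Lagr u l = F u + G u \<bullet> l"
    and xstar: "xstar \<in> X" and lstar: "0 \<le> lstar"
    and saddle: "\<forall>u\<in>X. \<forall>l\<ge>0. Lagr xstar l \<le> Lagr xstar lstar \<and> Lagr xstar lstar \<le> Lagr u lstar"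
    and diam: "\<forall>u\<in>X. norm (u - xstar) \<le> DX"
    \<comment> \<open>the functions are expectations of their value oracles\<close>
    and f1_mean: "\<forall>u. has_bochner_integral M (\<lambda>\<omega>. f1s u (\<xi>\<^sub>1 \<omega>)) (f1 u)"
    and f2_mean: "\<forall>u. has_bochner_integral M (\<lambda>\<omega>. f2s u (\<xi>\<^sub>2 \<omega>)) (f2 u)"
    and g1_mean: "\<forall>u. has_bochner_integral M (\<lambda>\<omega>. g1s u (\<zeta>\<^sub>1 \<omega>)) (g1 u)"
    and g2_mean: "\<forall>u. has_bochner_integral M (\<lambda>\<omega>. g2s u (\<zeta>\<^sub>2 \<omega>)) (g2 u)"
    \<comment> \<open>convexity and differentiability\<close>
    and f1_convex: "convex_on UNIV f1"
    and f2_convex: "\<forall>j. convex_on UNIV (\<lambda>u. f2 u $ j)"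
    and F_convex: "convex_on UNIV F"
    and g1_convex: "\<forall>j. convex_on UNIV (\<lambda>u. g1 u $ j)"
    and g2_convex: "\<forall>j. convex_on UNIV (\<lambda>u. g2 u $ j)"
    and G_convex: "\<forall>j. convex_on UNIV (\<lambda>u. G u $ j)"
    and f1_grad: "\<forall>u. GDERIV f1 u :> df1 u"
    and g1_grad: "\<forall>u. vec_has_gradient g1 (dg1 u) u"
    \<comment> \<open>assumptions on the objective\<close>
    and f1_max: "\<forall>u. is_max_on (conj_dom f1) (dual_obj f1 u) (f1 u)"
    and f2_max: "\<forall>u\<in>X. is_max_on (vec_conj_dom f2) (vec_dual_obj f2 u) (f2 u)"
    and df1_lipschitz: "Lf1-lipschitz_on UNIV df1"
    and f2_var: "\<forall>u\<in>X. has_bochner_integral M (\<lambda>\<omega>. (norm (f2s u (\<xi>\<^sub>2 \<omega>) - f2 u))\<^sup>2) (\<sigma>f2\<^sup>2)"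
    and f1_var: "\<forall>u. has_bochner_integral M (\<lambda>\<omega>. (f1s u (\<xi>\<^sub>1 \<omega>) - f1 u)\<^sup>2) (\<sigma>f1\<^sup>2)"
    and df2_mean: "\<forall>u\<in>X. \<exists>D \<in> vec_subdiff f2 u.
                     has_bochner_integral M (\<lambda>\<omega>. df2s u (\<xi>\<^sub>2 \<omega>)) D"
    and df2_moment: "\<forall>u\<in>X. second_moment_le M (\<lambda>\<omega>. df2s u (\<xi>\<^sub>2 \<omega>)) (Cf2\<^sup>2)"
    and df1_mean: "\<forall>u. has_bochner_integral M (\<lambda>\<omega>. df1s u (\<xi>\<^sub>1 \<omega>)) (df1 u)"
    and df1_moment: "\<forall>u. second_moment_le M (\<lambda>\<omega>. df1s u (\<xi>\<^sub>1 \<omega>)) (Cf1\<^sup>2)"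
    and f_mono: "\<not> affine_map f2 \<Longrightarrow> \<forall>u. 0 \<le> df1 u"
    \<comment> \<open>assumptions on the constraints\<close>
    and g1_max: "\<forall>u. is_max_on (vec_conj_dom g1) (vec_dual_obj g1 u) (g1 u)"
    and g2_max: "\<forall>u\<in>X. is_max_on (vec_conj_dom g2) (vec_dual_obj g2 u) (g2 u)"
    and g1_var: "\<forall>u. second_moment_le M (\<lambda>\<omega>. g1s u (\<zeta>\<^sub>1 \<omega>) - g1 u) (\<sigma>g1\<^sup>2)"
    and dg1_mean: "\<forall>u. has_bochner_integral M (\<lambda>\<omega>. dg1s u (\<zeta>\<^sub>1 \<omega>)) (dg1 u)"
    and dg1_moment: "\<forall>u. second_moment_le M (\<lambda>\<omega>. dg1s u (\<zeta>\<^sub>1 \<omega>)) (Cg1\<^sup>2)"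
    and g2_var: "\<forall>u\<in>X. second_moment_le M (\<lambda>\<omega>. g2s u (\<zeta>\<^sub>2 \<omega>) - g2 u) (\<sigma>g2\<^sup>2)"
    and dg2_mean: "\<forall>u\<in>X. \<exists>D \<in> vec_subdiff g2 u.
                     has_bochner_integral M (\<lambda>\<omega>. dg2s u (\<zeta>\<^sub>2 \<omega>)) D"
    and dg2_moment: "\<forall>u\<in>X. second_moment_le M (\<lambda>\<omega>. dg2s u (\<zeta>\<^sub>2 \<omega>)) (Cg2\<^sup>2)"
    and dg1_lipschitz: "Lg1-lipschitz_on UNIV dg1"
    and g_mono: "\<not> affine_map g2 \<Longrightarrow> \<forall>j. mono (\<lambda>u. g1 u $ j)"
    \<comment> \<open>the algorithm\<close>
    and N: "N \<ge> 2"
    and steps: "\<forall>t\<le>N. \<tau> t = real t / 2 \<and> \<rho> t = real t / 2 \<and> \<alpha> t = 2 * sqrt (real N) \<and>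
                  \<eta> t = 15 * Cg1\<^sup>2 * Cg2\<^sup>2 * sqrt (real N) / 2"
    and x0: "x0 \<in> X" and lam0: "lam0 = 0"
    and init: "\<forall>\<omega>. x 0 \<omega> = x0 \<and> y 0 \<omega> = 0 \<and> z 0 \<omega> = 0 \<and> lam 0 \<omega> = lam0"
    and y_step: "\<forall>t<N. \<forall>\<omega>. y (Suc t) \<omega> = (1 / (1 + \<tau> t)) *\<^sub>R (f2s (x t \<omega>) (xi2 1 t \<omega>) + \<tau> t *\<^sub>R y t \<omega>)"
    and z_step: "\<forall>t<N. \<forall>\<omega>. z (Suc t) \<omega> = (1 / (1 + \<rho> t)) *\<^sub>R (g2s (x t \<omega>) (zeta2 1 t \<omega>) + \<rho> t *\<^sub>R z t \<omega>)"
    and x_step: "\<forall>t<N. \<forall>\<omega>. x (Suc t) \<omega> = closest_point X (x t \<omega> - (1 / \<eta> t) *\<^sub>R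
                   (df2s (x t \<omega>) (xi2 0 t \<omega>) *v df1s (y (Suc t) \<omega>) (xi1 0 t \<omega>) +
                    dg2s (x t \<omega>) (zeta2 0 t \<omega>) *v
                      (dg1s (z (Suc t) \<omega>) (zeta1 0 t \<omega>) *v lam t \<omega>)))"
    and H_step: "\<forall>t<N. \<forall>\<omega>. H (Suc t) \<omega> = g1s (z (Suc t) \<omega>) (zeta1 1 t \<omega>)
                   - transpose (dg1s (z (Suc t) \<omega>) (zeta1 1 t \<omega>)) *v z (Suc t) \<omega>
                   + transpose (dg1s (z (Suc t) \<omega>) (zeta1 1 t \<omega>)) *v g2s (x t \<omega>) (zeta2 2 t \<omega>)"
    and lam_step: "\<forall>t<N. \<forall>\<omega>. lam (Suc t) \<omega> = pos_part (lam t \<omega> + (1 / \<alpha> t) *\<^sub>R H (Suc t) \<omega>)"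
    \<comment> \<open>conditional variance of \<open>H\<close>\<close>
    and v1: "\<forall>t\<in>{1..N}. \<forall>\<omega>. v1 t \<omega> = dg1 (z t \<omega>)"
    and v2: "\<forall>t\<in>{1..N}. v2 t \<in> borel_measurable (generated_algebra M (x (t - 1))) \<and>
               (\<forall>\<omega>. v2 t \<omega> \<in> argmax_on (vec_conj_dom g2) (vec_dual_obj g2 (x (t - 1) \<omega>)))"
    and \<sigma>H: "\<forall>t\<in>{1..N}. AE \<omega> in M.
               cond_variance M (generated_algebra M (\<lambda>\<omega>. (x (t - 1) \<omega>, v1 t \<omega>, v2 t \<omega>))) (H t) \<omega>
                 \<le> ennreal (\<sigma>H\<^sup>2)"
    \<comment> \<open>quantities in the bounds\<close>
    and Q_def: "Q = 2 * Lg1 * \<sigma>g2\<^sup>2 * norm lstar + 3 * Cg1 * \<sigma>g2 * norm lstar + norm lstar * \<sigma>H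
                    + 2 * Lf1 * \<sigma>f2\<^sup>2 + 3 * Cf1 * \<sigma>f2"
    and R_def: "R = 7 * Cf1\<^sup>2 * Cf2\<^sup>2 / (Cg1\<^sup>2 * Cg2\<^sup>2) + 6 * (norm lstar)\<^sup>2
                    + (DX\<^sup>2 * Cg1\<^sup>2 * Cg2\<^sup>2 + \<sigma>H\<^sup>2) / 2
                    + 15 * Cg1\<^sup>2 * Cg2\<^sup>2 / 4 * (norm (x0 - xstar))\<^sup>2
                    + (norm (lam0 - lstar))\<^sup>2 + Q"
    and xbar_def: "\<And>\<omega>. xbar \<omega> = (1 / real N) *\<^sub>R (\<Sum>t=1..N. x t \<omega>)"
    and nlt_def: "nlt = norm lstar + 1" \<comment> \<open>the common value of the norm of \<open>\<lambda>\<close>-tilde\<close>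
  shows "integrable M (\<lambda>\<omega>. F (xbar \<omega>) - F xstar) \<and>
         (\<integral>\<omega>. (F (xbar \<omega>) - F xstar) \<partial>M)
           \<le> 1 / sqrt (real N) *
               (15 * Cg1\<^sup>2 * Cg2\<^sup>2 / 4 * (norm (x0 - xstar))\<^sup>2
                + 7 * Cf1\<^sup>2 * Cf2\<^sup>2 / (Cg1\<^sup>2 * Cg2\<^sup>2)
                + (DX\<^sup>2 * Cg1\<^sup>2 * Cg2\<^sup>2 + \<sigma>H\<^sup>2) / 2
                + 2 * Lf1 * \<sigma>f2\<^sup>2 + 3 * Cf1 * \<sigma>f2)
             + 4 / (3 * sqrt (real N)) * ((norm lstar)\<^sup>2 + 2 * R * (exp 1)\<^sup>2)
         \<and>
         integrable M (\<lambda>\<omega>. norm (pos_part (G (xbar \<omega>)))) \<and>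
         (\<integral>\<omega>. norm (pos_part (G (xbar \<omega>))) \<partial>M)
           \<le> 1 / sqrt (real N) *
               (16 / 3 * nlt\<^sup>2 + 2 * Lg1 * \<sigma>g2\<^sup>2 * nlt + 3 * Cg1 * \<sigma>g2 * nlt
                + 15 * Cg1\<^sup>2 * Cg2\<^sup>2 / 4 * (norm (x0 - xstar))\<^sup>2
                + 7 * Cf1\<^sup>2 * Cf2\<^sup>2 / (Cg1\<^sup>2 * Cg2\<^sup>2))
             + 1 / sqrt (real N) *
               ((DX\<^sup>2 * Cg1\<^sup>2 * Cg2\<^sup>2 + \<sigma>H\<^sup>2) / 2 + nlt\<^sup>2 + \<sigma>H * nlt
                + 2 * Lf1 * \<sigma>f2\<^sup>2 + 3 * Cf1 * \<sigma>f2)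
             + 1 / sqrt (real N) * (nlt + (norm lstar)\<^sup>2 + 2 * R * (exp 1)\<^sup>2)"
proof -
  interpret prob_space M by (rule M)

  define A where "A i = (case i of
           Xi1 k t \<Rightarrow> sets (generated_algebra M (xi1 k t))
         | Xi2 k t \<Rightarrow> sets (generated_algebra M (xi2 k t))
         | Zeta1 k t \<Rightarrow> sets (generated_algebra M (zeta1 k t))
         | Zeta2 k t \<Rightarrow> sets (generated_algebra M (zeta2 k t)))" for i
  define I where "I = sample_indices N"
  interpret sample_space M A I
  proof
    show "indep_sets A I" using samples unfolding independent_copies_def A_def I_def by blast
    show "Int_stable (A i)" if "i \<in> I" for i
      by (cases i) (auto simp: A_def sets.Int_stable)
  qed
  define past where "past t = {i \<in> I. (case i of Xi1 k s \<Rightarrow> s | Xi2 k s \<Rightarrow> s | Zeta1 k s \<Rightarrow> s | Zeta2 k s \<Rightarrow> s) < t}" for t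
  \<comment> \<open>The samples in \<open>half t\<close> determine \<open>z (Suc t)\<close>, those in \<open>full t\<close> also \<open>y (Suc t)\<close>. The estimate of the
    constraints is centred relative to \<open>half t\<close>, the search direction is analysed relative to \<open>full t\<close>.\<close>
  define half where "half t = insert (Zeta2 1 t) (past t)" for t
  define full where "full t = insert (Xi2 1 t) (half t)" for t
  have idx: "Xi1 0 t \<in> I" "k < 2 \<Longrightarrow> Xi2 k t \<in> I" "k < 2 \<Longrightarrow> Zeta1 k t \<in> I" "k < 3 \<Longrightarrow> Zeta2 k t \<in> I" if "t < N" for t k
    using that by (auto simp: I_def sample_indices_def)
  have past_mono: "past s \<subseteq> past t" if "s \<le> t" for s t using that by (auto simp: past_def)
  have past_I: "past t \<subseteq> I" for t by (auto simp: past_def)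
  have sub: "half t \<subseteq> I" "full t \<subseteq> I" "past t \<subseteq> half t" "past t \<subseteq> full t" "half t \<subseteq> full t"
    "full t \<subseteq> past (Suc t)" "half t \<subseteq> past (Suc t)" if "t < N" for t
    using idx[OF that] by (auto simp: half_def full_def past_def)
  have sub1: "{Xi1 0 t} \<subseteq> past (Suc t)" "k < 2 \<Longrightarrow> {Xi2 k t} \<subseteq> past (Suc t)"
    "k < 2 \<Longrightarrow> {Zeta1 k t} \<subseteq> past (Suc t)" "k < 3 \<Longrightarrow> {Zeta2 k t} \<subseteq> past (Suc t)" if "t < N" for t k
    using idx[OF that] by (auto simp: past_def)
  have fresh: "Xi2 1 t \<in> I - past t" "Zeta2 1 t \<in> I - past t" "Zeta1 1 t \<in> I - half t" "Zeta2 2 t \<in> I - half t"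
    "Xi1 0 t \<in> I - full t" "Xi2 0 t \<in> I - full t" "Zeta1 0 t \<in> I - full t" "Zeta2 0 t \<in> I - full t" if "t < N" for t
    using idx[OF that] by (auto simp: past_def half_def full_def)
  have sample: "xi1 0 t \<in> borel_measurable (hist {Xi1 0 t})"
    "k < 2 \<Longrightarrow> xi2 k t \<in> borel_measurable (hist {Xi2 k t})"
    "k < 2 \<Longrightarrow> zeta1 k t \<in> borel_measurable (hist {Zeta1 k t})"
    "k < 3 \<Longrightarrow> zeta2 k t \<in> borel_measurable (hist {Zeta2 k t})" if "t < N" for t k
    using idx[OF that] by (auto intro!: hist_sample_measurable simp: A_def)
  have copy: "is_copy_of M (xi1 0 t) \<xi>\<^sub>1" "k < 2 \<Longrightarrow> is_copy_of M (xi2 k t) \<xi>\<^sub>2"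
    "k < 2 \<Longrightarrow> is_copy_of M (zeta1 k t) \<zeta>\<^sub>1" "k < 3 \<Longrightarrow> is_copy_of M (zeta2 k t) \<zeta>\<^sub>2" if "t < N" for t k
    using idx[OF that] samples unfolding independent_copies_def I_def
    by (auto dest: bspec[of _ _ "Xi1 0 t"] bspec[of _ _ "Xi2 k t"] bspec[of _ _ "Zeta1 k t"] bspec[of _ _ "Zeta2 k t"])

  \<comment> \<open>Equality in law transfers the oracle hypotheses to the individual samples.\<close>
  have mom: "second_moment_le M (\<lambda>\<omega>. f2s u (\<xi>\<^sub>2 \<omega>) - f2 u) (\<sigma>f2^2)" if "u \<in> X" for u
    using f2_var[rule_format, OF that] by (auto simp: second_moment_le_def has_bochner_integral_iff)
  note sec = oracles[THEN jointly_measurable_section]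
  have f2o: "has_bochner_integral M (\<lambda>\<omega>. f2s u (xi2 k t \<omega>)) (f2 u)"
      "u \<in> X \<Longrightarrow> second_moment_le M (\<lambda>\<omega>. f2s u (xi2 k t \<omega>) - f2 u) (\<sigma>f2^2)"
      "u \<in> X \<Longrightarrow> \<exists>D \<in> vec_subdiff f2 u. has_bochner_integral M (\<lambda>\<omega>. df2s u (xi2 k t \<omega>)) D"
      "u \<in> X \<Longrightarrow> second_moment_le M (\<lambda>\<omega>. df2s u (xi2 k t \<omega>)) (Cf2^2)" if "t < N" "k < 2" for u t k
    using is_copy_of_has_bochner_integral[OF copy(2)[OF that] rv(2) sec(3) f2_mean[rule_format]]
      is_copy_of_second_moment_le[OF copy(2)[OF that] rv(2) borel_measurable_diff[OF sec(3) borel_measurable_const] mom]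
      is_copy_of_has_bochner_integral[OF copy(2)[OF that] rv(2) sec(4)] df2_mean
      is_copy_of_second_moment_le[OF copy(2)[OF that] rv(2) sec(4)] df2_moment
    by blast+
  have g2o: "has_bochner_integral M (\<lambda>\<omega>. g2s u (zeta2 k t \<omega>)) (g2 u)"
      "u \<in> X \<Longrightarrow> second_moment_le M (\<lambda>\<omega>. g2s u (zeta2 k t \<omega>) - g2 u) (\<sigma>g2^2)"
      "u \<in> X \<Longrightarrow> \<exists>D \<in> vec_subdiff g2 u. has_bochner_integral M (\<lambda>\<omega>. dg2s u (zeta2 k t \<omega>)) D"
      "u \<in> X \<Longrightarrow> second_moment_le M (\<lambda>\<omega>. dg2s u (zeta2 k t \<omega>)) (Cg2^2)" if "t < N" "k < 3" for u t k
    using is_copy_of_has_bochner_integral[OF copy(4)[OF that] rv(4) sec(7) g2_mean[rule_format]]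
      is_copy_of_second_moment_le[OF copy(4)[OF that] rv(4) borel_measurable_diff[OF sec(7) borel_measurable_const]
        g2_var[rule_format]]
      is_copy_of_has_bochner_integral[OF copy(4)[OF that] rv(4) sec(8)] dg2_mean
      is_copy_of_second_moment_le[OF copy(4)[OF that] rv(4) sec(8)] dg2_moment
    by blast+
  have f1o: "has_bochner_integral M (\<lambda>\<omega>. df1s u (xi1 0 t \<omega>)) (df1 u)"
      "second_moment_le M (\<lambda>\<omega>. df1s u (xi1 0 t \<omega>)) (Cf1^2)" if "t < N" for u t
    using is_copy_of_has_bochner_integral[OF copy(1)[OF that] rv(1) sec(2) df1_mean[rule_format]]
      is_copy_of_second_moment_le[OF copy(1)[OF that] rv(1) sec(2) df1_moment[rule_format]] .
  have g1o: "has_bochner_integral M (\<lambda>\<omega>. g1s u (zeta1 k t \<omega>)) (g1 u)"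
      "second_moment_le M (\<lambda>\<omega>. g1s u (zeta1 k t \<omega>) - g1 u) (\<sigma>g1^2)"
      "has_bochner_integral M (\<lambda>\<omega>. dg1s u (zeta1 k t \<omega>)) (dg1 u)"
      "second_moment_le M (\<lambda>\<omega>. dg1s u (zeta1 k t \<omega>)) (Cg1^2)" if "t < N" "k < 2" for u t k
    using is_copy_of_has_bochner_integral[OF copy(3)[OF that] rv(3) sec(5) g1_mean[rule_format]]
      is_copy_of_second_moment_le[OF copy(3)[OF that] rv(3) borel_measurable_diff[OF sec(5) borel_measurable_const]
        g1_var[rule_format]]
      is_copy_of_has_bochner_integral[OF copy(3)[OF that] rv(3) sec(6) dg1_mean[rule_format]]
      is_copy_of_second_moment_le[OF copy(3)[OF that] rv(3) sec(6) dg1_moment[rule_format]] .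

  have df1_le: "norm (df1 u) \<le> Cf1" for u
    using mean_norm_le[OF df1_mean[rule_format] df1_moment[rule_format]] positive by simp
  have dg1_le: "norm (dg1 u) \<le> Cg1" for u
    using mean_norm_le[OF dg1_mean[rule_format] dg1_moment[rule_format]] positive by simp
  have sg_f: "\<exists>D \<in> vec_subdiff f2 u. norm D \<le> Cf2" if "u \<in> X" for u
    using df2_mean[rule_format, OF that] mean_norm_le[OF _ df2_moment[rule_format, OF that]] positive
    by (meson less_imp_le)
  have sg_g: "\<exists>D \<in> vec_subdiff g2 u. norm D \<le> Cg2" if "u \<in> X" for u
    using dg2_mean[rule_format, OF that] mean_norm_le[OF _ dg2_moment[rule_format, OF that]] positive
    by (meson less_imp_le)
  have layer_f: "composite_layer X f2 f1 (\<lambda>y d. df1 y \<bullet> d) (\<lambda>y l. l *\<^sub>R df1 y) Cf1 Cf2 Lf1"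
    by (rule composite_layer_scalar)
       (use X positive f1_convex f1_grad df1_le df1_lipschitz sg_f f2_convex f_mono in auto)
  have layer_g: "composite_layer X g2 g1 (\<lambda>z d. transpose (dg1 z) *v d) (\<lambda>z l. dg1 z *v l) Cg1 Cg2 Lg1"
    by (rule composite_layer_vector)
       (use X positive g1_convex g1_grad dg1_le dg1_lipschitz sg_g g2_convex g_mono in auto)
  have df1_meas: "df1 \<in> borel_measurable borel" and dg1_meas: "dg1 \<in> borel_measurable borel"
    using df1_lipschitz dg1_lipschitz
    by (auto intro!: borel_measurable_continuous_onI lipschitz_on_continuous_on)
  have f2_meas: "f2 \<in> borel_measurable borel" and g2_meas: "g2 \<in> borel_measurable borel"
    using f2_convex g2_convex
    by (auto intro!: borel_measurable_continuous_onI convex_components_continuous)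
  note comp_meas = measurable_compose[OF _ df1_meas] measurable_compose[OF _ dg1_meas]
    measurable_compose[OF _ f2_meas] measurable_compose[OF _ g2_meas]
  interpret stochastic_program X f2 f1 "\<lambda>y d. df1 y \<bullet> d" "\<lambda>y l. l *\<^sub>R df1 y" Cf1 Cf2 Lf1
      g2 g1 "\<lambda>z d. transpose (dg1 z) *v d" "\<lambda>z l. dg1 z *v l" Cg1 Cg2 Lg1 M A I
  proof -
    interpret f: composite_layer X f2 f1 "\<lambda>y d. df1 y \<bullet> d" "\<lambda>y l. l *\<^sub>R df1 y" Cf1 Cf2 Lf1 by (rule layer_f)
    interpret g: composite_layer X g2 g1 "\<lambda>z d. transpose (dg1 z) *v d" "\<lambda>z l. dg1 z *v l" Cg1 Cg2 Lg1
      by (rule layer_g)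
    show "stochastic_program X f2 f1 (\<lambda>y d. df1 y \<bullet> d) (\<lambda>y l. l *\<^sub>R df1 y) Cf1 Cf2 Lf1
      g2 g1 (\<lambda>z d. transpose (dg1 z) *v d) (\<lambda>z l. dg1 z *v l) Cg1 Cg2 Lg1 M A I"
    proof
      fix K :: "'w measure"
      show "(\<lambda>\<omega>. df1 (a \<omega>) \<bullet> b \<omega>) \<in> borel_measurable K"
        if "a \<in> borel_measurable K" "b \<in> borel_measurable K" for a b
        using comp_meas(1)[OF that(1)] that(2) by measurable
      show "(\<lambda>\<omega>. b \<omega> *\<^sub>R df1 (a \<omega>)) \<in> borel_measurable K"
        if "a \<in> borel_measurable K" "b \<in> borel_measurable K" for a b
        using comp_meas(1)[OF that(1)] that(2) by measurable
      show "(\<lambda>\<omega>. transpose (dg1 (a \<omega>)) *v b \<omega>) \<in> borel_measurable K"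
        if "a \<in> borel_measurable K" "b \<in> borel_measurable K" for a b
        using comp_meas(2)[OF that(1)] that(2) by measurable
      show "(\<lambda>\<omega>. dg1 (a \<omega>) *v b \<omega>) \<in> borel_measurable K"
        if "a \<in> borel_measurable K" "b \<in> borel_measurable K" for a b
        using comp_meas(2)[OF that(1)] that(2) by measurable
    qed
  qed
  note g1_meas = g.Phi_measurable

  have xX: "x t \<omega> \<in> X" if "t \<le> N" for t \<omega>
  proof (cases t)
    case 0 thus ?thesis using init x0 by simp
  next
    case (Suc s)
    thus ?thesis using that x_step x0 X(1) by (auto intro!: closest_point_in_set)
  qed
  have proj_meas: "closest_point X \<in> borel_measurable borel"
    using continuous_on_closest_point[OF X(2,1), of UNIV] x0 by (intro borel_measurable_continuous_onI) auto
  have pos_meas: "(pos_part :: real^'m \<Rightarrow> _) \<in> borel_measurable borel"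
    by (intro borel_measurable_continuous_onI continuous_pos_part)
  define w where "w t \<omega> = df2s (x t \<omega>) (xi2 0 t \<omega>) *v df1s (y (Suc t) \<omega>) (xi1 0 t \<omega>) +
      dg2s (x t \<omega>) (zeta2 0 t \<omega>) *v (dg1s (z (Suc t) \<omega>) (zeta1 0 t \<omega>) *v lam t \<omega>)" for t \<omega>
  have y_meas: "y (Suc t) \<in> borel_measurable (hist (full t))"
    if "t < N" "x t \<in> borel_measurable (hist (past t))" "y t \<in> borel_measurable (hist (past t))" for t
  proof -
    have [measurable]: "(\<lambda>\<omega>. f2s (x t \<omega>) (xi2 1 t \<omega>)) \<in> borel_measurable (hist (full t))"
      by (rule oracle_hist_measurable[OF oracles(3) that(2) sample(2)[OF that(1)] sub(4)[OF that(1)] _ sub(2)[OF that(1)]])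
        (auto simp: full_def)
    note [measurable] = hist_mono[OF that(3) sub(4)[OF that(1)] sub(2)[OF that(1)]]
    have "y (Suc t) = (\<lambda>\<omega>. (1 / (1 + \<tau> t)) *\<^sub>R (f2s (x t \<omega>) (xi2 1 t \<omega>) + \<tau> t *\<^sub>R y t \<omega>))"
      using y_step that(1) by auto
    also have "\<dots> \<in> borel_measurable (hist (full t))" by measurable
    finally show ?thesis .
  qed
  have z_meas: "z (Suc t) \<in> borel_measurable (hist (half t))"
    if "t < N" "x t \<in> borel_measurable (hist (past t))" "z t \<in> borel_measurable (hist (past t))" for t
  proof -
    have [measurable]: "(\<lambda>\<omega>. g2s (x t \<omega>) (zeta2 1 t \<omega>)) \<in> borel_measurable (hist (half t))"
      by (rule oracle_hist_measurable[OF oracles(7) that(2) sample(4)[OF that(1)] sub(3)[OF that(1)] _ sub(1)[OF that(1)]])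
        (auto simp: half_def)
    note [measurable] = hist_mono[OF that(3) sub(3)[OF that(1)] sub(1)[OF that(1)]]
    have "z (Suc t) = (\<lambda>\<omega>. (1 / (1 + \<rho> t)) *\<^sub>R (g2s (x t \<omega>) (zeta2 1 t \<omega>) + \<rho> t *\<^sub>R z t \<omega>))"
      using z_step that(1) by auto
    also have "\<dots> \<in> borel_measurable (hist (half t))" by measurable
    finally show ?thesis .
  qed
  have xwH_meas: "w t \<in> borel_measurable (hist (past (Suc t)))" "H (Suc t) \<in> borel_measurable (hist (past (Suc t)))"
    if t: "t < N" and m: "x t \<in> borel_measurable (hist (past t))" "y t \<in> borel_measurable (hist (past t))"
      "z t \<in> borel_measurable (hist (past t))" "lam t \<in> borel_measurable (hist (past t))" for t
  proof -
    let ?P = "past (Suc t)"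
    note yS = y_meas[OF t m(1,2)] and zS = z_meas[OF t m(1,3)]
    have pp: "past t \<subseteq> ?P" by (rule past_mono) simp
    note [measurable] = hist_mono[OF yS sub(6)[OF t] past_I] hist_mono[OF zS sub(7)[OF t] past_I]
      hist_mono[OF m(4) pp past_I]
      oracle_hist_measurable[OF oracles(4) m(1) sample(2)[OF t] pp sub1(2)[OF t] past_I, of 0, simplified]
      oracle_hist_measurable[OF oracles(2) yS sample(1)[OF t] sub(6)[OF t] sub1(1)[OF t] past_I]
      oracle_hist_measurable[OF oracles(8) m(1) sample(4)[OF t] pp sub1(4)[OF t] past_I, of 0, simplified]
      oracle_hist_measurable[OF oracles(6) zS sample(3)[OF t] sub(7)[OF t] sub1(3)[OF t] past_I, of 0, simplified]
      oracle_hist_measurable[OF oracles(6) zS sample(3)[OF t] sub(7)[OF t] sub1(3)[OF t] past_I, of 1, simplified]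
      oracle_hist_measurable[OF oracles(5) zS sample(3)[OF t] sub(7)[OF t] sub1(3)[OF t] past_I, of 1, simplified]
      oracle_hist_measurable[OF oracles(7) m(1) sample(4)[OF t] pp sub1(4)[OF t] past_I, of 2, simplified]
    show "w t \<in> borel_measurable (hist ?P)" unfolding w_def by measurable
    have "H (Suc t) = (\<lambda>\<omega>. g1s (z (Suc t) \<omega>) (zeta1 1 t \<omega>)
                   - transpose (dg1s (z (Suc t) \<omega>) (zeta1 1 t \<omega>)) *v z (Suc t) \<omega>
                   + transpose (dg1s (z (Suc t) \<omega>) (zeta1 1 t \<omega>)) *v g2s (x t \<omega>) (zeta2 2 t \<omega>))"
      using H_step t by auto
    also have "\<dots> \<in> borel_measurable (hist ?P)" unfolding One_nat_def by measurable
    finally show "H (Suc t) \<in> borel_measurable (hist ?P)" .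
  qed
  have x_step': "x (Suc t) \<omega> = closest_point X (x t \<omega> - (1 / \<eta> t) *\<^sub>R w t \<omega>)" if "t < N" for t \<omega>
    using x_step that by (simp add: w_def)
  have state: "x t \<in> borel_measurable (hist (past t)) \<and> y t \<in> borel_measurable (hist (past t)) \<and>
      z t \<in> borel_measurable (hist (past t)) \<and> lam t \<in> borel_measurable (hist (past t))" if "t \<le> N" for t
    using that
  proof (induction t)
    case 0
    have "x 0 = (\<lambda>_. x0)" "y 0 = (\<lambda>_. 0)" "z 0 = (\<lambda>_. 0)" "lam 0 = (\<lambda>_. lam0)" using init by auto
    thus ?case by simp
  next
    case (Suc t)
    hence t: "t < N" and m: "x t \<in> borel_measurable (hist (past t))" "y t \<in> borel_measurable (hist (past t))"
      "z t \<in> borel_measurable (hist (past t))" "lam t \<in> borel_measurable (hist (past t))" by auto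
    have pp: "past t \<subseteq> past (Suc t)" by (rule past_mono) simp
    note [measurable] = xwH_meas[OF t m] hist_mono[OF m(4) pp past_I] hist_mono[OF m(1) pp past_I]
    have "x (Suc t) = (\<lambda>\<omega>. closest_point X (x t \<omega> - (1 / \<eta> t) *\<^sub>R w t \<omega>))" using x_step'[OF t] by auto
    moreover have "(\<lambda>\<omega>. closest_point X (x t \<omega> - (1 / \<eta> t) *\<^sub>R w t \<omega>)) \<in> borel_measurable (hist (past (Suc t)))"
      by (rule measurable_compose[OF _ proj_meas]) measurable
    moreover have "lam (Suc t) = (\<lambda>\<omega>. pos_part (lam t \<omega> + (1 / \<alpha> t) *\<^sub>R H (Suc t) \<omega>))" using lam_step t by auto
    moreover have "(\<lambda>\<omega>. pos_part (lam t \<omega> + (1 / \<alpha> t) *\<^sub>R H (Suc t) \<omega>)) \<in> borel_measurable (hist (past (Suc t)))"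
      by (rule measurable_compose[OF _ pos_meas]) measurable
    ultimately show ?case
      using hist_mono[OF y_meas[OF t m(1,2)] sub(6)[OF t] past_I] hist_mono[OF z_meas[OF t m(1,3)] sub(7)[OF t] past_I]
      by simp
  qed
  have xm: "x t \<in> borel_measurable (hist (past t))" and ym: "y t \<in> borel_measurable (hist (past t))"
    and zm: "z t \<in> borel_measurable (hist (past t))" and lm: "lam t \<in> borel_measurable (hist (past t))" if "t \<le> N" for t
    using state[OF that] by auto
  have yS: "y (Suc t) \<in> borel_measurable (hist (full t))" and zS: "z (Suc t) \<in> borel_measurable (hist (half t))"
    and HS: "H (Suc t) \<in> borel_measurable (hist (past (Suc t)))" if "t < N" for t
    using y_meas z_meas xwH_meas(2) that xm[of t] ym[of t] zm[of t] lm[of t] by auto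
  have toM: "k \<in> borel_measurable M" if "k \<in> borel_measurable (hist (past t))" for k :: "'w \<Rightarrow> 'v::topological_space" and t
    by (rule hist_measurable[OF that past_I])

  define \<epsilon>f where "\<epsilon>f t \<omega> = f2s (x t \<omega>) (xi2 1 t \<omega>) - f2 (x t \<omega>)" for t \<omega>
  define \<epsilon>g where "\<epsilon>g t \<omega> = g2s (x t \<omega>) (zeta2 1 t \<omega>) - g2 (x t \<omega>)" for t \<omega>
  have ef: "uncorrelated (past t) (\<epsilon>f t)" "expectation (\<lambda>\<omega>. (norm (\<epsilon>f t \<omega>))^2) \<le> \<sigma>f2^2" if t: "t < N" for t
  proof -
    show "uncorrelated (past t) (\<epsilon>f t)" unfolding \<epsilon>f_def
      by (rule value_noise(1)[OF past_I fresh(1)[OF t] sample(2)[OF t] oracles(3) f2_meas xm xX f2o(1)[OF t] f2o(2)[OF t]])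
         (use t in auto)
    show "expectation (\<lambda>\<omega>. (norm (\<epsilon>f t \<omega>))^2) \<le> \<sigma>f2^2" unfolding \<epsilon>f_def
      by (rule value_noise(2)[OF past_I fresh(1)[OF t] sample(2)[OF t] oracles(3) f2_meas xm xX f2o(1)[OF t] f2o(2)[OF t]])
         (use t in auto)
  qed
  have eg: "uncorrelated (past t) (\<epsilon>g t)" "expectation (\<lambda>\<omega>. (norm (\<epsilon>g t \<omega>))^2) \<le> \<sigma>g2^2" if t: "t < N" for t
  proof -
    show "uncorrelated (past t) (\<epsilon>g t)" unfolding \<epsilon>g_def
      by (rule value_noise(1)[OF past_I fresh(2)[OF t] sample(4)[OF t] oracles(7) g2_meas xm xX g2o(1)[OF t] g2o(2)[OF t]])
         (use t in auto)
    show "expectation (\<lambda>\<omega>. (norm (\<epsilon>g t \<omega>))^2) \<le> \<sigma>g2^2" unfolding \<epsilon>g_def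
      by (rule value_noise(2)[OF past_I fresh(2)[OF t] sample(4)[OF t] oracles(7) g2_meas xm xX g2o(1)[OF t] g2o(2)[OF t]])
         (use t in auto)
  qed
  have efm: "\<epsilon>f s \<in> borel_measurable (hist (past t))" and egm: "\<epsilon>g s \<in> borel_measurable (hist (past t))"
    if st: "s < t" "t < N" for s t
  proof -
    have s: "s < N" and p: "past (Suc s) \<subseteq> past t" using st past_mono[of "Suc s" t] by simp_all
    have pp: "past s \<subseteq> past (Suc s)" by (rule past_mono) simp
    have xs: "x s \<in> borel_measurable (hist (past s))" using xm s by simp
    note [measurable] = hist_mono[OF xs pp past_I] comp_meas
      oracle_hist_measurable[OF oracles(3) xs sample(2)[OF s] pp sub1(2)[OF s] past_I, of 1, simplified]
      oracle_hist_measurable[OF oracles(7) xs sample(4)[OF s] pp sub1(4)[OF s] past_I, of 1, simplified]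
    have "\<epsilon>f s \<in> borel_measurable (hist (past (Suc s)))" unfolding \<epsilon>f_def One_nat_def by measurable
    thus "\<epsilon>f s \<in> borel_measurable (hist (past t))" by (rule hist_mono[OF _ p past_I])
    have "\<epsilon>g s \<in> borel_measurable (hist (past (Suc s)))" unfolding \<epsilon>g_def One_nat_def by measurable
    thus "\<epsilon>g s \<in> borel_measurable (hist (past t))" by (rule hist_mono[OF _ p past_I])
  qed
  have f2_bd: "norm (f2 (x t \<omega>) - f2 xstar) \<le> sqrt 2 * Cf2 * DX"
    and g2_bd: "norm (g2 (x t \<omega>) - g2 xstar) \<le> sqrt 2 * Cg2 * DX" if "t \<le> N" for t \<omega>
  proof -
    have d: "norm (x t \<omega> - xstar) \<le> DX" using diam xX[OF that] by blast
    show "norm (f2 (x t \<omega>) - f2 xstar) \<le> sqrt 2 * Cf2 * DX"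
      by (rule order_trans[OF f.h_lipschitz[OF xX[OF that] xstar]]) (use d positive in \<open>auto intro!: mult_left_mono\<close>)
    show "norm (g2 (x t \<omega>) - g2 xstar) \<le> sqrt 2 * Cg2 * DX"
      by (rule order_trans[OF g.h_lipschitz[OF xX[OF that] xstar]]) (use d positive in \<open>auto intro!: mult_left_mono\<close>)
  qed
  have f2sq: "square_integrable (\<lambda>\<omega>. f2 (x t \<omega>))" and g2sq: "square_integrable (\<lambda>\<omega>. g2 (x t \<omega>))" if "t \<le> N" for t
  proof -
    note [measurable] = toM[OF xm[OF that]] comp_meas
    have "square_integrable (\<lambda>\<omega>. f2 (x t \<omega>) - f2 xstar)"
      by (rule square_integrable_bounded[OF _ f2_bd[OF that]]) measurable
    from square_integrable_add[OF this square_integrable_const[of "f2 xstar"]]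
    show "square_integrable (\<lambda>\<omega>. f2 (x t \<omega>))" by simp
    have "square_integrable (\<lambda>\<omega>. g2 (x t \<omega>) - g2 xstar)"
      by (rule square_integrable_bounded[OF _ g2_bd[OF that]]) measurable
    from square_integrable_add[OF this square_integrable_const[of "g2 xstar"]]
    show "square_integrable (\<lambda>\<omega>. g2 (x t \<omega>))" by simp
  qed
  have y_rec: "y (Suc t) \<omega> = f.damped t (f2 (x t \<omega>) + \<epsilon>f t \<omega>) (y t \<omega>)"
    and z_rec: "z (Suc t) \<omega> = g.damped t (g2 (x t \<omega>) + \<epsilon>g t \<omega>) (z t \<omega>)" if "t < N" for t \<omega>
    using y_step z_step steps that by (auto simp: f.damped_def g.damped_def \<epsilon>f_def \<epsilon>g_def)
  have zsq: "square_integrable (z t)" if "t \<le> N" for t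
    using that
  proof (induction t)
    case 0
    have "z 0 = (\<lambda>_. 0)" using init by auto
    thus ?case by simp
  next
    case (Suc t)
    have "z (Suc t) = (\<lambda>\<omega>. (1 / (1 + real t / 2)) *\<^sub>R ((g2 (x t \<omega>) + \<epsilon>g t \<omega>) + (real t / 2) *\<^sub>R z t \<omega>))"
      using z_rec Suc by (auto simp: g.damped_def)
    thus ?case using Suc uncorrelatedD(1)[OF eg(1)]
      by (auto intro!: square_integrable_scaleR square_integrable_add g2sq)
  qed

  define \<delta> where "\<delta> t \<omega> = H (Suc t) \<omega> - g.lin (z (Suc t) \<omega>) (g2 (x t \<omega>))" for t \<omega>
  have linsq: "square_integrable (\<lambda>\<omega>. g.lin (z (Suc t) \<omega>) (g2 (x t \<omega>)))" if "t < N" for t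
    using that by (intro g.lin_square_integrable zsq g2sq) auto
  have linm: "(\<lambda>\<omega>. g.lin (z (Suc t) \<omega>) (g2 (x t \<omega>))) \<in> borel_measurable (hist (half t))" if t: "t < N" for t
  proof -
    note zh = zS[OF t] and xh = hist_mono[OF xm[OF less_imp_le[OF t]] sub(3)[OF t] sub(1)[OF t]]
    note [measurable] = zh comp_meas(2)[OF zh] comp_meas(4)[OF xh] measurable_compose[OF zh g1_meas]
    show ?thesis unfolding g.lin_def by measurable
  qed
  have du: "uncorrelated (half t) (\<delta> t)" if t: "t < N" for t
  proof -
    note xh = hist_mono[OF xm[OF less_imp_le[OF t]] sub(3)[OF t] sub(1)[OF t]]
    have un: "uncorrelated (half t) (\<lambda>\<omega>. g2s (x t \<omega>) (zeta2 2 t \<omega>) - g2 (x t \<omega>))"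
      by (rule value_noise(1)[OF sub(1)[OF t] fresh(4)[OF t] sample(4)[OF t] oracles(7) g2_meas xh xX g2o(1)[OF t] g2o(2)[OF t]])
         (use t in auto)
    have um: "(\<lambda>\<omega>. g2s (x t \<omega>) (zeta2 2 t \<omega>)) \<in> borel_measurable (hist (insert (Zeta2 2 t) (half t)))"
      by (rule oracle_hist_measurable[OF oracles(7) xh sample(4)[OF t]]) (use sub(1)[OF t] fresh(4)[OF t] in auto)
    have eq: "\<delta> t = (\<lambda>\<omega>. (g1s (z (Suc t) \<omega>) (zeta1 1 t \<omega>) - transpose (dg1s (z (Suc t) \<omega>) (zeta1 1 t \<omega>)) *v z (Suc t) \<omega>
            + transpose (dg1s (z (Suc t) \<omega>) (zeta1 1 t \<omega>)) *v g2s (x t \<omega>) (zeta2 2 t \<omega>))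
          - (g1 (z (Suc t) \<omega>) + transpose (dg1 (z (Suc t) \<omega>)) *v (g2 (x t \<omega>) - z (Suc t) \<omega>)))"
      using H_step t by (auto simp: \<delta>_def g.lin_def simp del: transpose_matrix_vector)
    show ?thesis unfolding eq
      by (rule linearized_value_oracle[OF sub(1)[OF t] fresh(3)[OF t] fresh(4)[OF t] _ sample(3)[OF t] oracles(5,6)
            g1_meas dg1_meas g1o[OF t] _ _ zsq zS[OF t] g2sq measurable_compose[OF xh g2_meas] un um])
         (use t positive in auto)
  qed
  have dm: "\<delta> s \<in> borel_measurable (hist (half t))" if st: "s < t" "t < N" for s t
  proof -
    have s: "s < N" using st by simp
    note [measurable] = HS[OF s] hist_mono[OF linm[OF s] sub(7)[OF s] past_I]
    have "\<delta> s \<in> borel_measurable (hist (past (Suc s)))" unfolding \<delta>_def by measurable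
    moreover have "past (Suc s) \<subseteq> half t" using past_mono[of "Suc s" t] sub(3)[OF st(2)] st by auto
    ultimately show ?thesis by (rule hist_mono[OF _ _ sub(1)[OF st(2)]])
  qed
  \<comment> \<open>The conditional mean of \<open>H\<close> given \<open>x\<close>, \<open>v1\<close> and \<open>v2\<close> is measurable for \<open>half t\<close>, because \<open>v1\<close> and \<open>v2\<close> are
    functions of \<open>z (Suc t)\<close> and \<open>x t\<close>; so the variance bound applies by minimality.\<close>
  have dv: "expectation (\<lambda>\<omega>. (norm (\<delta> t \<omega>))^2) \<le> \<sigma>H^2" if t: "t < N" for t
  proof -
    have xh: "x t \<in> borel_measurable (hist (half t))"
      using hist_mono[OF xm[OF less_imp_le[OF t]] sub(3)[OF t] sub(1)[OF t]] .
    have St: "Suc t \<in> {1..N}" using t by simp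
    have v1h: "v1 (Suc t) \<in> borel_measurable (hist (half t))"
    proof -
      have "v1 (Suc t) = (\<lambda>\<omega>. dg1 (z (Suc t) \<omega>))" using v1 St by blast
      thus ?thesis using comp_meas(2)[OF zS[OF t]] by simp
    qed
    have v2h: "v2 (Suc t) \<in> borel_measurable (hist (half t))"
    proof (rule measurable_from_subalg[OF generated_algebra_subalgebra[OF xh]])
      show "v2 (Suc t) \<in> borel_measurable (generated_algebra M (x t))"
        using v2[rule_format, OF St] by simp
    qed
    let ?Y = "\<lambda>\<omega>. (x t \<omega>, v1 (Suc t) \<omega>, v2 (Suc t) \<omega>)"
    have Yh: "?Y \<in> borel_measurable (hist (half t))" by (intro borel_measurable_Pair xh v1h v2h)
    have YM: "?Y \<in> borel_measurable M" by (rule hist_measurable[OF Yh sub(1)[OF t]])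
    note cv = conditional_variance_integral[OF YM toM[OF HS[OF t]] \<sigma>H[rule_format, OF St, unfolded diff_Suc_1]]
    show ?thesis unfolding \<delta>_def
      by (rule conditional_variance_minimal[OF du[OF t, unfolded \<delta>_def] sub(1)[OF t] linsq[OF t] linm[OF t]
            measurable_from_subalg[OF generated_algebra_subalgebra[OF Yh] cv(1)] cv(2)]) simp
  qed
  have lsq: "square_integrable (lam t)" if "t \<le> N" for t
    using that
  proof (induction t)
    case 0
    have "lam 0 = (\<lambda>_. lam0)" using init by auto
    thus ?case by simp
  next
    case (Suc t)
    hence t: "t < N" by simp
    have "square_integrable (\<lambda>\<omega>. \<delta> t \<omega> + g.lin (z (Suc t) \<omega>) (g2 (x t \<omega>)))"
      by (intro square_integrable_add linsq t uncorrelatedD(1)[OF du[OF t]])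
    hence "square_integrable (H (Suc t))" by (simp add: \<delta>_def)
    hence v: "square_integrable (\<lambda>\<omega>. lam t \<omega> + (1 / \<alpha> t) *\<^sub>R H (Suc t) \<omega>)"
      using Suc by (intro square_integrable_add square_integrable_scaleR) auto
    show ?case
      by (rule square_integrable_mono[OF v toM[OF lm[OF Suc.prems]], of 1])
         (use lam_step t norm_pos_part_le in auto)
  qed

  define pF where "pF t \<omega> = df2s (x t \<omega>) (xi2 0 t \<omega>) *v df1s (y (Suc t) \<omega>) (xi1 0 t \<omega>)" for t \<omega>
  define pG where "pG t \<omega> = dg2s (x t \<omega>) (zeta2 0 t \<omega>) *v (dg1s (z (Suc t) \<omega>) (zeta1 0 t \<omega>) *v lam t \<omega>)" for t \<omega>
  have w_eq: "w t \<omega> = pF t \<omega> + pG t \<omega>" for t \<omega> by (simp add: w_def pF_def pG_def)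
  have dX: "norm (x t \<omega> - xstar) \<le> DX" if "t \<le> N" for t \<omega> using diam xX[OF that] by blast
  have pF: "square_integrable (pF t)" "expectation (\<lambda>\<omega>. (norm (pF t \<omega>))^2) \<le> (Cf1 * Cf2)^2"
      "expectation (\<lambda>\<omega>. df1 (y (Suc t) \<omega>) \<bullet> (f2 (x t \<omega>) - f2 xstar)) \<le> expectation (\<lambda>\<omega>. pF t \<omega> \<bullet> (x t \<omega> - xstar))"
      "square_integrable (\<lambda>\<omega>. df1 (y (Suc t) \<omega>))"
    if t: "t < N" for t
  proof -
    have tN: "t \<le> N" using t by simp
    note xf = hist_mono[OF xm[OF tN] sub(4)[OF t] sub(2)[OF t]]
    have Rb: "(\<lambda>\<omega>. df1 (y (Suc t) \<omega>)) \<in> borel_measurable (hist (full t))" by (rule comp_meas(1)[OF yS[OF t]])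
    show Rsq: "square_integrable (\<lambda>\<omega>. df1 (y (Suc t) \<omega>))"
      by (rule square_integrable_bounded[OF hist_measurable[OF Rb sub(2)[OF t]] df1_le])
    have le: "(norm (df1 u))^2 \<le> Cf1^2" for u using df1_le by (intro power_mono) auto
    have mono: "affine_map f2 \<or> 0 \<le> df1 u" for u using f_mono by blast
    note G = composite_gradient_oracle[where J = "full t" and ?i1.0 = "Xi1 0 t" and ?i2.0 = "Xi2 0 t"
        and ?S1.0 = "xi1 0 t" and ?S2.0 = "xi2 0 t" and P = df2s and U = X and h = f2 and C = Cf2 and xt = "x t"
        and v = xstar and D = DX and Rv = "\<lambda>\<omega> s. df1s (y (Suc t) \<omega>) s" and Rb = "\<lambda>\<omega>. df1 (y (Suc t) \<omega>)"
        and \<kappa> = "\<lambda>_. Cf1^2" and B = "sqrt 2 * Cf2 * DX",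
        OF sub(2)[OF t] fresh(5)[OF t] fresh(6)[OF t] _ sample(1)[OF t] sample(2)[OF t] oracles(4)
          f2o(3)[OF t] f2o(4)[OF t] xf xX[OF tN] dX[OF tN] oracle_pair_measurable[OF oracles(2) yS[OF t]] f1o(1)[OF t]
          second_moment_leD[OF f1o(2)[OF t]] Rsq Rb mono le _ _ f2_meas f2_bd[OF tN], simplified]
    show "square_integrable (pF t)"
      "expectation (\<lambda>\<omega>. df1 (y (Suc t) \<omega>) \<bullet> (f2 (x t \<omega>) - f2 xstar)) \<le> expectation (\<lambda>\<omega>. pF t \<omega> \<bullet> (x t \<omega> - xstar))"
      "expectation (\<lambda>\<omega>. (norm (pF t \<omega>))^2) \<le> (Cf1 * Cf2)^2"
      using G unfolding pF_def by (simp_all add: prob_space power_mult_distrib mult.commute)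
  qed
  have pG: "square_integrable (pG t)"
      "expectation (\<lambda>\<omega>. (norm (pG t \<omega>))^2) \<le> (Cg1 * Cg2)^2 * expectation (\<lambda>\<omega>. (norm (lam t \<omega>))^2)"
      "expectation (\<lambda>\<omega>. (dg1 (z (Suc t) \<omega>) *v lam t \<omega>) \<bullet> (g2 (x t \<omega>) - g2 xstar)) \<le> expectation (\<lambda>\<omega>. pG t \<omega> \<bullet> (x t \<omega> - xstar))"
      "square_integrable (\<lambda>\<omega>. dg1 (z (Suc t) \<omega>) *v lam t \<omega>)"
    if t: "t < N" for t
  proof -
    have tN: "t \<le> N" using t by simp
    note xf = hist_mono[OF xm[OF tN] sub(4)[OF t] sub(2)[OF t]]
    note zf = hist_mono[OF zS[OF t] sub(5)[OF t] sub(2)[OF t]]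
    note lf = hist_mono[OF lm[OF tN] sub(4)[OF t] sub(2)[OF t]]
    note [measurable] = lf zf comp_meas(2)[OF zf] oracle_pair_measurable[OF oracles(6) zf]
    have Rb: "(\<lambda>\<omega>. dg1 (z (Suc t) \<omega>) *v lam t \<omega>) \<in> borel_measurable (hist (full t))" by measurable
    have Rv: "(\<lambda>(\<omega>, s). dg1s (z (Suc t) \<omega>) s *v lam t \<omega>) \<in> borel_measurable (hist (full t) \<Otimes>\<^sub>M borel)"
      by measurable
    show Rsq: "square_integrable (\<lambda>\<omega>. dg1 (z (Suc t) \<omega>) *v lam t \<omega>)"
      by (rule square_integrable_mono[OF lsq[OF tN] hist_measurable[OF Rb sub(2)[OF t]] g.adj_bound])
    have le: "(norm (dg1 (z (Suc t) \<omega>) *v lam t \<omega>))^2 \<le> Cg1^2 * (norm (lam t \<omega>))^2" for \<omega>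
      unfolding power_mult_distrib[symmetric] by (intro power_mono g.adj_bound) auto
    have l0: "0 \<le> lam t \<omega>" for \<omega>
    proof (cases t)
      case 0 thus ?thesis using init lam0 by simp
    next
      case (Suc s) thus ?thesis using lam_step tN by (auto intro: pos_part_nonneg)
    qed
    have mono: "affine_map g2 \<or> 0 \<le> dg1 (z (Suc t) \<omega>) *v lam t \<omega>" for \<omega> by (rule g.monotone[OF l0])
    have mean: "has_bochner_integral M (\<lambda>\<omega>'. dg1s (z (Suc t) \<omega>) (zeta1 0 t \<omega>') *v lam t \<omega>)
        (dg1 (z (Suc t) \<omega>) *v lam t \<omega>)" for \<omega>
      by (rule has_bochner_integral_bounded_linear[OF bounded_linear_matrix_vector_left g1o(3)[OF t]]) simp
    have moment: "(\<integral>\<^sup>+\<omega>'. ennreal ((norm (dg1s (z (Suc t) \<omega>) (zeta1 0 t \<omega>') *v lam t \<omega>))^2) \<partial>M)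
        \<le> ennreal (Cg1^2 * (norm (lam t \<omega>))^2)" for \<omega>
    proof -
      let ?d = "\<lambda>\<omega>'. dg1s (z (Suc t) \<omega>) (zeta1 0 t \<omega>')"
      have [measurable]: "?d \<in> borel_measurable M"
        using g1o(3)[OF t, of 0 "z (Suc t) \<omega>"] by (auto simp: has_bochner_integral_iff)
      have "(\<integral>\<^sup>+\<omega>'. ennreal ((norm (?d \<omega>' *v lam t \<omega>))^2) \<partial>M)
          \<le> (\<integral>\<^sup>+\<omega>'. ennreal ((norm (?d \<omega>'))^2) * ennreal ((norm (lam t \<omega>))^2) \<partial>M)"
        by (intro nn_integral_mono)
           (auto simp flip: ennreal_mult power_mult_distrib intro!: ennreal_leI power_mono norm_matrix_vector_le)
      also have "\<dots> = (\<integral>\<^sup>+\<omega>'. ennreal ((norm (?d \<omega>'))^2) \<partial>M) * ennreal ((norm (lam t \<omega>))^2)"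
        by (rule nn_integral_multc) measurable
      also have "\<dots> \<le> ennreal (Cg1^2) * ennreal ((norm (lam t \<omega>))^2)"
        by (intro mult_right_mono second_moment_leD g1o(4) t) auto
      also have "\<dots> = ennreal (Cg1^2 * (norm (lam t \<omega>))^2)" by (simp add: ennreal_mult)
      finally show ?thesis .
    qed
    have kI: "integrable M (\<lambda>\<omega>. Cg1^2 * (norm (lam t \<omega>))^2)" using square_integrableD(2)[OF lsq[OF tN]] by simp
    have km: "(\<lambda>\<omega>. Cg1^2 * (norm (lam t \<omega>))^2) \<in> borel_measurable (hist (full t))" by measurable
    note G = composite_gradient_oracle[where J = "full t" and ?i1.0 = "Zeta1 0 t" and ?i2.0 = "Zeta2 0 t"
        and ?S1.0 = "zeta1 0 t" and ?S2.0 = "zeta2 0 t" and P = dg2s and U = X and h = g2 and C = Cg2 and xt = "x t"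
        and v = xstar and D = DX and Rv = "\<lambda>\<omega> s. dg1s (z (Suc t) \<omega>) s *v lam t \<omega>"
        and Rb = "\<lambda>\<omega>. dg1 (z (Suc t) \<omega>) *v lam t \<omega>"
        and \<kappa> = "\<lambda>\<omega>. Cg1^2 * (norm (lam t \<omega>))^2" and B = "sqrt 2 * Cg2 * DX",
        OF sub(2)[OF t] fresh(7)[OF t] fresh(8)[OF t] _ sample(3)[OF t] sample(4)[OF t] oracles(8)
          g2o(3)[OF t] g2o(4)[OF t] xf xX[OF tN] dX[OF tN] Rv mean
          moment Rsq Rb mono le kI km g2_meas g2_bd[OF tN], simplified]
    show "square_integrable (pG t)"
      "expectation (\<lambda>\<omega>. (dg1 (z (Suc t) \<omega>) *v lam t \<omega>) \<bullet> (g2 (x t \<omega>) - g2 xstar)) \<le> expectation (\<lambda>\<omega>. pG t \<omega> \<bullet> (x t \<omega> - xstar))"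
      "expectation (\<lambda>\<omega>. (norm (pG t \<omega>))^2) \<le> (Cg1 * Cg2)^2 * expectation (\<lambda>\<omega>. (norm (lam t \<omega>))^2)"
      using G unfolding pG_def by (simp_all add: power_mult_distrib mult_ac)
  qed
  have w: "square_integrable (w t)"
      "expectation (\<lambda>\<omega>. (norm (w t \<omega>))^2)
        \<le> 2 * (Cf1 * Cf2)^2 + 2 * (Cg1 * Cg2)^2 * expectation (\<lambda>\<omega>. (norm (lam t \<omega>))^2)" if t: "t < N" for t
  proof -
    note i = square_integrableD(2)[OF pF(1)[OF t]] square_integrableD(2)[OF pG(1)[OF t]]
    show wsq: "square_integrable (w t)"
      using square_integrable_add[OF pF(1)[OF t] pG(1)[OF t]] by (simp add: w_eq[abs_def])
    have sq: "(norm (a + b))^2 \<le> 2 * (norm a)^2 + 2 * (norm b)^2" for a b :: "real^'x"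
      using zero_le_power2[of "norm (a - b)"] unfolding power2_norm_eq_inner
      by (simp add: inner_diff_left inner_diff_right inner_add_left inner_add_right inner_commute)
    have "expectation (\<lambda>\<omega>. (norm (w t \<omega>))^2) \<le> expectation (\<lambda>\<omega>. 2 * (norm (pF t \<omega>))^2 + 2 * (norm (pG t \<omega>))^2)"
      using i square_integrableD(2)[OF wsq] by (intro integral_mono) (auto simp: w_eq sq)
    also have "\<dots> = 2 * expectation (\<lambda>\<omega>. (norm (pF t \<omega>))^2) + 2 * expectation (\<lambda>\<omega>. (norm (pG t \<omega>))^2)"
      using i by simp
    also have "\<dots> \<le> 2 * (Cf1 * Cf2)^2 + 2 * ((Cg1 * Cg2)^2 * expectation (\<lambda>\<omega>. (norm (lam t \<omega>))^2))"
      by (intro add_mono mult_left_mono pF(2) pG(2) t) auto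
    finally show "expectation (\<lambda>\<omega>. (norm (w t \<omega>))^2)
        \<le> 2 * (Cf1 * Cf2)^2 + 2 * (Cg1 * Cg2)^2 * expectation (\<lambda>\<omega>. (norm (lam t \<omega>))^2)" by simp
  qed
  have drift: "integrable M (\<lambda>\<omega>. (1 *\<^sub>R df1 (y (Suc t) \<omega>)) \<bullet> (f2 (x t \<omega>) - f2 xstar)
          + (dg1 (z (Suc t) \<omega>) *v lam t \<omega>) \<bullet> (g2 (x t \<omega>) - g2 xstar) - w t \<omega> \<bullet> (x t \<omega> - xstar))"
      "expectation (\<lambda>\<omega>. (1 *\<^sub>R df1 (y (Suc t) \<omega>)) \<bullet> (f2 (x t \<omega>) - f2 xstar)
          + (dg1 (z (Suc t) \<omega>) *v lam t \<omega>) \<bullet> (g2 (x t \<omega>) - g2 xstar) - w t \<omega> \<bullet> (x t \<omega> - xstar)) \<le> 0"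
    if t: "t < N" for t
  proof -
    have tN: "t \<le> N" using t by simp
    have dsq: "square_integrable (\<lambda>\<omega>. x t \<omega> - xstar)"
      by (rule square_integrable_bounded[OF borel_measurable_diff[OF toM[OF xm[OF tN]] borel_measurable_const] dX[OF tN]])
    note I = square_integrable_inner[OF pF(4)[OF t] square_integrable_diff[OF f2sq[OF tN] square_integrable_const[of "f2 xstar"]]]
      square_integrable_inner[OF pG(4)[OF t] square_integrable_diff[OF g2sq[OF tN] square_integrable_const[of "g2 xstar"]]]
      square_integrable_inner[OF pF(1)[OF t] dsq] square_integrable_inner[OF pG(1)[OF t] dsq]
    show "integrable M (\<lambda>\<omega>. (1 *\<^sub>R df1 (y (Suc t) \<omega>)) \<bullet> (f2 (x t \<omega>) - f2 xstar)
          + (dg1 (z (Suc t) \<omega>) *v lam t \<omega>) \<bullet> (g2 (x t \<omega>) - g2 xstar) - w t \<omega> \<bullet> (x t \<omega> - xstar))"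
      unfolding w_eq inner_add_left scaleR_one
      by (intro Bochner_Integration.integrable_add Bochner_Integration.integrable_diff I)
    have "expectation (\<lambda>\<omega>. (1 *\<^sub>R df1 (y (Suc t) \<omega>)) \<bullet> (f2 (x t \<omega>) - f2 xstar)
          + (dg1 (z (Suc t) \<omega>) *v lam t \<omega>) \<bullet> (g2 (x t \<omega>) - g2 xstar) - w t \<omega> \<bullet> (x t \<omega> - xstar))
      = expectation (\<lambda>\<omega>. df1 (y (Suc t) \<omega>) \<bullet> (f2 (x t \<omega>) - f2 xstar))
        + expectation (\<lambda>\<omega>. (dg1 (z (Suc t) \<omega>) *v lam t \<omega>) \<bullet> (g2 (x t \<omega>) - g2 xstar))
        - (expectation (\<lambda>\<omega>. pF t \<omega> \<bullet> (x t \<omega> - xstar)) + expectation (\<lambda>\<omega>. pG t \<omega> \<bullet> (x t \<omega> - xstar)))"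
      unfolding w_eq inner_add_left scaleR_one
      by (subst Bochner_Integration.integral_diff Bochner_Integration.integral_add,
          intro Bochner_Integration.integrable_add Bochner_Integration.integrable_diff I,
          (intro Bochner_Integration.integrable_add Bochner_Integration.integrable_diff I)?)+ (rule refl)
    also have "\<dots> \<le> 0" using pF(3)[OF t] pG(3)[OF t] by linarith
    finally show "expectation (\<lambda>\<omega>. (1 *\<^sub>R df1 (y (Suc t) \<omega>)) \<bullet> (f2 (x t \<omega>) - f2 xstar)
          + (dg1 (z (Suc t) \<omega>) *v lam t \<omega>) \<bullet> (g2 (x t \<omega>) - g2 xstar) - w t \<omega> \<bullet> (x t \<omega> - xstar)) \<le> 0" .
  qed

  \<comment> \<open>Raising one coordinate of \<open>lstar\<close> does not increase the Lagrangian.\<close>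
  have Gxs: "g1 (g2 xstar) \<le> 0"
  proof -
    have "G xstar $ j \<le> 0" for j
    proof -
      have "0 \<le> lstar + axis j 1" using lstar by (auto simp: less_eq_vec_def axis_def)
      hence "Lagr xstar (lstar + axis j 1) \<le> Lagr xstar lstar" using saddle xstar by blast
      thus ?thesis by (simp add: Lagr_def inner_add_right inner_axis)
    qed
    thus ?thesis by (simp add: less_eq_vec_def G_def)
  qed
  \<comment> \<open>Comparing \<open>lstar\<close> with \<open>0\<close> shows that the multiplier term at \<open>xstar\<close> is nonnegative.\<close>
  have saddle_gap: "0 \<le> F u - F xstar + G u \<bullet> lstar" if u: "u \<in> X" for u
  proof -
    have "Lagr xstar 0 \<le> Lagr xstar lstar" using saddle xstar by blast
    moreover have "Lagr xstar lstar \<le> Lagr u lstar" using saddle u lstar by blast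
    ultimately show ?thesis by (simp add: Lagr_def)
  qed

  define s where "s = sqrt (real N)"
  have s0: "0 < s" and sN: "s * s = real N" using N by (auto simp: s_def)
  define cf cg where "cf = Cf1 * Cf2" and "cg = Cg1 * Cg2"
  have c0: "0 < cf" "0 < cg" using positive by (auto simp: cf_def cg_def)
  have eta: "\<eta> t = 15 * cg^2 * sqrt N / 2" "\<alpha> t = 2 * sqrt N" if "t < N" for t
    using steps that by (auto simp: cg_def power_mult_distrib)
  have eta0: "0 < 15 * cg^2 * sqrt N / 2" "0 < 2 * sqrt N" using c0 N by auto
  define \<Lambda> where "\<Lambda> t = expectation (\<lambda>\<omega>. (norm (lam t \<omega>))^2)" for t
  have \<Lambda>0: "0 \<le> \<Lambda> t" for t by (simp add: \<Lambda>_def)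
  define xb where "xb n \<omega> = (1 / real n) *\<^sub>R (\<Sum>t=1..n. x t \<omega>)" for n \<omega>
  have xbX: "xb n \<omega> \<in> X" if "0 < n" "n \<le> N" for n \<omega>
  proof -
    have "(\<Sum>t=1..n. (1 / real n) *\<^sub>R x t \<omega>) \<in> X"
      using that xX by (intro convex_sum[OF _ X(2)]) auto
    thus ?thesis by (simp add: xb_def scaleR_right.sum)
  qed
  define a where "a = 15 * cg^2 / 4 * (norm (x0 - xstar))^2 + 2 * cf^2 / (15 * cg^2) + (2 * (cg * DX)^2 + \<sigma>H^2) / 2
      + 2 * (cf * DX) + (2 * (Cf1 * \<sigma>f2) + 2 * (Lf1 * \<sigma>f2^2))"
  define b where "b = 2 * (cg * DX) + (2 * (Cg1 * \<sigma>g2) + 2 * (Lg1 * \<sigma>g2^2) + \<sigma>H)"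
  \<comment> \<open>All \<open>n \<le> N\<close> are needed: the smaller ones for the moments of the multipliers.\<close>
  have gap: "\<exists>W V. integrable M W \<and> integrable M V \<and>
      (\<forall>\<omega> l K. 0 \<le> l \<longrightarrow> norm l \<le> K \<longrightarrow> n * (F (xb n \<omega>) - F xstar + G (xb n \<omega>) \<bullet> l) + s * (norm (lam n \<omega> - l))^2
          \<le> s * (norm l)^2 + W \<omega> + K * V \<omega>) \<and>
      expectation W \<le> s * (a + 2 / 15 * ((\<Sum>t<n. \<Lambda> t) / N)) \<and> expectation V \<le> s * b"
    if n: "0 < n" "n \<le> N" for n
  proof -
    have tn: "t < N" if "t < n" for t using that n by simp
    have tle: "t \<le> N" if "t \<le> n" for t using that n by simp
    have x00: "x 0 \<omega> = x0" for \<omega> using init by simp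
    have Dd: "norm (u - xstar) \<le> DX" if "u \<in> X" for u using diam that by blast
    have sg: "0 \<le> \<sigma>f2" "0 \<le> \<sigma>g2" "0 \<le> \<sigma>H" using positive by auto
    have xs: "x (Suc t) \<omega> = closest_point X (x t \<omega> - (1 / (15 * cg^2 * sqrt N / 2)) *\<^sub>R w t \<omega>)" if "t < n" for t \<omega>
      using x_step'[OF tn[OF that]] eta(1)[OF tn[OF that]] by simp
    have l00: "lam 0 \<omega> = 0" for \<omega> using init lam0 by simp
    have ls: "lam (Suc t) \<omega> = pos_part (lam t \<omega> + (1 / (2 * sqrt N)) *\<^sub>R (g.lin (z (Suc t) \<omega>) (g2 (x t \<omega>)) + \<delta> t \<omega>))"
      if "t < n" for t \<omega>
      using lam_step tn[OF that] eta(2)[OF tn[OF that]] by (simp add: \<delta>_def)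
    have m: "(\<lambda>\<omega>. f2 (x r \<omega>)) \<in> borel_measurable (hist (past t))" "(\<lambda>\<omega>. g2 (x r \<omega>)) \<in> borel_measurable (hist (past t))"
      "y r \<in> borel_measurable (hist (past t))" "z r \<in> borel_measurable (hist (past t))" if "r \<le> t" "t < n" for r t
    proof -
      have r: "r \<le> N" and p: "past r \<subseteq> past t" using that n past_mono by auto
      show "(\<lambda>\<omega>. f2 (x r \<omega>)) \<in> borel_measurable (hist (past t))" "(\<lambda>\<omega>. g2 (x r \<omega>)) \<in> borel_measurable (hist (past t))"
        by (rule comp_meas(3,4)[OF hist_mono[OF xm[OF r] p past_I]])+
      show "y r \<in> borel_measurable (hist (past t))" "z r \<in> borel_measurable (hist (past t))"
        by (rule hist_mono[OF ym[OF r] p past_I] hist_mono[OF zm[OF r] p past_I])+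
    qed
    have lh: "lam t \<in> borel_measurable (hist (half t))" if "t < n" for t
      using hist_mono[OF lm sub(3) sub(1)] tn[OF that] by simp
    have lsq': "square_integrable (lam t)" if "t < n" for t using lsq tn[OF that] by simp
    note prem = n(1) xX[OF tle] x00 xstar Gxs Dd eta0 sg y_rec[OF tn] z_rec[OF tn] xs l00 ls past_I sub(1)[OF tn]
      ef[OF tn] efm[OF _ tn] eg[OF tn] egm[OF _ tn] du[OF tn] dv[OF tn] dm[OF _ tn] m lh lsq' w[OF tn] drift[OF tn]
    have "\<exists>W V. integrable M W \<and> integrable M V \<and>
    (\<forall>\<omega> l K. 0 \<le> l \<longrightarrow> norm l \<le> K \<longrightarrow>
       n * (f1 (f2 ((1 / n) *\<^sub>R (\<Sum>t=1..n. x t \<omega>))) - f1 (f2 xstar) + g1 (g2 ((1 / n) *\<^sub>R (\<Sum>t=1..n. x t \<omega>))) \<bullet> l)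
         + 2 * sqrt N / 2 * (norm (lam n \<omega> - l))^2 \<le> 2 * sqrt N / 2 * (norm l)^2 + W \<omega> + K * V \<omega>) \<and>
    expectation W \<le> 15 * cg^2 * sqrt N / 2 / 2 * (norm (x0 - xstar))^2
      + ((Cf1 * Cf2)^2 * n + (Cg1 * Cg2)^2 * (\<Sum>t<n. expectation (\<lambda>\<omega>. (norm (lam t \<omega>))^2))) / (15 * cg^2 * sqrt N / 2)
      + (2 * (Cg1 * Cg2 * DX)^2 + \<sigma>H^2) * n / (2 * sqrt N)
      + 2 * sqrt 2 * Cf1 * Cf2 * DX + sqrt n * (2 * Cf1 * \<sigma>f2 + 2 * Lf1 * \<sigma>f2^2) \<and>
    expectation V \<le> 2 * sqrt 2 * Cg1 * Cg2 * DX + sqrt n * (2 * Cg1 * \<sigma>g2 + 2 * Lg1 * \<sigma>g2^2 + \<sigma>H)"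
      by (rule expected_gap[where w = w and J = past and J' = half and \<epsilon>f = \<epsilon>f and \<epsilon>g = \<epsilon>g and \<delta> = \<delta> and y = y and z = z])
         (assumption | rule prem)+
    then obtain W V where WV: "integrable M W" "integrable M V"
      "\<And>\<omega> l K. 0 \<le> l \<Longrightarrow> norm l \<le> K \<Longrightarrow>
         n * (F (xb n \<omega>) - F xstar + G (xb n \<omega>) \<bullet> l) + s * (norm (lam n \<omega> - l))^2 \<le> s * (norm l)^2 + W \<omega> + K * V \<omega>"
      and WE: "expectation W \<le> 15 * cg^2 * sqrt N / 2 / 2 * (norm (x0 - xstar))^2
        + (cf^2 * n + cg^2 * (\<Sum>t<n. \<Lambda> t)) / (15 * cg^2 * sqrt N / 2)
        + (2 * (cg * DX)^2 + \<sigma>H^2) * n / (2 * sqrt N)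
        + 2 * sqrt 2 * (cf * DX) + sqrt n * (2 * (Cf1 * \<sigma>f2) + 2 * (Lf1 * \<sigma>f2^2))"
      and VE: "expectation V \<le> 2 * sqrt 2 * (cg * DX) + sqrt n * (2 * (Cg1 * \<sigma>g2) + 2 * (Lg1 * \<sigma>g2^2) + \<sigma>H)"
      unfolding F_def G_def xb_def s_def \<Lambda>_def cf_def cg_def by (auto simp: mult.assoc)
    note WE
    also have "15 * cg^2 * sqrt N / 2 / 2 * (norm (x0 - xstar))^2
        + (cf^2 * n + cg^2 * (\<Sum>t<n. \<Lambda> t)) / (15 * cg^2 * sqrt N / 2)
        + (2 * (cg * DX)^2 + \<sigma>H^2) * n / (2 * sqrt N)
        + 2 * sqrt 2 * (cf * DX) + sqrt n * (2 * (Cf1 * \<sigma>f2) + 2 * (Lf1 * \<sigma>f2^2))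
      \<le> s * (15 * cg^2 / 4 * (norm (x0 - xstar))^2 + 2 * cf^2 / (15 * cg^2) + 2 / 15 * ((\<Sum>t<n. \<Lambda> t) / N)
        + (2 * (cg * DX)^2 + \<sigma>H^2) / 2 + 2 * (cf * DX) + (2 * (Cf1 * \<sigma>f2) + 2 * (Lf1 * \<sigma>f2^2)))"
      unfolding s_def using n N c0 positive \<Lambda>0 by (intro scaled_gap_bound) (auto intro!: sum_nonneg)
    also have "\<dots> = s * (a + 2 / 15 * ((\<Sum>t<n. \<Lambda> t) / N))" unfolding a_def by (simp add: algebra_simps)
    finally have WE': "expectation W \<le> s * (a + 2 / 15 * ((\<Sum>t<n. \<Lambda> t) / N))" .
    note VE
    also have "2 * sqrt 2 * (cg * DX) + sqrt n * (2 * (Cg1 * \<sigma>g2) + 2 * (Lg1 * \<sigma>g2^2) + \<sigma>H) \<le> s * b"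
    proof -
      have "sqrt 2 * (2 * (cg * DX)) \<le> s * (2 * (cg * DX))"
        unfolding s_def using N c0 positive by (intro mult_right_mono) auto
      moreover have "sqrt n * (2 * (Cg1 * \<sigma>g2) + 2 * (Lg1 * \<sigma>g2^2) + \<sigma>H) \<le> s * (2 * (Cg1 * \<sigma>g2) + 2 * (Lg1 * \<sigma>g2^2) + \<sigma>H)"
        unfolding s_def using n positive by (intro mult_right_mono) auto
      ultimately show ?thesis unfolding b_def by (simp add: algebra_simps)
    qed
    finally have VE': "expectation V \<le> s * b" .
    show ?thesis using WV WE' VE' by blast
  qed

  define m where "m = norm lstar"
  have m0: "0 \<le> m" by (simp add: m_def)
  have R_eq: "R = 7 * cf^2 / cg^2 + 6 * m^2 + ((cg * DX)^2 + \<sigma>H^2) / 2 + 15 * cg^2 / 4 * (norm (x0 - xstar))^2 + m^2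
        + (2 * (Lg1 * \<sigma>g2^2) * m + 3 * (Cg1 * \<sigma>g2) * m + m * \<sigma>H + 2 * (Lf1 * \<sigma>f2^2) + 3 * (Cf1 * \<sigma>f2))"
    unfolding R_def Q_def m_def lam0 cf_def cg_def by (simp add: power_mult_distrib mult_ac)
  note cb = constants_bound[of cg m "(norm (x0 - xstar))^2" "Lf1 * \<sigma>f2^2" "Cf1 * \<sigma>f2" "Lg1 * \<sigma>g2^2" "Cg1 * \<sigma>g2" \<sigma>H cf DX,
      folded R_eq a_def b_def]
  have nn: "0 \<le> (norm (x0 - xstar))^2" "0 \<le> Lf1 * \<sigma>f2^2" "0 \<le> Cf1 * \<sigma>f2" "0 \<le> Lg1 * \<sigma>g2^2" "0 \<le> Cg1 * \<sigma>g2" "0 \<le> \<sigma>H"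
    using positive by auto
  note cb = cb[OF c0(2) m0 nn]
  \<comment> \<open>For \<open>l = lstar\<close> the gap is nonnegative, which leaves a bound on the multipliers.\<close>
  have rec: "\<Lambda> n \<le> (6 * R + 2 * m^2) + 4 / 15 * ((\<Sum>t<n. \<Lambda> t) / N)" if n: "0 < n" "n \<le> N" for n
  proof -
    obtain W V where WV: "integrable M W" "integrable M V"
      and path: "\<And>\<omega> l K. 0 \<le> l \<Longrightarrow> norm l \<le> K \<Longrightarrow>
         n * (F (xb n \<omega>) - F xstar + G (xb n \<omega>) \<bullet> l) + s * (norm (lam n \<omega> - l))^2 \<le> s * (norm l)^2 + W \<omega> + K * V \<omega>"
      and WE: "expectation W \<le> s * (a + 2 / 15 * ((\<Sum>t<n. \<Lambda> t) / N))" and VE: "expectation V \<le> s * b"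
      using gap[OF n] by blast
    have dsq: "square_integrable (\<lambda>\<omega>. lam n \<omega> - lstar)"
      by (intro square_integrable_diff lsq n square_integrable_const)
    have pw: "s * (norm (lam n \<omega> - lstar))^2 \<le> s * m^2 + W \<omega> + m * V \<omega>" for \<omega>
    proof -
      have "0 \<le> n * (F (xb n \<omega>) - F xstar + G (xb n \<omega>) \<bullet> lstar)"
        using saddle_gap[OF xbX[OF n]] by (intro mult_nonneg_nonneg) auto
      thus ?thesis using path[of lstar m \<omega>] lstar by (simp add: m_def)
    qed
    have "s * expectation (\<lambda>\<omega>. (norm (lam n \<omega> - lstar))^2) = expectation (\<lambda>\<omega>. s * (norm (lam n \<omega> - lstar))^2)"
      by simp
    also have "\<dots> \<le> expectation (\<lambda>\<omega>. s * m^2 + W \<omega> + m * V \<omega>)"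
      using square_integrableD(2)[OF dsq] WV pw by (intro integral_mono) auto
    also have "\<dots> = s * m^2 + expectation W + m * expectation V" using WV by (simp add: prob_space)
    also have "\<dots> \<le> s * m^2 + s * (a + 2 / 15 * ((\<Sum>t<n. \<Lambda> t) / N)) + m * (s * b)"
      by (intro add_mono mult_left_mono WE VE m0 order_refl)
    also have "\<dots> = s * ((m^2 + a + m * b) + 2 / 15 * ((\<Sum>t<n. \<Lambda> t) / N))" by (simp add: algebra_simps)
    finally have "expectation (\<lambda>\<omega>. (norm (lam n \<omega> - lstar))^2) \<le> (m^2 + a + m * b) + 2 / 15 * ((\<Sum>t<n. \<Lambda> t) / N)"
      using s0 by (subst (asm) mult_le_cancel_left_pos) auto
    hence D: "expectation (\<lambda>\<omega>. (norm (lam n \<omega> - lstar))^2) \<le> 3 * R + 2 / 15 * ((\<Sum>t<n. \<Lambda> t) / N)"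
      using cb(1) by linarith
    have sq: "(norm l)^2 \<le> 2 * (norm (l - lstar))^2 + 2 * m^2" for l
      using zero_le_power2[of "norm (l - 2 *\<^sub>R lstar)"] unfolding m_def power2_norm_eq_inner
      by (simp add: inner_diff_left inner_diff_right inner_commute)
    have "\<Lambda> n \<le> expectation (\<lambda>\<omega>. 2 * (norm (lam n \<omega> - lstar))^2 + 2 * m^2)"
      unfolding \<Lambda>_def using square_integrableD(2)[OF dsq] square_integrableD(2)[OF lsq[OF n(2)]] sq
      by (intro integral_mono) auto
    also have "\<dots> = 2 * expectation (\<lambda>\<omega>. (norm (lam n \<omega> - lstar))^2) + 2 * m^2"
      using square_integrableD(2)[OF dsq] by (simp add: prob_space)
    finally show ?thesis using D by linarith
  qed
  have \<Lambda>_zero: "\<Lambda> 0 = 0" using init lam0 by (simp add: \<Lambda>_def)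
  \<comment> \<open>\<open>B = 9 R\<close> works since \<open>m^2 \<le> R / 7\<close> and \<open>6 + 2/7 + 36/15 < 9\<close>.\<close>
  have S_le: "(\<Sum>t<N. \<Lambda> t) / N \<le> 9 * R"
    by (rule averaged_recursion_bound(2)[where a = "6 * R + 2 * m^2" and c = "4 / 15", OF rec])
       (use cb(2,3) \<Lambda>_zero in auto)

  have N0: "0 < N" "N \<le> N" using N by auto
  obtain W V where WV: "integrable M W" "integrable M V"
      and path: "\<And>\<omega> l K. 0 \<le> l \<Longrightarrow> norm l \<le> K \<Longrightarrow>
         N * (F (xb N \<omega>) - F xstar + G (xb N \<omega>) \<bullet> l) + s * (norm (lam N \<omega> - l))^2 \<le> s * (norm l)^2 + W \<omega> + K * V \<omega>"
      and WE: "expectation W \<le> s * (a + 2 / 15 * ((\<Sum>t<N. \<Lambda> t) / N))" and VE: "expectation V \<le> s * b"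
    using gap[OF N0] by blast
  have WE': "expectation W \<le> s * (a + 6 / 5 * R)"
  proof -
    have "a + 2 / 15 * ((\<Sum>t<N. \<Lambda> t) / N) \<le> a + 6 / 5 * R" using S_le by linarith
    thus ?thesis using WE s0 by (meson mult_left_mono less_imp_le order_trans)
  qed
  have xb_eq: "xbar \<omega> = xb N \<omega>" for \<omega> by (simp add: xbar_def xb_def)
  have xbarX: "xbar \<omega> \<in> X" for \<omega> unfolding xb_eq by (rule xbX[OF N0])
  have xbar_meas: "xbar \<in> borel_measurable M"
  proof -
    have [measurable]: "x t \<in> borel_measurable M" if "t \<in> {1..N}" for t
      using that by (intro toM[OF xm]) auto
    have "(\<lambda>\<omega>. (1 / real N) *\<^sub>R (\<Sum>t=1..N. x t \<omega>)) \<in> borel_measurable M" by measurable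
    thus ?thesis by (simp add: xbar_def[abs_def])
  qed
  have F_cont: "continuous_on UNIV F" by (rule convex_on_continuous[OF open_UNIV F_convex])
  have G_cont: "continuous_on UNIV G" using G_convex by (intro convex_components_continuous) auto
  have compact: "compact X" using X by (simp add: compact_eq_bounded_closed)
  have bounded_int: "integrable M (\<lambda>\<omega>. \<phi> (xbar \<omega>))" if "continuous_on UNIV \<phi>" for \<phi> :: "real^'x \<Rightarrow> real"
  proof -
    have "bounded (\<phi> ` X)"
      by (intro compact_imp_bounded compact_continuous_image continuous_on_subset[OF that] compact) auto
    then obtain B where "\<And>u. u \<in> X \<Longrightarrow> norm (\<phi> u) \<le> B" by (auto simp: bounded_iff)
    thus ?thesis
      using xbarX measurable_compose[OF xbar_meas borel_measurable_continuous_onI[OF that]]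
      by (intro integrable_const_bound[where B = B]) auto
  qed
  have FI: "integrable M (\<lambda>\<omega>. F (xbar \<omega>) - F xstar)" using bounded_int[OF F_cont] by simp
  have GI: "integrable M (\<lambda>\<omega>. norm (pos_part (G (xbar \<omega>))))"
    by (rule bounded_int) (intro continuous_on_norm continuous_on_compose2[OF continuous_pos_part[of UNIV] G_cont], auto)
  have scale: "E \<le> c / s" if "N * E \<le> s * c" for E c :: real
  proof -
    have "s * (s * E) \<le> s * c" using that unfolding sN[symmetric] by (simp only: mult.assoc)
    hence "s * E \<le> c" using s0 by (simp only: mult_le_cancel_left_pos)
    thus ?thesis using s0 by (simp add: pos_le_divide_eq mult.commute)
  qed
  have F_bound: "expectation (\<lambda>\<omega>. F (xbar \<omega>) - F xstar) \<le> (a + 6 / 5 * R) / s"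
  proof -
    have "N * (F (xbar \<omega>) - F xstar) \<le> W \<omega>" for \<omega>
      using path[of 0 0 \<omega>] s0 unfolding xb_eq by (auto intro: order_trans[rotated])
    hence "expectation (\<lambda>\<omega>. N * (F (xbar \<omega>) - F xstar)) \<le> expectation W"
      using FI WV by (intro integral_mono) auto
    hence "N * expectation (\<lambda>\<omega>. F (xbar \<omega>) - F xstar) \<le> s * (a + 6 / 5 * R)" using WE' by simp
    thus ?thesis by (rule scale)
  qed
  have k0: "0 < nlt" using m0 unfolding nlt_def m_def by linarith
  have G_bound: "expectation (\<lambda>\<omega>. norm (pos_part (G (xbar \<omega>)))) \<le> (nlt^2 + (a + 6 / 5 * R) + nlt * b) / s"
  proof -
    have pw: "N * norm (pos_part (G (xbar \<omega>))) \<le> s * nlt^2 + W \<omega> + nlt * V \<omega>" for \<omega>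
    proof -
      define p where "p = pos_part (G (xbar \<omega>))"
      \<comment> \<open>If \<open>p = 0\<close>, then \<open>l = 0\<close> by the convention for division by zero, and the argument still works.\<close>
      define l where "l = (nlt / norm p) *\<^sub>R p"
      have p0: "0 \<le> p" unfolding p_def by (rule pos_part_nonneg)
      have l0: "0 \<le> l" unfolding l_def using p0 k0 by (auto simp: less_eq_vec_def)
      have ln: "norm l \<le> nlt" using k0 by (simp add: l_def)
      have Gp: "G (xbar \<omega>) \<bullet> p = (norm p)^2" unfolding p_def by (rule pos_part_inner_self)
      hence Gl: "G (xbar \<omega>) \<bullet> l = nlt * norm p" by (simp add: l_def power2_eq_square)
      have "G (xbar \<omega>) \<bullet> lstar \<le> p \<bullet> lstar"
        using inner_nonneg_vec[of "p - G (xbar \<omega>)" lstar] pos_part_ge[of "G (xbar \<omega>)"] lstar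
        by (simp add: p_def inner_diff_left)
      also have "\<dots> \<le> norm p * m" unfolding m_def by (rule norm_cauchy_schwarz)
      finally have "- (norm p * m) \<le> F (xbar \<omega>) - F xstar" using saddle_gap[OF xbarX, of \<omega>] by simp
      hence "norm p \<le> F (xbar \<omega>) - F xstar + G (xbar \<omega>) \<bullet> l"
        unfolding Gl by (simp add: nlt_def m_def algebra_simps)
      hence "N * norm p \<le> N * (F (xbar \<omega>) - F xstar + G (xbar \<omega>) \<bullet> l)" by (intro mult_left_mono) auto
      also have "\<dots> \<le> s * (norm l)^2 + W \<omega> + nlt * V \<omega>"
        using path[OF l0 ln, of \<omega>] s0 unfolding xb_eq by (auto intro: order_trans[rotated])
      also have "\<dots> \<le> s * nlt^2 + W \<omega> + nlt * V \<omega>"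
        using s0 ln by (intro add_right_mono mult_left_mono power_mono) auto
      finally show ?thesis by (simp add: p_def)
    qed
    hence "expectation (\<lambda>\<omega>. N * norm (pos_part (G (xbar \<omega>)))) \<le> expectation (\<lambda>\<omega>. s * nlt^2 + W \<omega> + nlt * V \<omega>)"
      using GI WV by (intro integral_mono) auto
    also have "\<dots> = s * nlt^2 + expectation W + nlt * expectation V" using WV by (simp add: prob_space)
    also have "\<dots> \<le> s * nlt^2 + s * (a + 6 / 5 * R) + nlt * (s * b)"
      using k0 by (intro add_mono mult_left_mono WE' VE order_refl) auto
    finally have "N * expectation (\<lambda>\<omega>. norm (pos_part (G (xbar \<omega>)))) \<le> s * (nlt^2 + (a + 6 / 5 * R) + nlt * b)"
      by (simp add: algebra_simps)
    thus ?thesis by (rule scale)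
  qed
  have e2: "4 \<le> (exp 1 :: real)^2"
    using power_mono[of 2 "exp 1 :: real" 2] exp_ge_add_one_self[of 1] by simp
  have Re: "8 * R \<le> 2 * R * (exp 1)^2" using mult_left_mono[OF e2, of "2 * R"] cb(3) by simp
  have F_num: "a + 6 / 5 * R
      \<le> (15 * Cg1^2 * Cg2^2 / 4 * (norm (x0 - xstar))^2 + 7 * Cf1^2 * Cf2^2 / (Cg1^2 * Cg2^2)
          + (DX^2 * Cg1^2 * Cg2^2 + \<sigma>H^2) / 2 + 2 * Lf1 * \<sigma>f2^2 + 3 * Cf1 * \<sigma>f2)
        + 4 / 3 * ((norm lstar)^2 + 2 * R * (exp 1)^2)"
  proof -
    have "0 \<le> 15 * Cg1^2 * Cg2^2 / 4 * (norm (x0 - xstar))^2" "0 \<le> 7 * Cf1^2 * Cf2^2 / (Cg1^2 * Cg2^2)"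
      "0 \<le> (DX^2 * Cg1^2 * Cg2^2 + \<sigma>H^2) / 2" "0 \<le> 2 * Lf1 * \<sigma>f2^2" "0 \<le> 3 * Cf1 * \<sigma>f2" "0 \<le> (norm lstar)^2"
      using positive by auto
    thus ?thesis using cb(3,4) Re by argo
  qed
  have G_num: "nlt^2 + (a + 6 / 5 * R) + nlt * b
      \<le> (16 / 3 * nlt^2 + 2 * Lg1 * \<sigma>g2^2 * nlt + 3 * Cg1 * \<sigma>g2 * nlt
                + 15 * Cg1^2 * Cg2^2 / 4 * (norm (x0 - xstar))^2 + 7 * Cf1^2 * Cf2^2 / (Cg1^2 * Cg2^2))
        + ((DX^2 * Cg1^2 * Cg2^2 + \<sigma>H^2) / 2 + nlt^2 + \<sigma>H * nlt + 2 * Lf1 * \<sigma>f2^2 + 3 * Cf1 * \<sigma>f2)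
        + (nlt + (norm lstar)^2 + 2 * R * (exp 1)^2)"
  proof -
    have nonneg: "0 \<le> 15 * Cg1^2 * Cg2^2 / 4 * (norm (x0 - xstar))^2" "0 \<le> 7 * Cf1^2 * Cf2^2 / (Cg1^2 * Cg2^2)"
      "0 \<le> (DX^2 * Cg1^2 * Cg2^2 + \<sigma>H^2) / 2" "0 \<le> 2 * Lf1 * \<sigma>f2^2" "0 \<le> 3 * Cf1 * \<sigma>f2" "0 \<le> (norm lstar)^2"
      "0 \<le> nlt^2" "0 \<le> Cg1 * \<sigma>g2 * nlt"
      using positive k0 by auto
    have split: "nlt * (2 * (Cg1 * \<sigma>g2) + 2 * (Lg1 * \<sigma>g2^2) + \<sigma>H)
        = 2 * (Cg1 * \<sigma>g2 * nlt) + 2 * Lg1 * \<sigma>g2^2 * nlt + \<sigma>H * nlt" by (simp add: algebra_simps)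
    have "3 * Cg1 * \<sigma>g2 * nlt = 3 * (Cg1 * \<sigma>g2 * nlt)" by simp
    thus ?thesis using nonneg cb(3) cb(5)[of nlt] Re k0 unfolding split by argo
  qed
  show ?thesis
  proof (intro conjI FI GI)
    show "expectation (\<lambda>\<omega>. F (xbar \<omega>) - F xstar)
           \<le> 1 / sqrt (real N) *
               (15 * Cg1^2 * Cg2^2 / 4 * (norm (x0 - xstar))^2
                + 7 * Cf1^2 * Cf2^2 / (Cg1^2 * Cg2^2)
                + (DX^2 * Cg1^2 * Cg2^2 + \<sigma>H^2) / 2
                + 2 * Lf1 * \<sigma>f2^2 + 3 * Cf1 * \<sigma>f2)
             + 4 / (3 * sqrt (real N)) * ((norm lstar)^2 + 2 * R * (exp 1)^2)"
      (is "_ \<le> 1 / _ * ?A + 4 / (3 * _) * ?B")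
    proof -
      have "(a + 6 / 5 * R) / s \<le> (?A + 4 / 3 * ?B) / s" using F_num s0 by (intro divide_right_mono) auto
      also have "\<dots> = 1 / s * ?A + 4 / (3 * s) * ?B" by (simp add: add_divide_distrib)
      finally show ?thesis using F_bound unfolding s_def by linarith
    qed
    show "expectation (\<lambda>\<omega>. norm (pos_part (G (xbar \<omega>))))
           \<le> 1 / sqrt (real N) *
               (16 / 3 * nlt^2 + 2 * Lg1 * \<sigma>g2^2 * nlt + 3 * Cg1 * \<sigma>g2 * nlt
                + 15 * Cg1^2 * Cg2^2 / 4 * (norm (x0 - xstar))^2
                + 7 * Cf1^2 * Cf2^2 / (Cg1^2 * Cg2^2))
             + 1 / sqrt (real N) *
               ((DX^2 * Cg1^2 * Cg2^2 + \<sigma>H^2) / 2 + nlt^2 + \<sigma>H * nlt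
                + 2 * Lf1 * \<sigma>f2^2 + 3 * Cf1 * \<sigma>f2)
             + 1 / sqrt (real N) * (nlt + (norm lstar)^2 + 2 * R * (exp 1)^2)"
      (is "_ \<le> 1 / _ * ?A + 1 / _ * ?B + 1 / _ * ?C")
    proof -
      have "(nlt^2 + (a + 6 / 5 * R) + nlt * b) / s \<le> (?A + ?B + ?C) / s"
        using G_num s0 by (intro divide_right_mono) auto
      also have "\<dots> = 1 / s * ?A + 1 / s * ?B + 1 / s * ?C" by (simp add: add_divide_distrib)
      finally show ?thesis using G_bound unfolding s_def by linarith
    qed
  qed
qed

end
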